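(* Let $F(w_1,w_2)$ be an odd holomorphic function near the origin of $\mathbb{C}^2$ with $F(w_1,w_2)=O(\|(w_1,w_2)\|^5)$, and let $f(z)=F(z,\bar z)$. Suppose: (1) $g$ is an even $C^1$ function near $0\in\mathbb{C}$, homogeneous of degree $m>3$ (i.e. $g(tz)=t^mg(z)$ for $t>0$); (2) there are an integer $s\ge1$ and homogeneous complex-symmetric polynomials $p_{2s-1}$ and $p_{2s+1}$ of degrees $2s-1$ and $2s+1$ respectively such that $\operatorname{Im}\bigl(\frac{\partial p_{2s-1}}{\partial\zeta_2}(z,\bar z)\,g(z)\bigr)\ge0$ for all $z\in\Gamma$, and $\operatorname{Im}\bigl(\frac{\partial p_{2s+1}}{\partial\zeta_2}(z,\bar z)\,g(z)\bigr)>0$ for all $z\in\Gamma$ at which $\operatorname{Im}\bigl(\frac{\partial p_{2s-1}}{\partial\zeta_2}(z,\bar z)\,g(z)\bigr)=0$, where $\Gamma$ is the unit circle; (3) $h$ is a $C^1$ function defined near the origin with $h(z)=o(z^2g(z))$. Then for every closed disk $D$ centered at $0$ with sufficiently small radius, $$[\,z^2,\ (\bar z+f(z)+g(z)+h(z))^2\,;\,D\,]=C(D).$$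
   Context: For continuous functions $f_1,f_2$ on a compact set $D\subset\mathbb{C}$, $[f_1,f_2;D]$ denotes the uniform closure in $C(D)$ of the set of polynomials (with complex coefficients) in $f_1$ and $f_2$. A homogeneous polynomial $q(\zeta_1,\zeta_2)=\sum_{k=0}^{d}a_k\zeta_1^k\zeta_2^{d-k}$ of degree $d$ is called complex-symmetric if $a_k=\overline{a_{d-k}}$ for all $k=0,\dots,d$. *)

theory Defs
  imports "HOL-Analysis.Analysis" "HOL-Library.Landau_Symbols"
begin

definition poly_gen_dense ::
  "(complex \<Rightarrow> complex) \<Rightarrow> (complex \<Rightarrow> complex) \<Rightarrow> complex set \<Rightarrow> bool" where
  "poly_gen_dense f1 f2 D \<longleftrightarrow>
     (\<forall>\<phi>. continuous_on D \<phi> \<longrightarrow>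
        (\<forall>\<epsilon>>0. \<exists>(N::nat) (c::nat \<Rightarrow> nat \<Rightarrow> complex).
           \<forall>z\<in>D. norm (\<phi> z - (\<Sum>i\<le>N. \<Sum>j\<le>N. c i j * f1 z ^ i * f2 z ^ j)) < \<epsilon>))"

definition holomorphic2_on :: "(complex \<times> complex) set \<Rightarrow> (complex \<times> complex \<Rightarrow> complex) \<Rightarrow> bool" where
  "holomorphic2_on U F \<longleftrightarrow> open U \<and>
     (\<forall>w\<in>U. \<exists>a b. (F has_derivative (\<lambda>v. a * fst v + b * snd v)) (at w))"

definition C1_on :: "complex set \<Rightarrow> (complex \<Rightarrow> complex) \<Rightarrow> bool" where
  "C1_on S g \<longleftrightarrow> (\<exists>g' :: complex \<Rightarrow> (complex \<Rightarrow>\<^sub>L complex).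
      (\<forall>z\<in>S. (g has_derivative blinfun_apply (g' z)) (at z)) \<and> continuous_on S g')"

definition hpoly :: "(nat \<Rightarrow> complex) \<Rightarrow> nat \<Rightarrow> complex \<Rightarrow> complex \<Rightarrow> complex" where
  "hpoly a d \<zeta>1 \<zeta>2 = (\<Sum>k\<le>d. a k * \<zeta>1 ^ k * \<zeta>2 ^ (d - k))"

definition complex_symmetric :: "(nat \<Rightarrow> complex) \<Rightarrow> nat \<Rightarrow> bool" where
  "complex_symmetric a d \<longleftrightarrow> (\<forall>k\<le>d. a k = cnj (a (d - k)))"

definition dpoly2_at :: "(nat \<Rightarrow> complex) \<Rightarrow> nat \<Rightarrow> complex \<Rightarrow> complex" where
  "dpoly2_at a d z = deriv (\<lambda>w. hpoly a d z w) (cnj z)"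

end

theory Submission
  imports Defs "HOL-Complex_Analysis.Complex_Analysis"
begin

text \<open>
  Let \<open>w z = cnj z + F (z, cnj z) + g z + h z\<close> and let \<open>A\<close> be the uniform closure of the polynomials in
  \<open>z\<^sup>2\<close> and \<open>w\<^sup>2\<close> on a small disk \<open>D\<close>. A continuous function with values in the right half-plane
  together with \<open>0\<close> lies in \<open>A\<close> as soon as its square does. Applied to \<open>z * w\<close>, which is close to
  \<open>\<bar>z\<bar>\<^sup>2\<close>, this puts all even polynomials in \<open>z\<close> and \<open>w\<close> into \<open>A\<close>.

  Iterating \<open>\<eta> \<mapsto> w - F (z, \<eta>)\<close> yields an odd uniform limit \<open>\<eta>\<close> of polynomials in \<open>z\<close> and \<open>w\<close> that
  agrees with \<open>cnj z + g z\<close> up to \<open>o(\<bar>z\<bar>\<^sup>2 * \<bar>g z\<bar>)\<close>. Since \<open>p\<close> and \<open>q\<close> are real on \<open>(z, cnj z)\<close>, the imaginary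
  part of \<open>\<Psi> = p (z, \<eta>) + q (z, \<eta>)\<close> is governed by the first-order terms
  \<open>\<partial>p/\<partial>\<zeta>\<^sub>2 * g + \<partial>q/\<partial>\<zeta>\<^sub>2 * g\<close>, and the two sign conditions make it positive off the origin. As \<open>\<Psi>\<close> is odd,
  \<open>\<Psi>\<^sup>2\<close> belongs to \<open>A\<close>, hence so does \<open>\<Psi>\<close>; therefore \<open>A\<close> contains \<open>\<Psi>\<close> times every even and every odd
  polynomial in \<open>z\<close> and \<open>w\<close>. Those polynomials are dense in the continuous functions because \<open>w\<close> is
  a small Lipschitz perturbation of complex conjugation, and \<open>\<Psi>\<close> vanishes only at \<open>0\<close>, so \<open>A\<close>
  contains every continuous function.
\<close>

section \<open>Square roots in uniform algebras\<close>

text \<open>Even polynomials in z and w do not separate (z, w) from (-z, -w), so the crux is to find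
  one useful odd function inside \<open>A\<close>. The sign conditions put \<Psi> into a half-plane,
  where the square root has a continuous branch. F has order 5 while g has an arbitrary degree m >
  3, so F may dominate g and spoil the sign of the imaginary part of p (z, w); for this reason w is
  replaced by \<eta>. Write u = |z|^m. The first-order term of p fixes the sign at order |z|^(2s-2)
  u unless it degenerates, and there q takes over at order |z|^(2s) u, which is thus the unit for
  all errors. An error of size o(|z|^2 u) in \<eta> is negligible in this unit because dp has order
  |z|^(2s-2); this is the tolerance granted to h. The quadratic Taylor terms of p have order
  |z|^(2s-3) u^2 and are negligible exactly because m > 3.\<close>

lemma csqrt_diff_quotient:
  fixes y :: complex and e :: real
  assumes y: "y \<notin> \<real>\<^sub>\<le>\<^sub>0" and y': "y - of_real e \<notin> \<real>\<^sub>\<le>\<^sub>0"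
  shows "csqrt (y - of_real e) = csqrt y * csqrt (1 - of_real e / y)"
proof -
  define a b where "a = csqrt y" and "b = csqrt (y - of_real e)"
  have y0: "y \<noteq> 0" using y by auto
  have a2: "a\<^sup>2 = y" and b2: "b\<^sup>2 = y - of_real e" by (simp_all add: a_def b_def)
  have pa: "Re a > 0" using csqrt_principal[of y] y a2
    by (auto simp: a_def complex_nonpos_Reals_iff power2_eq_square complex_eq_iff)
  have pb: "Re b > 0" using csqrt_principal[of "y - of_real e"] y' b2
    by (auto simp: b_def complex_nonpos_Reals_iff power2_eq_square complex_eq_iff)
  \<comment> \<open>Since \<open>e\<close> is real, both roots have the same product of real and
    imaginary part, so their imaginary parts cannot have opposite signs. Hence \<open>b / a\<close>
    lies in the right half-plane, which identifies it as the principal root; in general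
    \<open>csqrt\<close> is not multiplicative.\<close>
  have "Im (a\<^sup>2) = Im (b\<^sup>2)" by (simp add: a2 b2)
  hence "Re a * Im a = Re b * Im b" by (simp add: power2_eq_square mult.commute)
  hence "Re b * (Im a * Im b) = Re a * (Im a)\<^sup>2" by (simp add: power2_eq_square algebra_simps)
  hence "Re b * (Im a * Im b) \<ge> 0" using pa by simp
  hence im: "Im a * Im b \<ge> 0" using pb by (simp add: zero_le_mult_iff)
  have a0: "a \<noteq> 0" using pa by auto
  have "0 < Re a * Re b + Im a * Im b" using im mult_pos_pos[OF pa pb] by linarith
  moreover have "(Re a)\<^sup>2 + (Im a)\<^sup>2 > 0" using pa by (simp add: add_pos_nonneg)
  ultimately have "Re (b / a) > 0" by (simp add: Re_divide mult.commute)
  moreover have "(b / a)\<^sup>2 = 1 - of_real e / y" using y0 by (simp add: power_divide a2 b2 field_simps)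
  ultimately have "csqrt (1 - of_real e / y) = b / a" by (intro csqrt_unique) auto
  thus ?thesis using a0 by (simp add: a_def b_def)
qed

text \<open>With b the shifted root, \<open>(u - b) * (u + b) = - d\<close>. Both \<open>u\<close>
  and b lie in the closed right half-plane and their imaginary parts do not have opposite signs, so
  \<open>u - b\<close> is the shorter factor and its norm is at most \<open>sqrt d\<close>.\<close>

lemma csqrt_shift_close:
  fixes u :: complex and d :: real
  assumes u: "Re u > 0 \<or> u = 0" and d: "d > 0"
  shows "norm (u - csqrt (u\<^sup>2 + of_real d)) \<le> sqrt d"
proof -
  define b where "b = csqrt (u\<^sup>2 + of_real d)"
  have b2: "b\<^sup>2 = u\<^sup>2 + of_real d" by (simp add: b_def)
  have b0: "Re b \<ge> 0" using csqrt_principal[of "u\<^sup>2 + of_real d"] by (auto simp: b_def)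
  have "Re (cnj u * b) \<ge> 0"
  proof (cases "u = 0")
    case False
    hence pu: "Re u > 0" using u by auto
    have "Im (b\<^sup>2) = Im (u\<^sup>2)" by (simp add: b2)
    hence "Re b * Im b = Re u * Im u" by (simp add: power2_eq_square mult.commute)
    hence "Re u * (Im u * Im b) = Re b * (Im b)\<^sup>2" by (simp add: power2_eq_square algebra_simps)
    hence "Re u * (Im u * Im b) \<ge> 0" using b0 by simp
    hence "Im u * Im b \<ge> 0" using pu by (simp add: zero_le_mult_iff)
    thus ?thesis using b0 pu by simp
  qed simp
  hence "(norm (u - b))\<^sup>2 \<le> (norm (u + b))\<^sup>2"
    by (simp only: cmod_power2) (simp add: power2_eq_square algebra_simps)
  hence le: "norm (u - b) \<le> norm (u + b)" by (rule power2_le_imp_le) simp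
  have "norm (u - b) * norm (u + b) = norm ((u - b) * (u + b))" by (simp add: norm_mult)
  also have "(u - b) * (u + b) = - of_real d" using b2 by (simp add: power2_eq_square algebra_simps)
  finally have "norm (u - b) * norm (u + b) = d" using d by simp
  hence "(norm (u - b))\<^sup>2 \<le> d" using le by (metis mult_left_mono norm_ge_zero power2_eq_square)
  thus ?thesis unfolding b_def by (rule real_le_rsqrt)
qed

text \<open>Members are functions on the whole plane although only their values on \<open>D\<close>
  matter; \<open>closed\<close> makes membership blind to values off \<open>D\<close>, which is what
  \<open>cong\<close> records.\<close>

locale uniform_algebra =
  fixes D :: "complex set" and A :: "(complex \<Rightarrow> complex) set"
  assumes compact_D: "compact D"
    and cont: "u \<in> A \<Longrightarrow> continuous_on D u"
    and const: "(\<lambda>_. c) \<in> A"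
    and add: "u \<in> A \<Longrightarrow> v \<in> A \<Longrightarrow> (\<lambda>z. u z + v z) \<in> A"
    and mult: "u \<in> A \<Longrightarrow> v \<in> A \<Longrightarrow> (\<lambda>z. u z * v z) \<in> A"
    and closed: "(\<And>\<epsilon>. \<epsilon> > 0 \<Longrightarrow> \<exists>v\<in>A. \<forall>z\<in>D. norm (u z - v z) < \<epsilon>) \<Longrightarrow> u \<in> A"
begin

lemma bound:
  assumes "u \<in> A" obtains M where "M > 0" "\<And>z. z \<in> D \<Longrightarrow> norm (u z) \<le> M"
proof -
  have "bounded (u ` D)" using cont[OF assms] compact_D compact_continuous_image compact_imp_bounded by blast
  thus ?thesis using that unfolding bounded_pos by auto
qed

lemma cong: "u \<in> A \<Longrightarrow> (\<And>z. z \<in> D \<Longrightarrow> u z = v z) \<Longrightarrow> v \<in> A"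
  by (rule closed) (auto intro!: bexI[of _ u])

lemma power: "u \<in> A \<Longrightarrow> (\<lambda>z. u z ^ n) \<in> A"
  by (induction n) (auto intro: const mult)

lemma sum: "(\<And>i. i \<in> I \<Longrightarrow> u i \<in> A) \<Longrightarrow> (\<lambda>z. \<Sum>i\<in>I. u i z) \<in> A"
  by (induction I rule: infinite_finite_induct) (auto intro: const add)

lemma power_series:
  assumes x: "x \<in> A" and r: "\<And>z. z \<in> D \<Longrightarrow> norm (x z) \<le> r" "0 \<le> r" "r < 1"
    and f: "\<And>y. norm y < 1 \<Longrightarrow> (\<lambda>n. a n * y ^ n) sums f y"
  shows "(\<lambda>z. f (x z)) \<in> A"
proof (rule closed)
  fix e :: real assume e: "e > 0"
  \<comment> \<open>The midpoint between \<open>r\<close> and 1: convergence at \<open>y\<close>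
    gives a radius of convergence beyond \<open>r\<close>, hence uniform convergence on a closed
    disk that contains all values of \<open>x\<close> on \<open>D\<close>.\<close>
  define y :: complex where "y = of_real ((1 + r) / 2)"
  have ny: "norm y = (1 + r) / 2" unfolding y_def norm_of_real using r by simp
  have "summable (\<lambda>n. a n * y ^ n)" by (rule sums_summable[OF f]) (use r ny in simp)
  hence "conv_radius a \<ge> norm y" by (rule conv_radius_geI)
  moreover have "ereal r < norm y" using ny r by simp
  ultimately have "r < conv_radius a" by (rule less_le_trans[rotated])
  from powser_uniform_limit[OF this, of 0]
  obtain N where N: "\<And>n z. n \<ge> N \<Longrightarrow> z \<in> cball 0 r \<Longrightarrow>
      dist (\<Sum>i<n. a i * z ^ i) (\<Sum>i. a i * z ^ i) < e"
    using e unfolding uniform_limit_iff eventually_sequentially by fastforce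
  show "\<exists>v\<in>A. \<forall>z\<in>D. norm (f (x z) - v z) < e"
  proof (intro bexI[of _ "\<lambda>z. \<Sum>i<N. a i * x z ^ i"] ballI)
    show "(\<lambda>z. \<Sum>i<N. a i * x z ^ i) \<in> A" by (intro sum mult const power x)
    fix z assume z: "z \<in> D"
    have "(\<Sum>i. a i * x z ^ i) = f (x z)"
      using f[of "x z"] r z by (intro sums_unique[symmetric]) force
    thus "norm (f (x z) - (\<Sum>i<N. a i * x z ^ i)) < e"
      using N[of N "x z"] r(1)[OF z] by (simp add: dist_norm norm_minus_commute)
  qed
qed

lemma csqrt_one_plus:
  assumes "x \<in> A" "\<And>z. z \<in> D \<Longrightarrow> norm (x z) \<le> 1/2"
  shows "(\<lambda>z. csqrt (1 + x z)) \<in> A"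
proof -
  have "(\<lambda>n. ((1/2) gchoose n) * y^n) sums csqrt (1 + y)" if "norm y < 1" for y :: complex
  proof -
    have "1 + y \<noteq> 0" using that by (metis add.commute add_eq_0_iff norm_minus_cancel norm_one less_irrefl)
    thus ?thesis using gen_binomial_complex[OF that, of "1/2"] by (simp add: csqrt_conv_powr)
  qed
  from power_series[OF assms(1) _ _ _ this, of "1/2"] assms(2) show ?thesis by simp
qed

lemma inverse_one_minus:
  assumes "x \<in> A" "\<And>z. z \<in> D \<Longrightarrow> norm (x z) \<le> 1/2"
  shows "(\<lambda>z. 1 / (1 - x z)) \<in> A"
proof -
  have "(\<lambda>n. 1 * y^n) sums (1 / (1 - y))" if "norm y < 1" for y :: complex
    using geometric_sums[OF that] by simp
  from power_series[OF assms(1) _ _ _ this, of "1/2"] assms(2) show ?thesis by simp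
qed

text \<open>Analytic continuation along the ray: \<open>csqrt (v + T)\<close> and \<open>1 / (v + T)\<close> are given by
  convergent power series for large \<open>T\<close>, and can be continued down to any \<open>T > 0\<close> in equal steps
  because \<open>v + T\<close> stays away from \<open>0\<close>.\<close>

lemma square_root:
  assumes u: "continuous_on D u" and pos: "\<And>z. z \<in> D \<Longrightarrow> Re (u z) > 0 \<or> u z = 0"
    and sq: "(\<lambda>z. (u z)\<^sup>2) \<in> A"
  shows "u \<in> A"
proof (rule closed)
  fix e :: real assume e: "e > 0"
  \<comment> \<open>The function approximating \<open>u\<close> inside \<open>A\<close> is
    \<open>csqrt (u\<^sup>2 + d)\<close>, at distance at most \<open>sqrt d = e / 2\<close> from
    \<open>u\<close>; the shift keeps the argument of the root off the branch cut.\<close>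
  define d where "d = (e/2)\<^sup>2"
  have d: "d > 0" using e by (simp add: d_def)
  define v where "v = (\<lambda>z. (u z)\<^sup>2)"
  have vA: "v \<in> A" using sq by (simp add: v_def)
  obtain M where M: "M > 0" "\<And>z. z \<in> D \<Longrightarrow> norm (v z) \<le> M" using bound[OF vA] by blast
  have nonpos: "v z + of_real T \<notin> \<real>\<^sub>\<le>\<^sub>0" if z: "z \<in> D" and T: "T \<ge> d" for z T
  proof
    assume "v z + of_real T \<in> \<real>\<^sub>\<le>\<^sub>0"
    hence *: "Re (v z) + T \<le> 0" "Im (v z) = 0" by (auto simp: complex_nonpos_Reals_iff)
    from pos[OF z] show False
    proof
      assume p: "Re (u z) > 0"
      hence "Im (u z) = 0" using *(2) by (simp add: v_def power2_eq_square)
      hence "Re (v z) \<ge> 0" by (simp add: v_def power2_eq_square)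
      thus False using * T d by simp
    next
      assume "u z = 0" thus False using * T d by (simp add: v_def)
    qed
  qed
  \<comment> \<open>\<open>S\<close> is the ray of all \<open>- T\<close> with
    \<open>T \<ge> d\<close>. Its distance \<open>c\<close> from the compact image of
    \<open>D\<close> under \<open>v\<close> bounds |v z + T| from below for all these
    \<open>T\<close> at once.\<close>
  define S where "S = {z. Re z \<le> - d} \<inter> {z. Im z = 0}"
  have clS: "closed S" unfolding S_def
    by (intro closed_Int closed_halfspace_Re_le closed_Collect_eq continuous_intros)
  obtain c where c: "c > 0" "\<And>x y. x \<in> v ` D \<Longrightarrow> y \<in> S \<Longrightarrow> c \<le> dist x y"
  proof -
    have "v ` D \<inter> S = {}" using nonpos[of _ d] by (force simp: S_def complex_nonpos_Reals_iff)
    from separate_compact_closed[OF compact_continuous_image[OF cont[OF vA] compact_D] clS this]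
    show ?thesis using that by auto
  qed
  have low: "c \<le> norm (v z + of_real T)" if "z \<in> D" "T \<ge> d" for z T
    using c(2)[of "v z" "of_real (-T)"] that by (auto simp: S_def dist_norm)
  \<comment> \<open>Since \<open>T0 \<ge> 2 * M\<close>, the quotient \<open>v / T0\<close> has norm
    at most 1/2 and the binomial and geometric series can start the continuation, which covers a
    length of \<open>2 * M\<close> and ends at \<open>d\<close>.\<close>
  define T0 where "T0 = d + 2 * M"
  obtain N :: nat where N: "N > 0" "2 * M / N \<le> c / 2"
  proof -
    obtain N :: nat where "real N > 4 * M / c" using reals_Archimedean2 by blast
    moreover from this have "N > 0" using M(1) c(1) by (metis divide_pos_pos gr0I less_asym mult_pos_pos of_nat_0 zero_less_numeral)
    ultimately show ?thesis using that[of N] c by (simp add: field_simps)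
  qed
  define st where "st = 2 * M / N"
  have st: "st > 0" "st \<le> c / 2" using N M by (auto simp: st_def)
  \<comment> \<open>Root and reciprocal are carried along together: the next root is the old one
    times \<open>csqrt (1 - st / (v + T))\<close>, and forming this argument requires the
    reciprocal. As \<open>st \<le> c / 2\<close>, the quotient has norm at most 1/2 in every
    step.\<close>
  have main: "n \<le> N \<Longrightarrow> (\<lambda>z. csqrt (v z + of_real (T0 - n * st))) \<in> A \<and>
      (\<lambda>z. 1 / (v z + of_real (T0 - n * st))) \<in> A" for n
  proof (induction n)
    case 0
    have T0: "T0 > 0" "T0 \<ge> 2 * M" using d M by (auto simp: T0_def)
    define x where "x = (\<lambda>z. of_real (1 / T0) * v z)"
    have xA: "x \<in> A" unfolding x_def by (intro mult const vA)
    have xb: "norm (x z) \<le> 1/2" if "z \<in> D" for z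
      using M(2)[OF that] T0 by (simp add: x_def norm_mult field_simps norm_divide)
    have eq: "v z + of_real T0 = of_real T0 * (1 + x z)" for z using T0 by (simp add: x_def field_simps)
    have "(\<lambda>z. of_real (sqrt T0) * csqrt (1 + x z)) \<in> A" by (intro mult const csqrt_one_plus xA xb)
    hence 1: "(\<lambda>z. csqrt (v z + of_real T0)) \<in> A"
    proof (rule cong)
      fix z assume z: "z \<in> D"
      have "Re (1 + x z) > 0" using xb[OF z] abs_Re_le_cmod[of "x z"] by simp
      hence "Re (csqrt (1 + x z)) > 0" 
        using csqrt_principal[of "1 + x z"] power2_csqrt[of "1 + x z"]
        by (auto simp del: power2_csqrt csqrt.simps simp: power2_eq_square complex_eq_iff)
      thus "of_real (sqrt T0) * csqrt (1 + x z) = csqrt (v z + of_real T0)"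
        using T0 by (intro csqrt_unique[symmetric])
          (auto simp: eq power_mult_distrib simp flip: of_real_power)
    qed
    have "(\<lambda>z. of_real (1 / T0) * (1 / (1 - (-1) * x z))) \<in> A"
      by (intro mult const inverse_one_minus xA) (use xb in simp)
    hence "(\<lambda>z. 1 / (v z + of_real T0)) \<in> A"
      by (rule cong) (simp add: eq)
    with 1 show ?case by simp
  next
    case (Suc n)
    define T where "T = T0 - n * st"
    have T: "T - st \<ge> d"
    proof -
      have "Suc n * st \<le> N * st" using Suc.prems st by (intro mult_right_mono) auto
      also have "\<dots> = 2 * M" using N by (simp add: st_def)
      finally show ?thesis by (simp add: T_def T0_def algebra_simps)
    qed
    define i where "i = (\<lambda>z. 1 / (v z + of_real T))"
    have iA: "i \<in> A" and sA: "(\<lambda>z. csqrt (v z + of_real T)) \<in> A" using Suc by (auto simp: i_def T_def)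
    have ib: "norm (of_real st * i z) \<le> 1/2" if z: "z \<in> D" for z
    proof -
      have "c \<le> norm (v z + of_real T)" using low[OF z] T st by simp
      hence "2 * st \<le> norm (v z + of_real T)" "0 < norm (v z + of_real T)" using st c(1) by linarith+
      thus ?thesis using st(1) by (simp add: i_def norm_mult norm_divide divide_simps)
    qed
    have eq: "v z + of_real (T - st) = (v z + of_real T) - of_real st" for z by simp
    have nz: "v z + of_real T \<notin> \<real>\<^sub>\<le>\<^sub>0" "v z + of_real T - of_real st \<notin> \<real>\<^sub>\<le>\<^sub>0" if "z \<in> D" for z
      using nonpos[OF that, of T] nonpos[OF that, of "T - st"] T st by (auto simp: algebra_simps)
    have "(\<lambda>z. csqrt (v z + of_real T) * csqrt (1 + of_real (- st) * i z)) \<in> A"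
      by (intro mult csqrt_one_plus const sA iA) (use ib in \<open>simp add: norm_mult\<close>)
    hence 1: "(\<lambda>z. csqrt (v z + of_real (T - st))) \<in> A"
      by (rule cong, unfold eq) (subst csqrt_diff_quotient, use nz in \<open>auto simp: i_def\<close>)
    have "(\<lambda>z. i z * (1 / (1 - of_real st * i z))) \<in> A"
      by (intro mult inverse_one_minus const iA) (use ib in \<open>simp add: norm_mult\<close>)
    hence 2: "(\<lambda>z. 1 / (v z + of_real (T - st))) \<in> A"
    proof (rule cong)
      fix z assume z: "z \<in> D"
      have "v z + of_real T \<noteq> 0" "v z + of_real T - of_real st \<noteq> 0" using nz[OF z] by force+
      thus "i z * (1 / (1 - of_real st * i z)) = 1 / (v z + of_real (T - st))"
        unfolding eq by (simp add: i_def field_simps)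
    qed
    have step: "T0 - Suc n * st = T - st" by (simp add: T_def algebra_simps)
    show ?case unfolding step by (rule conjI[OF 1 2])
  qed
  have "T0 - N * st = d" using N by (simp add: T0_def st_def)
  hence "(\<lambda>z. csqrt ((u z)\<^sup>2 + of_real d)) \<in> A" using main[of N] by (simp add: v_def)
  moreover have "norm (u z - csqrt ((u z)\<^sup>2 + of_real d)) < e" if "z \<in> D" for z
    using csqrt_shift_close[OF pos[OF that] d] e by (simp add: d_def del: csqrt.simps)
  ultimately show "\<exists>v\<in>A. \<forall>z\<in>D. norm (u z - v z) < e"
    by (intro bexI[of _ "\<lambda>z. csqrt ((u z)\<^sup>2 + of_real d)"] ballI)
qed

end

section \<open>Polynomials in two functions\<close>

text \<open>The outer variable is \<open>y\<close>, the coefficients are polynomials in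
  \<open>x\<close>, and \<open>y\<close> is inserted as the constant polynomial
  \<open>[:y:]\<close>. Nesting the type \<open>poly\<close> supplies the ring structure, so that
  sums and products of polynomials in two variables need no manipulation of double sums.\<close>

definition poly2 :: "complex poly poly \<Rightarrow> complex \<Rightarrow> complex \<Rightarrow> complex" where
  "poly2 P x y = poly (poly P [:y:]) x"

lemma poly2_simps [simp]:
  "poly2 0 x y = 0" "poly2 (P + Q) x y = poly2 P x y + poly2 Q x y"
  "poly2 (P * Q) x y = poly2 P x y * poly2 Q x y"
  "poly2 [:[:c:]:] x y = c" "poly2 [:[:0, 1:]:] x y = x" "poly2 [:0, 1:] x y = y"
  by (simp_all add: poly2_def)

lemma poly_eq_sum_ge_degree:
  fixes p :: "'a :: comm_ring_1 poly"
  assumes "degree p \<le> n" shows "poly p x = (\<Sum>i\<le>n. coeff p i * x ^ i)"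
  unfolding poly_altdef using assms
  by (intro sum.mono_neutral_left) (auto simp: coeff_eq_0)

lemma poly2_altdef:
  "\<exists>N. \<forall>x y. poly2 P x y = (\<Sum>i\<le>N. \<Sum>j\<le>N. coeff (coeff P j) i * x ^ i * y ^ j)"
proof (intro exI allI)
  define N where "N = Max ((\<lambda>j. degree (coeff P j)) ` {..degree P}) + degree P"
  have dP: "degree P \<le> N" by (simp add: N_def)
  have dc: "degree (coeff P j) \<le> N" for j
  proof (cases "j \<le> degree P")
    case True
    hence "degree (coeff P j) \<le> Max ((\<lambda>j. degree (coeff P j)) ` {..degree P})" by (intro Max_ge) auto
    thus ?thesis by (simp add: N_def)
  next
    case False thus ?thesis by (simp add: coeff_eq_0)
  qed
  fix x y
  have "poly2 P x y = (\<Sum>j\<le>N. poly (coeff P j * [:y:] ^ j) x)"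
    by (simp add: poly2_def poly_eq_sum_ge_degree[OF dP] poly_sum)
  also have "\<dots> = (\<Sum>j\<le>N. \<Sum>i\<le>N. coeff (coeff P j) i * x ^ i * y ^ j)"
    by (simp add: poly_eq_sum_ge_degree[OF dc] sum_distrib_right)
  also have "\<dots> = (\<Sum>i\<le>N. \<Sum>j\<le>N. coeff (coeff P j) i * x ^ i * y ^ j)" by (rule sum.swap)
  finally show "poly2 P x y = \<dots>" .
qed

text \<open>Continuity of \<open>u\<close> is not demanded; for continuous generators it follows
  from uniform approximation.\<close>

definition poly_closure ::
    "(complex \<Rightarrow> complex) \<Rightarrow> (complex \<Rightarrow> complex) \<Rightarrow> complex set \<Rightarrow> (complex \<Rightarrow> complex) set" where
  "poly_closure f1 f2 D = {u. \<forall>\<epsilon>>0. \<exists>P. \<forall>z\<in>D. norm (u z - poly2 P (f1 z) (f2 z)) < \<epsilon>}"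

lemma poly2_in_poly_closure: "(\<lambda>z. poly2 P (f1 z) (f2 z)) \<in> poly_closure f1 f2 D"
  unfolding poly_closure_def by (auto intro!: exI[of _ P])

lemma poly_closure_gens: "f1 \<in> poly_closure f1 f2 D" "f2 \<in> poly_closure f1 f2 D"
  using poly2_in_poly_closure[of "[:[:0, 1:]:]" f1 f2 D] poly2_in_poly_closure[of "[:0, 1:]" f1 f2 D]
  by simp_all

lemma poly_gen_dense_iff:
  "poly_gen_dense f1 f2 D \<longleftrightarrow> (\<forall>\<phi>. continuous_on D \<phi> \<longrightarrow> \<phi> \<in> poly_closure f1 f2 D)"
proof -
  have "(\<exists>N c. \<forall>z\<in>D. norm (\<phi> z - (\<Sum>i\<le>N. \<Sum>j\<le>N. c i j * f1 z ^ i * f2 z ^ j)) < \<epsilon>)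
     \<longleftrightarrow> (\<exists>P. \<forall>z\<in>D. norm (\<phi> z - poly2 P (f1 z) (f2 z)) < \<epsilon>)" for \<phi> and \<epsilon> :: real
  proof safe
    fix N :: nat and c assume *: "\<forall>z\<in>D. norm (\<phi> z - (\<Sum>i\<le>N. \<Sum>j\<le>N. c i j * f1 z ^ i * f2 z ^ j)) < \<epsilon>"
    define P :: "complex poly poly" where "P = (\<Sum>i\<le>N. \<Sum>j\<le>N. [:[:c i j:]:] * [:[:0, 1:]:] ^ i * [:0, 1:] ^ j)"
    have "poly2 P x y = (\<Sum>i\<le>N. \<Sum>j\<le>N. c i j * x ^ i * y ^ j)" for x y
      by (simp add: P_def poly2_def poly_sum mult.assoc)
    thus "\<exists>P. \<forall>z\<in>D. norm (\<phi> z - poly2 P (f1 z) (f2 z)) < \<epsilon>" using * by (intro exI[of _ P]) simp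
  next
    fix P assume *: "\<forall>z\<in>D. norm (\<phi> z - poly2 P (f1 z) (f2 z)) < \<epsilon>"
    from poly2_altdef[of P] obtain N where N0: "\<forall>x y. poly2 P x y = (\<Sum>i\<le>N. \<Sum>j\<le>N. coeff (coeff P j) i * x ^ i * y ^ j)" ..
    show "\<exists>N c. \<forall>z\<in>D. norm (\<phi> z - (\<Sum>i\<le>N. \<Sum>j\<le>N. c i j * f1 z ^ i * f2 z ^ j)) < \<epsilon>"
      using *[unfolded N0[rule_format]] by (intro exI[of _ N] exI[of _ "\<lambda>i j. coeff (coeff P j) i"])
  qed
  thus ?thesis unfolding poly_gen_dense_def poly_closure_def by simp
qed

lemma continuous_on_poly2 [continuous_intros]:
  assumes "continuous_on D f" "continuous_on D g"
  shows "continuous_on D (\<lambda>z. poly2 P (f z) (g z))"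
proof -
  from poly2_altdef[of P] obtain N where N0: "\<forall>x y. poly2 P x y = (\<Sum>i\<le>N. \<Sum>j\<le>N. coeff (coeff P j) i * x ^ i * y ^ j)" ..
  show ?thesis unfolding N0[rule_format] by (intro continuous_intros assms)
qed

lemma continuous_on_uniform_approx:
  fixes u :: "complex \<Rightarrow> complex"
  assumes "\<And>\<epsilon>. \<epsilon> > 0 \<Longrightarrow> \<exists>v. continuous_on D v \<and> (\<forall>z\<in>D. norm (u z - v z) < \<epsilon>)"
  shows "continuous_on D u"
proof -
  have "\<forall>n. \<exists>v. continuous_on D v \<and> (\<forall>z\<in>D. norm (u z - v z) < inverse (Suc n))"
    using assms by simp
  then obtain V where V: "\<And>n. continuous_on D (V n)" "\<And>n z. z \<in> D \<Longrightarrow> norm (u z - V n z) < inverse (Suc n)"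
    by metis
  have "uniform_limit D V u sequentially"
  proof (rule uniform_limitI)
    fix e :: real assume e: "e > 0"
    have "\<forall>\<^sub>F n in sequentially. inverse (real (Suc n)) < e"
      using e by (rule order_tendstoD(2)[OF LIMSEQ_inverse_real_of_nat])
    thus "\<forall>\<^sub>F n in sequentially. \<forall>x\<in>D. dist (V n x) (u x) < e"
      by eventually_elim (use V(2) in \<open>auto simp: dist_norm norm_minus_commute intro: less_trans\<close>)
  qed
  thus ?thesis using V(1) by (intro uniform_limit_theorem[of _ V]) auto
qed

lemma small_factor:
  fixes e c :: real assumes "c > 0" "e > 0"
  obtains d where "d > 0" "d \<le> 1" "c * d < e"
proof
  define d where "d = min 1 (e / (2 * c))"
  show "d > 0" "d \<le> 1" using assms by (auto simp: d_def)
  have "c * d \<le> c * (e / (2 * c))" using assms by (intro mult_left_mono) (auto simp: d_def)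
  also have "\<dots> = e / 2" using assms by simp
  finally show "c * d < e" using assms by simp
qed

text \<open>Size bounds are placed on the exact factors only; \<open>e \<le> 1\<close> absorbs the
  product of the two errors.\<close>

lemma uniform_approx_mult:
  fixes u v u' v' :: "complex"
  assumes "norm u \<le> M" "norm v \<le> M" "norm (u - u') < e" "norm (v - v') < e" "e \<le> 1" "M > 0"
  shows "norm (u * v - u' * v') \<le> (2 * M + 1) * e"
proof -
  have "u * v - u' * v' = (u - u') * v + u * (v - v') - (u - u') * (v - v')" by (simp add: algebra_simps)
  also have "norm \<dots> \<le> norm (u - u') * norm v + norm u * norm (v - v') + norm (u - u') * norm (v - v')"
    by (smt (verit, best) norm_mult norm_triangle_ineq norm_triangle_ineq4)
  also have "\<dots> \<le> e * M + M * e + e * 1"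
    using assms le_less_trans[OF norm_ge_zero assms(3)] by (intro add_mono mult_mono) auto
  finally show ?thesis by (simp add: algebra_simps)
qed

lemma uniform_algebra_poly_closure:
  assumes D: "compact D" and f1: "continuous_on D f1" and f2: "continuous_on D f2"
  shows "uniform_algebra D (poly_closure f1 f2 D)"
proof
  show c: "continuous_on D u" if u: "u \<in> poly_closure f1 f2 D" for u
  proof (rule continuous_on_uniform_approx)
    fix e :: real assume "e > 0"
    then obtain P where "\<forall>z\<in>D. norm (u z - poly2 P (f1 z) (f2 z)) < e"
      using u unfolding poly_closure_def by blast
    thus "\<exists>v. continuous_on D v \<and> (\<forall>z\<in>D. norm (u z - v z) < e)"
      using continuous_on_poly2[OF f1 f2] by blast
  qed
  show "(\<lambda>_. c) \<in> poly_closure f1 f2 D" for c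
    using poly2_in_poly_closure[of "[:[:c:]:]" f1 f2 D] by simp
  fix u v assume u: "u \<in> poly_closure f1 f2 D" and v: "v \<in> poly_closure f1 f2 D"
  show "(\<lambda>z. u z + v z) \<in> poly_closure f1 f2 D"
    unfolding poly_closure_def
  proof safe
    fix e :: real assume "e > 0"
    hence "e/2 > 0" by simp
    then obtain P Q where P: "\<And>z. z\<in>D \<Longrightarrow> norm (u z - poly2 P (f1 z) (f2 z)) < e/2"
      and Q: "\<And>z. z\<in>D \<Longrightarrow> norm (v z - poly2 Q (f1 z) (f2 z)) < e/2"
      using u v unfolding poly_closure_def by blast
    show "\<exists>P. \<forall>z\<in>D. norm (u z + v z - poly2 P (f1 z) (f2 z)) < e"
    proof (intro exI[of _ "P + Q"] ballI)
      fix z assume z: "z \<in> D"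
      show "norm (u z + v z - poly2 (P + Q) (f1 z) (f2 z)) < e"
        using norm_add_less[OF P[OF z] Q[OF z]] by (simp add: algebra_simps)
    qed
  qed
  show "(\<lambda>z. u z * v z) \<in> poly_closure f1 f2 D"
    unfolding poly_closure_def
  proof safe
    fix e :: real assume e: "e > 0"
    have "bounded (u ` D)" "bounded (v ` D)"
      using c u v D compact_continuous_image compact_imp_bounded by blast+
    then obtain M1 M2 where M1: "M1 > 0" "\<And>z. z \<in> D \<Longrightarrow> norm (u z) \<le> M1"
      and M2: "M2 > 0" "\<And>z. z \<in> D \<Longrightarrow> norm (v z) \<le> M2"
      unfolding bounded_pos by (metis imageI)
    define M where "M = max M1 M2"
    have M: "M > 0" "\<And>z. z \<in> D \<Longrightarrow> norm (u z) \<le> M" "\<And>z. z \<in> D \<Longrightarrow> norm (v z) \<le> M"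
      using M1 M2 by (auto simp: M_def le_max_iff_disj)
    obtain d where d: "d > 0" "d \<le> 1" "(2 * M + 1) * d < e"
      by (rule small_factor[OF _ e, of "2 * M + 1"]) (use M in auto)
    obtain P Q where P: "\<And>z. z\<in>D \<Longrightarrow> norm (u z - poly2 P (f1 z) (f2 z)) < d"
      and Q: "\<And>z. z\<in>D \<Longrightarrow> norm (v z - poly2 Q (f1 z) (f2 z)) < d"
      using u v d(1) unfolding poly_closure_def by blast
    show "\<exists>P. \<forall>z\<in>D. norm (u z * v z - poly2 P (f1 z) (f2 z)) < e"
    proof (intro exI[of _ "P * Q"] ballI)
      fix z assume z: "z \<in> D"
      show "norm (u z * v z - poly2 (P * Q) (f1 z) (f2 z)) < e"
        using uniform_approx_mult[OF M(2)[OF z] M(3)[OF z] P[OF z] Q[OF z] d(2) M(1)] d(3) by simp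
    qed
  qed
next
  fix u assume *: "\<And>\<epsilon>. \<epsilon> > 0 \<Longrightarrow> \<exists>v\<in>poly_closure f1 f2 D. \<forall>z\<in>D. norm (u z - v z) < \<epsilon>"
  show "u \<in> poly_closure f1 f2 D"
    unfolding poly_closure_def
  proof safe
    fix e :: real assume "e > 0"
    hence e: "e/2 > 0" by simp
    from *[OF this] obtain v where v: "v \<in> poly_closure f1 f2 D" "\<And>z. z \<in> D \<Longrightarrow> norm (u z - v z) < e/2" by blast
    from v(1) e obtain P where P: "\<And>z. z\<in>D \<Longrightarrow> norm (v z - poly2 P (f1 z) (f2 z)) < e/2"
      unfolding poly_closure_def by blast
    show "\<exists>P. \<forall>z\<in>D. norm (u z - poly2 P (f1 z) (f2 z)) < e"
    proof (intro exI[of _ P] ballI)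
      fix z assume z: "z \<in> D"
      show "norm (u z - poly2 P (f1 z) (f2 z)) < e" using norm_add_less[OF v(2)[OF z] P[OF z]] by simp
    qed
  qed
qed (use D in auto)

context uniform_algebra
begin

lemma diff: "u \<in> A \<Longrightarrow> v \<in> A \<Longrightarrow> (\<lambda>z. u z - v z) \<in> A"
  using add[of u "\<lambda>z. -1 * v z"] mult[OF const[of "-1"], of v] by simp

end

section \<open>The odd part of a graded algebra\<close>

text \<open>\<open>A\<close> acts as the even part of a grading modulo 2 in which \<open>f1\<close>
  and \<open>f2\<close> have degree one. The sum of the two parts need not be direct: an element
  that is odd and at the same time lies in \<open>A\<close> is precisely what the density argument
  exploits.\<close>

locale graded_algebra = uniform_algebra +
  fixes f1 f2 :: "complex \<Rightarrow> complex"
  assumes f1: "continuous_on D f1" and f2: "continuous_on D f2"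
    and f11: "(\<lambda>z. f1 z * f1 z) \<in> A" and f12: "(\<lambda>z. f1 z * f2 z) \<in> A" and f22: "(\<lambda>z. f2 z * f2 z) \<in> A"
begin

text \<open>The closed \<open>A\<close>-module generated by \<open>f1\<close> and \<open>f2\<close>.
  The closure makes room for limits of odd polynomials, in particular for odd holomorphic functions
  of odd arguments.\<close>

definition Odd :: "(complex \<Rightarrow> complex) set" where
  "Odd = {u. \<forall>\<epsilon>>0. \<exists>a\<in>A. \<exists>b\<in>A. \<forall>z\<in>D. norm (u z - (a z * f1 z + b z * f2 z)) < \<epsilon>}"

lemma OddD:
  assumes "u \<in> Odd" "\<epsilon> > 0"
  obtains a b where "a \<in> A" "b \<in> A" "\<And>z. z \<in> D \<Longrightarrow> norm (u z - (a z * f1 z + b z * f2 z)) < \<epsilon>"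
  using assms unfolding Odd_def by blast

lemma Odd_combination: "a \<in> A \<Longrightarrow> b \<in> A \<Longrightarrow> (\<lambda>z. a z * f1 z + b z * f2 z) \<in> Odd"
  unfolding Odd_def by force

lemma Odd_gens: "f1 \<in> Odd" "f2 \<in> Odd"
  using Odd_combination[OF const[of 1] const[of 0]] Odd_combination[OF const[of 0] const[of 1]] by auto

lemma Odd_cont: assumes "u \<in> Odd" shows "continuous_on D u"
proof (rule continuous_on_uniform_approx)
  fix e :: real assume "e > 0"
  from OddD[OF assms this] obtain a b where "a \<in> A" "b \<in> A" "\<And>z. z \<in> D \<Longrightarrow> norm (u z - (a z * f1 z + b z * f2 z)) < e"
    by blast
  thus "\<exists>v. continuous_on D v \<and> (\<forall>z\<in>D. norm (u z - v z) < e)"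
    by (intro exI[of _ "\<lambda>z. a z * f1 z + b z * f2 z"]) (auto intro!: continuous_on_add continuous_on_mult f1 f2 intro: cont)
qed

lemma Odd_closed:
  assumes "\<And>\<epsilon>. \<epsilon> > 0 \<Longrightarrow> \<exists>v\<in>Odd. \<forall>z\<in>D. norm (u z - v z) < \<epsilon>" shows "u \<in> Odd"
  unfolding Odd_def
proof safe
  fix e :: real assume "e > 0"
  hence e: "e/2 > 0" by simp
  from assms[OF this] obtain v where v: "v \<in> Odd" "\<And>z. z \<in> D \<Longrightarrow> norm (u z - v z) < e/2" by blast
  obtain a b where ab: "a \<in> A" "b \<in> A" "\<And>z. z \<in> D \<Longrightarrow> norm (v z - (a z * f1 z + b z * f2 z)) < e/2"
    using OddD[OF v(1) e] by blast
  have "norm (u z - (a z * f1 z + b z * f2 z)) < e" if "z \<in> D" for z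
    using norm_add_less[OF v(2)[OF that] ab(3)[OF that]] by (simp add: algebra_simps)
  thus "\<exists>a\<in>A. \<exists>b\<in>A. \<forall>z\<in>D. norm (u z - (a z * f1 z + b z * f2 z)) < e" using ab by blast
qed

lemma Odd_add: assumes u: "u \<in> Odd" and v: "v \<in> Odd" shows "(\<lambda>z. u z + v z) \<in> Odd"
proof (rule Odd_closed)
  fix e :: real assume "e > 0"
  hence e: "e/2 > 0" by simp
  obtain a b where ab: "a \<in> A" "b \<in> A" "\<And>z. z \<in> D \<Longrightarrow> norm (u z - (a z * f1 z + b z * f2 z)) < e/2"
    using OddD[OF u e] by blast
  obtain c d where cd: "c \<in> A" "d \<in> A" "\<And>z. z \<in> D \<Longrightarrow> norm (v z - (c z * f1 z + d z * f2 z)) < e/2"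
    using OddD[OF v e] by blast
  have "norm (u z + v z - ((a z + c z) * f1 z + (b z + d z) * f2 z)) < e" if "z \<in> D" for z
    using norm_add_less[OF ab(3)[OF that] cd(3)[OF that]] by (simp add: algebra_simps)
  moreover have "(\<lambda>z. (a z + c z) * f1 z + (b z + d z) * f2 z) \<in> Odd"
    by (intro Odd_combination add ab cd)
  ultimately show "\<exists>w\<in>Odd. \<forall>z\<in>D. norm (u z + v z - w z) < e"
    by (intro bexI[of _ "\<lambda>z. (a z + c z) * f1 z + (b z + d z) * f2 z"] ballI)
qed

lemma Odd_scale: assumes x: "x \<in> A" and u: "u \<in> Odd" shows "(\<lambda>z. x z * u z) \<in> Odd"
proof (rule Odd_closed)
  fix e :: real assume e: "e > 0"
  obtain M where M: "M > 0" "\<And>z. z \<in> D \<Longrightarrow> norm (x z) \<le> M" using bound[OF x] by blast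
  have "e / M > 0" using e M by simp
  then obtain a b where ab: "a \<in> A" "b \<in> A" "\<And>z. z \<in> D \<Longrightarrow> norm (u z - (a z * f1 z + b z * f2 z)) < e/M"
    using OddD[OF u] by blast
  have "norm (x z * u z - (x z * a z * f1 z + x z * b z * f2 z)) < e" if z: "z \<in> D" for z
  proof -
    have "norm (x z * u z - (x z * a z * f1 z + x z * b z * f2 z)) = norm (x z) * norm (u z - (a z * f1 z + b z * f2 z))"
      by (simp add: algebra_simps flip: norm_mult)
    also have "\<dots> \<le> M * norm (u z - (a z * f1 z + b z * f2 z))" using M z by (intro mult_right_mono) auto
    also have "\<dots> < M * (e / M)" using M(1) ab(3)[OF z] by (intro mult_strict_left_mono)
    finally show ?thesis using M(1) by simp
  qed
  moreover have "(\<lambda>z. x z * a z * f1 z + x z * b z * f2 z) \<in> Odd"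
    by (intro Odd_combination mult x ab)
  ultimately show "\<exists>w\<in>Odd. \<forall>z\<in>D. norm (x z * u z - w z) < e"
    by (intro bexI[of _ "\<lambda>z. x z * a z * f1 z + x z * b z * f2 z"] ballI)
qed

text \<open>Expanding a product of two combinations of \<open>f1\<close> and \<open>f2\<close>
  leaves only the generator products \<open>f1 * f1\<close>, \<open>f1 * f2\<close> and
  \<open>f2 * f2\<close>, each of which is in \<open>A\<close>.\<close>

lemma Odd_mult: assumes u: "u \<in> Odd" and v: "v \<in> Odd" shows "(\<lambda>z. u z * v z) \<in> A"
proof (rule closed)
  fix e :: real assume e: "e > 0"
  have "bounded (u ` D)" "bounded (v ` D)"
    using Odd_cont u v compact_D compact_continuous_image compact_imp_bounded by blast+
  then obtain M1 M2 where M1: "M1 > 0" "\<And>z. z \<in> D \<Longrightarrow> norm (u z) \<le> M1"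
    and M2: "M2 > 0" "\<And>z. z \<in> D \<Longrightarrow> norm (v z) \<le> M2"
    unfolding bounded_pos by (metis imageI)
  define M where "M = max M1 M2"
  have M: "M > 0" "\<And>z. z \<in> D \<Longrightarrow> norm (u z) \<le> M" "\<And>z. z \<in> D \<Longrightarrow> norm (v z) \<le> M"
    using M1 M2 by (auto simp: M_def le_max_iff_disj)
  obtain d where d: "d > 0" "d \<le> 1" "(2 * M + 1) * d < e"
    by (rule small_factor[OF _ e, of "2 * M + 1"]) (use M in auto)
  obtain a b where ab: "a \<in> A" "b \<in> A" "\<And>z. z \<in> D \<Longrightarrow> norm (u z - (a z * f1 z + b z * f2 z)) < d"
    using OddD[OF u d(1)] by blast
  obtain a' b' where ab': "a' \<in> A" "b' \<in> A" "\<And>z. z \<in> D \<Longrightarrow> norm (v z - (a' z * f1 z + b' z * f2 z)) < d"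
    using OddD[OF v d(1)] by blast
  have "norm (u z * v z - (a z * f1 z + b z * f2 z) * (a' z * f1 z + b' z * f2 z)) < e" if z: "z \<in> D" for z
    using uniform_approx_mult[OF M(2)[OF z] M(3)[OF z] ab(3)[OF z] ab'(3)[OF z] d(2) M(1)] d(3) by simp
  moreover have "(\<lambda>z. (a z * f1 z + b z * f2 z) * (a' z * f1 z + b' z * f2 z)) \<in> A"
  proof -
    have "(\<lambda>z. a z * a' z * (f1 z * f1 z) + (a z * b' z + b z * a' z) * (f1 z * f2 z)
        + b z * b' z * (f2 z * f2 z)) \<in> A"
      by (intro add mult ab ab' f11 f12 f22)
    thus ?thesis by (rule cong) (simp add: algebra_simps)
  qed
  ultimately show "\<exists>w\<in>A. \<forall>z\<in>D. norm (u z * v z - w z) < e"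
    by (intro bexI[of _ "\<lambda>z. (a z * f1 z + b z * f2 z) * (a' z * f1 z + b' z * f2 z)"] ballI)
qed

lemma Odd_diff: "u \<in> Odd \<Longrightarrow> v \<in> Odd \<Longrightarrow> (\<lambda>z. u z - v z) \<in> Odd"
  using Odd_add[of u "\<lambda>z. -1 * v z"] Odd_scale[OF const[of "-1"], of v] by simp

lemma Odd_sum: "(\<And>i. i \<in> I \<Longrightarrow> u i \<in> Odd) \<Longrightarrow> (\<lambda>z. \<Sum>i\<in>I. u i z) \<in> Odd"
proof (induction I rule: infinite_finite_induct)
  case (insert x F) thus ?case by (auto intro: Odd_add)
qed (use Odd_combination[OF const[of 0] const[of 0]] in simp_all)

lemma Odd_power: "u \<in> Odd \<Longrightarrow> (even n \<longrightarrow> (\<lambda>z. u z ^ n) \<in> A) \<and> (odd n \<longrightarrow> (\<lambda>z. u z ^ n) \<in> Odd)"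
proof (induction n)
  case (Suc n)
  show ?case
  proof (cases "even n")
    case True
    hence "(\<lambda>z. u z ^ n * u z) \<in> Odd" using Suc by (intro Odd_scale) auto
    thus ?thesis using True by (simp add: mult.commute)
  next
    case False
    hence "(\<lambda>z. u z ^ n * u z) \<in> A" using Suc by (intro Odd_mult) auto
    thus ?thesis using False by (simp add: mult.commute)
  qed
qed (auto intro: const)

lemma Odd_monomial:
  assumes u: "u \<in> Odd" and v: "v \<in> Odd" and "odd (i + j)"
  shows "(\<lambda>z. c * u z ^ i * v z ^ j) \<in> Odd"
proof (cases "even i")
  case True
  with assms Odd_power[OF u, of i] Odd_power[OF v, of j]
  have "(\<lambda>z. c * u z ^ i) \<in> A" "(\<lambda>z. v z ^ j) \<in> Odd" by (auto intro: mult const)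
  thus ?thesis by (rule Odd_scale)
next
  case False
  with assms Odd_power[OF u, of i] Odd_power[OF v, of j]
  have "(\<lambda>z. c * v z ^ j) \<in> A" "(\<lambda>z. u z ^ i) \<in> Odd" by (auto intro: mult const)
  from Odd_scale[OF this] show ?thesis by (simp add: mult_ac)
qed

lemma Odd_hpoly:
  assumes "u \<in> Odd" "v \<in> Odd" "odd d" shows "(\<lambda>z. hpoly a d (u z) (v z)) \<in> Odd"
  unfolding hpoly_def using assms by (intro Odd_sum Odd_monomial) auto

text \<open>Antisymmetrising under the joint sign change deletes the monomials of even total degree
  and keeps the others. This turns an arbitrary polynomial approximation of an odd function into an
  odd one.\<close>

lemma Odd_poly2:
  assumes u: "u \<in> Odd" and v: "v \<in> Odd"
  shows "(\<lambda>z. (poly2 P (u z) (v z) - poly2 P (- u z) (- v z)) / 2) \<in> Odd"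
proof -
  from poly2_altdef[of P] obtain N where N0: "\<forall>x y. poly2 P x y = (\<Sum>i\<le>N. \<Sum>j\<le>N. coeff (coeff P j) i * x ^ i * y ^ j)" ..
  note N = N0[rule_format]
  have odd_part: "(poly2 P x y - poly2 P (- x) (- y)) / 2 =
      (\<Sum>i\<le>N. \<Sum>j\<le>N. (if odd (i + j) then coeff (coeff P j) i else 0) * x ^ i * y ^ j)" for x y
  proof -
    have "poly2 P x y - poly2 P (- x) (- y) =
        (\<Sum>i\<le>N. \<Sum>j\<le>N. 2 * ((if odd (i + j) then coeff (coeff P j) i else 0) * x ^ i * y ^ j))"
      unfolding N sum_subtractf[symmetric]
      by (intro sum.cong refl) (auto simp: power_minus_odd power_minus_even)
    thus ?thesis by (simp flip: sum_distrib_left)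
  qed
  have "(\<lambda>z. (if odd (i + j) then coeff (coeff P j) i else 0) * u z ^ i * v z ^ j) \<in> Odd" for i j
  proof (cases "odd (i + j)")
    case True thus ?thesis using Odd_monomial[OF u v True] by (simp only: if_True)
  next
    case False thus ?thesis using Odd_combination[OF const[of 0] const[of 0]] by simp
  qed
  thus ?thesis unfolding odd_part by (intro Odd_sum)
qed

text \<open>Multiplication by an odd \<open>\<Psi>\<close> that happens to lie in \<open>A\<close> sends both the even and the odd
  polynomials in \<open>f1\<close>, \<open>f2\<close> into \<open>A\<close>, hence all of them.\<close>

lemma mult_poly_closure:
  assumes \<Psi>: "\<Psi> \<in> Odd" "\<Psi> \<in> A" and u: "u \<in> poly_closure f1 f2 D"
  shows "(\<lambda>z. \<Psi> z * u z) \<in> A"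
proof (rule closed)
  fix e :: real assume e: "e > 0"
  obtain M where M: "M > 0" "\<And>z. z \<in> D \<Longrightarrow> norm (\<Psi> z) \<le> M" using bound[OF \<Psi>(2)] by blast
  have "e / M > 0" using e M by simp
  then obtain P where P: "\<And>z. z \<in> D \<Longrightarrow> norm (u z - poly2 P (f1 z) (f2 z)) < e / M"
    using u unfolding poly_closure_def by blast
  from poly2_altdef[of P] obtain N where N0: "\<forall>x y. poly2 P x y = (\<Sum>i\<le>N. \<Sum>j\<le>N. coeff (coeff P j) i * x ^ i * y ^ j)" ..
  note N = N0[rule_format]
  have "(\<lambda>z. \<Psi> z * (c * f1 z ^ i * f2 z ^ j)) \<in> A" for c i j
  proof (cases "odd (i + j)")
    case True thus ?thesis by (intro Odd_mult \<Psi> Odd_monomial Odd_gens)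
  next
    case False
    show ?thesis
    proof (cases "even i")
      case True
      with False Odd_power[OF Odd_gens(1), of i] Odd_power[OF Odd_gens(2), of j]
      show ?thesis by (intro mult \<Psi> const) auto
    next
      case False': False
      with False Odd_power[OF Odd_gens(1), of i] Odd_power[OF Odd_gens(2), of j]
      have "(\<lambda>z. f1 z ^ i * f2 z ^ j) \<in> A" by (intro Odd_mult) auto
      from mult[OF \<Psi>(2) mult[OF const this]]
      have "(\<lambda>z. \<Psi> z * (c * (f1 z ^ i * f2 z ^ j))) \<in> A" .
      thus ?thesis by (simp add: mult.assoc)
    qed
  qed
  hence "(\<lambda>z. \<Psi> z * poly2 P (f1 z) (f2 z)) \<in> A"
    unfolding N sum_distrib_left by (intro sum)
  moreover have "norm (\<Psi> z * u z - \<Psi> z * poly2 P (f1 z) (f2 z)) < e" if z: "z \<in> D" for z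
  proof -
    have "norm (\<Psi> z * u z - \<Psi> z * poly2 P (f1 z) (f2 z)) = norm (\<Psi> z) * norm (u z - poly2 P (f1 z) (f2 z))"
      by (simp flip: norm_mult right_diff_distrib)
    also have "\<dots> \<le> M * norm (u z - poly2 P (f1 z) (f2 z))" using M z by (intro mult_right_mono) auto
    also have "\<dots> < M * (e / M)" using M(1) P[OF z] by (intro mult_strict_left_mono)
    finally show ?thesis using M(1) by simp
  qed
  ultimately show "\<exists>w\<in>A. \<forall>z\<in>D. norm (\<Psi> z * u z - w z) < e"
    by (intro bexI[of _ "\<lambda>z. \<Psi> z * poly2 P (f1 z) (f2 z)"] ballI)
qed

end

section \<open>Gaussian integrals over the plane\<close>

lemma lborel_integral_affine_complex:
  fixes f :: "complex \<Rightarrow> complex" and c :: real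
  assumes f: "f \<in> borel_measurable borel" and c: "c > 0"
  shows "(\<integral>x. f x \<partial>lborel) = of_real (c\<^sup>2) * (\<integral>x. f (t + of_real c * x) \<partial>lborel)"
proof -
  have m: "(\<lambda>x. t + c *\<^sub>R x) \<in> lborel \<rightarrow>\<^sub>M borel" by measurable
  have "(\<integral>x. f x \<partial>lborel) = (\<integral>x. f x \<partial>(density (distr lborel borel (\<lambda>x. t + c *\<^sub>R x)) (\<lambda>_. ennreal (c ^ 2))))"
    using lborel_affine[of c t] c by (simp add: ennreal_power)
  also have "\<dots> = (\<integral>x. c\<^sup>2 *\<^sub>R f x \<partial>(distr lborel borel (\<lambda>x. t + c *\<^sub>R x)))"
    using f by (intro integral_density) auto
  also have "\<dots> = (\<integral>x. c\<^sup>2 *\<^sub>R f (t + c *\<^sub>R x) \<partial>lborel)"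
    using f m by (intro integral_distr) auto
  finally show ?thesis by (simp add: scaleR_conv_of_real)
qed

text \<open>A point with integer part n of its norm lies in the ball of radius n + 1, where the
  function is at most 1 / (1 + n)^4. These balls have area \<pi> (n + 1)^2, so the integral is
  dominated by the convergent sum of \<pi> / (n + 1)^2. The function serves as an elementary
  majorant for the Gaussian integrals.\<close>

lemma integrable_inverse_fourth_power:
  "integrable (lborel :: complex measure) (\<lambda>x. 1 / (1 + norm x) ^ 4 :: real)"
proof (rule integrableI_bounded)
  have "(\<lambda>x::complex. 1 / (1 + norm x) ^ 4 :: real) \<in> borel_measurable borel"
    by (intro borel_measurable_continuous_onI continuous_intros) (metis add_pos_nonneg less_irrefl norm_ge_zero power_not_zero zero_less_one)
  thus "(\<lambda>x::complex. 1 / (1 + norm x) ^ 4 :: real) \<in> borel_measurable lborel" by simp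
  define g where "g = (\<lambda>n (x::complex). ennreal (1 / (1 + real n) ^ 4) * indicator (cball 0 (real n + 1)) x)"
  have le: "ennreal (norm (1 / (1 + norm x) ^ 4 :: real)) \<le> (\<Sum>n. g n x)" for x :: complex
  proof -
    define n where "n = nat \<lfloor>norm x\<rfloor>"
    have n: "real n \<le> norm x" "norm x \<le> real n + 1" unfolding n_def
      using of_nat_floor[of "norm x"] real_nat_ceiling_ge[of "norm x"] by (simp, linarith)
    have "1 / (1 + norm x) ^ 4 \<le> 1 / (1 + real n) ^ 4"
      using n by (intro divide_left_mono power_mono mult_pos_pos zero_less_power) (auto intro: add_pos_nonneg)
    hence "ennreal (norm (1 / (1 + norm x) ^ 4 :: real)) \<le> g n x"
      using n by (auto simp: g_def intro: ennreal_leI)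
    also have "\<dots> = sum (\<lambda>n. g n x) {n}" by simp
    also have "\<dots> \<le> (\<Sum>n. g n x)" by (intro sum_le_suminf) auto
    finally show ?thesis .
  qed
  have em: "emeasure lborel (cball (0::complex) (real n + 1)) = ennreal (pi * (real n + 1)\<^sup>2)" for n
    by (subst emeasure_cball) (auto simp: unit_ball_vol_2)
  have "(\<integral>\<^sup>+x. ennreal (norm (1 / (1 + norm x) ^ 4 :: real)) \<partial>(lborel::complex measure)) \<le> (\<integral>\<^sup>+x. (\<Sum>n. g n x) \<partial>lborel)"
    by (intro nn_integral_mono le)
  also have "\<dots> = (\<Sum>n. \<integral>\<^sup>+x. g n x \<partial>lborel)"
    unfolding g_def
    by (intro nn_integral_suminf borel_measurable_times_ennreal borel_measurable_indicator) auto
  also have "\<dots> = (\<Sum>n. ennreal (1 / (1 + real n) ^ 4) * ennreal (pi * (real n + 1)\<^sup>2))"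
    unfolding g_def by (subst nn_integral_cmult_indicator) (auto simp: em)
  also have "\<dots> = (\<Sum>n. ennreal (pi * (1 / (real (Suc n))\<^sup>2)))"
  proof (intro arg_cong[where f = suminf] ext)
    fix n
    have "1 / y ^ 4 * (pi * y\<^sup>2) = pi * (1 / y\<^sup>2)" if "y > 0" for y :: real
      using that by (simp add: divide_simps flip: power_add)
    from this[of "real (Suc n)"]
    have "1 / (1 + real n) ^ 4 * (pi * (real n + 1)\<^sup>2) = pi * (1 / (real (Suc n))\<^sup>2)"
      by (simp add: add.commute)
    thus "ennreal (1 / (1 + real n) ^ 4) * ennreal (pi * (real n + 1)\<^sup>2) = ennreal (pi * (1 / (real (Suc n))\<^sup>2))"
      by (simp flip: ennreal_mult)
  qed
  also have "\<dots> < \<infinity>"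
  proof -
    have "summable (\<lambda>n. pi * (1 / (real (Suc n))\<^sup>2))"
      using inverse_squares_sums by (intro summable_mult) (auto simp: sums_iff add.commute)
    hence "(\<Sum>n. ennreal (pi * (1 / (real (Suc n))\<^sup>2))) \<noteq> top" by (intro ennreal_suminf_neq_top) auto
    thus ?thesis by (simp add: less_top)
  qed
  finally show "(\<integral>\<^sup>+x. ennreal (norm (1 / (1 + norm x) ^ 4 :: real)) \<partial>(lborel::complex measure)) < \<infinity>" .
qed

text \<open>The square root of the kernel \<open>exp (- (norm x)\<^sup>2)\<close> that arises from
  exact conjugation. A perturbed kernel loses at most half of the decay, so \<open>gauss\<close> is
  the common majorant.\<close>

definition gauss :: "complex \<Rightarrow> real" where "gauss x = exp (- (norm x)\<^sup>2 / 2)"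

text \<open>With t = |x| and y = 1 + t^2 / 8 one has y^4 \<le> exp (t^2 / 2), (1 + t)^4 \<le> 256
  y^2 and t^2 \<le> 8 y. Since y \<ge> 1, the constant 2048 = 8 * 256 serves both bounds.\<close>

lemma gauss_bounds:
  "gauss x \<le> 2048 * (1 / (1 + norm x) ^ 4)" "(norm x)\<^sup>2 * gauss x \<le> 2048 * (1 / (1 + norm x) ^ 4)"
proof -
  define t where "t = norm x"
  define y where "y = 1 + t\<^sup>2 / 8"
  have t: "t \<ge> 0" and y1: "y \<ge> 1" by (auto simp: t_def y_def)
  have "y ^ 4 \<le> exp (t\<^sup>2 / 8) ^ 4" using y1 exp_ge_add_one_self[of "t\<^sup>2 / 8"] by (intro power_mono) (auto simp: y_def)
  also have "\<dots> = exp (t\<^sup>2 / 2)" by (simp flip: exp_of_nat_mult)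
  finally have e: "y ^ 4 \<le> exp (t\<^sup>2 / 2)" .
  have "(1 + t)\<^sup>2 + (1 - t)\<^sup>2 = 2 + 2 * t\<^sup>2" by (simp add: power2_eq_square algebra_simps)
  hence "(1 + t)\<^sup>2 \<le> 16 * y" unfolding y_def using zero_le_power2[of "1 - t"] by (simp only: distrib_left)
  hence "((1 + t)\<^sup>2)\<^sup>2 \<le> (16 * y)\<^sup>2" by (intro power_mono) auto
  hence f: "(1 + t) ^ 4 \<le> 256 * y\<^sup>2" by (simp add: power_mult_distrib flip: power_mult)
  have y4: "y\<^sup>2 * y \<le> y ^ 4" "y\<^sup>2 \<le> y ^ 4"
    using power_increasing[of 3 4 y] power_increasing[of 2 4 y] y1 by (auto simp: power3_eq_cube power2_eq_square)
  have "(1 + t) ^ 4 \<le> 2048 * exp (t\<^sup>2 / 2)" using f y4 e y1 zero_le_power2[of y] by linarith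
  thus "gauss x \<le> 2048 * (1 / (1 + norm x) ^ 4)"
    using t by (simp add: gauss_def t_def[symmetric] exp_minus field_simps)
  have "t\<^sup>2 * (1 + t) ^ 4 \<le> (8 * y) * (256 * y\<^sup>2)" using f t by (intro mult_mono) (auto simp: y_def)
  also have "\<dots> = 2048 * (y\<^sup>2 * y)" by simp
  also have "\<dots> \<le> 2048 * exp (t\<^sup>2 / 2)" using y4 e by linarith
  finally show "(norm x)\<^sup>2 * gauss x \<le> 2048 * (1 / (1 + norm x) ^ 4)"
    using t by (simp add: gauss_def t_def[symmetric] exp_minus field_simps)
qed

lemma gauss_cont: "continuous_on S gauss" unfolding gauss_def by (intro continuous_intros) auto

lemma integrable_gauss:
  "integrable lborel gauss" "integrable lborel (\<lambda>x. (norm x)\<^sup>2 * gauss x)" "integrable lborel (\<lambda>x. gauss x * gauss x)"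
proof -
  have m: "f \<in> borel_measurable lborel" if "continuous_on UNIV f" for f :: "complex \<Rightarrow> real"
    using borel_measurable_continuous_onI[OF that] by simp
  have i: "integrable lborel (\<lambda>x::complex. 2048 * (1 / (1 + norm x) ^ 4) :: real)"
    by (intro integrable_mult_right integrable_inverse_fourth_power)
  have pos: "gauss x \<ge> 0" for x by (simp add: gauss_def)
  have le1: "gauss x \<le> 1" for x by (simp add: gauss_def)
  show 1: "integrable lborel gauss"
    by (rule Bochner_Integration.integrable_bound[OF i m]) (use gauss_bounds(1) pos in \<open>auto intro!: gauss_cont\<close>)
  show "integrable lborel (\<lambda>x. (norm x)\<^sup>2 * gauss x)"
    by (rule Bochner_Integration.integrable_bound[OF i m])
      (use gauss_bounds(2) pos in \<open>auto intro!: continuous_intros gauss_cont simp: abs_mult\<close>)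
  show "integrable lborel (\<lambda>x. gauss x * gauss x)"
    by (rule Bochner_Integration.integrable_bound[OF 1 m])
      (use le1 pos in \<open>auto intro!: continuous_intros gauss_cont simp: abs_mult mult_left_le\<close>)
qed

lemma integral_gauss_pos: "(\<integral>x. gauss x * gauss x \<partial>lborel) > 0"
proof -
  have "(\<integral>x. gauss x * gauss x \<partial>lborel) \<noteq> 0"
  proof
    assume "(\<integral>x. gauss x * gauss x \<partial>lborel) = 0"
    hence "AE x in lborel. gauss x * gauss x = 0"
      by (subst (asm) integral_nonneg_eq_0_iff_AE[OF integrable_gauss(3)]) auto
    hence "AE x in (lborel :: complex measure). False" by (simp add: gauss_def)
    thus False by (simp add: eventually_False ae_filter_eq_bot_iff)
  qed
  moreover have "(\<integral>x. gauss x * gauss x \<partial>lborel) \<ge> 0" by (intro integral_nonneg_AE) auto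
  ultimately show ?thesis by linarith
qed

text \<open>Mean value inequality on a half-plane, which is convex and on which the derivative of
  \<open>exp\<close> is bounded by \<open>exp b\<close>. With b negative, Gaussian decay survives
  the comparison of two kernels.\<close>

lemma norm_exp_diff_le:
  fixes x y :: complex
  assumes "Re x \<le> b" "Re y \<le> b"
  shows "norm (exp x - exp y) \<le> exp b * norm (x - y)"
proof (rule field_differentiable_bound[where S = "{z. Re z \<le> b}" and f' = exp])
  show "convex {z. Re z \<le> b}" by (rule convex_halfspace_Re_le)
qed (use assms in \<open>auto intro!: derivative_eq_intros\<close>)

section \<open>Small perturbations of complex conjugation\<close>

lemma integrable_compact_support:
  fixes \<psi> f :: "complex \<Rightarrow> complex"
  assumes "continuous_on UNIV \<psi>" "\<And>a. a \<notin> cball 0 R \<Longrightarrow> \<psi> a = 0" "continuous_on UNIV f"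
  shows "integrable lborel (\<lambda>a. \<psi> a * f a)"
proof -
  have "integrable lborel (\<lambda>a. indicator (cball 0 R) a *\<^sub>R (\<psi> a * f a))"
    using assms by (intro borel_integrable_compact continuous_intros) (auto intro: continuous_on_subset)
  also have "(\<lambda>a. indicator (cball 0 R) a *\<^sub>R (\<psi> a * f a)) = (\<lambda>a. \<psi> a * f a)"
    using assms(2) by (auto simp: fun_eq_iff indicator_def)
  finally show ?thesis .
qed

text \<open>In each factor \<open>W z - W a\<close> the part \<open>W z\<close> leaves the integral
  as a generator, while \<open>W a\<close> is absorbed into the density \<psi>; factors
  \<open>z - a\<close> are treated alike. The induction therefore has to range over all continuous
  compactly supported densities.\<close>

lemma integral_kernel_power_in_poly_closure:
  fixes \<psi> W :: "complex \<Rightarrow> complex"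
  assumes W: "continuous_on UNIV W" and D: "compact D"
    and \<psi>: "continuous_on UNIV \<psi>" "\<And>a. a \<notin> cball 0 R \<Longrightarrow> \<psi> a = 0"
  shows "(\<lambda>z. \<integral>a. \<psi> a * ((z - a) ^ n * (W z - W a) ^ m) \<partial>lborel) \<in> poly_closure (\<lambda>z. z) W D"
proof -
  interpret uniform_algebra D "poly_closure (\<lambda>z. z) W D"
    using D continuous_on_subset[OF W] by (intro uniform_algebra_poly_closure) auto
  have base: "(\<lambda>z. \<integral>a. \<psi> a * (W z - W a) ^ m \<partial>lborel) \<in> poly_closure (\<lambda>z. z) W D"
    if \<psi>: "continuous_on UNIV \<psi>" "\<And>a. a \<notin> cball 0 R \<Longrightarrow> \<psi> a = 0" for \<psi>
    using \<psi>
  proof (induction m arbitrary: \<psi>)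
    case 0 show ?case using const by simp
  next
    case (Suc m)
    have 1: "(\<lambda>z. \<integral>a. \<psi> a * (W z - W a) ^ m \<partial>lborel) \<in> poly_closure (\<lambda>z. z) W D"
      by (rule Suc.IH[OF Suc.prems])
    have 2: "(\<lambda>z. \<integral>a. (\<psi> a * W a) * (W z - W a) ^ m \<partial>lborel) \<in> poly_closure (\<lambda>z. z) W D"
      by (rule Suc.IH) (use Suc.prems W in \<open>auto intro: continuous_intros\<close>)
    have "(\<lambda>z. W z * (\<integral>a. \<psi> a * (W z - W a) ^ m \<partial>lborel) - (\<integral>a. (\<psi> a * W a) * (W z - W a) ^ m \<partial>lborel))
        \<in> poly_closure (\<lambda>z. z) W D"
      by (rule diff[OF mult[OF poly_closure_gens(2) 1] 2])
    thus ?case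
    proof (rule cong)
      fix z
      have i: "integrable lborel (\<lambda>a. \<psi> a * (W z - W a) ^ m)" "integrable lborel (\<lambda>a. (\<psi> a * W a) * (W z - W a) ^ m)"
        using Suc.prems W by (auto intro!: integrable_compact_support[where R = R] continuous_intros)
      have "W z * (\<integral>a. \<psi> a * (W z - W a) ^ m \<partial>lborel) - (\<integral>a. (\<psi> a * W a) * (W z - W a) ^ m \<partial>lborel)
         = (\<integral>a. W z * (\<psi> a * (W z - W a) ^ m) - (\<psi> a * W a) * (W z - W a) ^ m \<partial>lborel)"
        by (subst Bochner_Integration.integral_diff) (use i in auto)
      also have "\<dots> = (\<integral>a. \<psi> a * (W z - W a) ^ Suc m \<partial>lborel)"
        by (intro Bochner_Integration.integral_cong) (auto simp: algebra_simps)
      finally show "W z * (\<integral>a. \<psi> a * (W z - W a) ^ m \<partial>lborel) - (\<integral>a. (\<psi> a * W a) * (W z - W a) ^ m \<partial>lborel)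
         = (\<integral>a. \<psi> a * (W z - W a) ^ Suc m \<partial>lborel)" .
    qed
  qed
  show ?thesis using \<psi>
  proof (induction n arbitrary: \<psi>)
    case 0 thus ?case using base[OF 0] by simp
  next
    case (Suc n)
    have 1: "(\<lambda>z. \<integral>a. \<psi> a * ((z - a) ^ n * (W z - W a) ^ m) \<partial>lborel) \<in> poly_closure (\<lambda>z. z) W D"
      by (rule Suc.IH[OF Suc.prems])
    have 2: "(\<lambda>z. \<integral>a. (\<psi> a * a) * ((z - a) ^ n * (W z - W a) ^ m) \<partial>lborel) \<in> poly_closure (\<lambda>z. z) W D"
      by (rule Suc.IH) (use Suc.prems in \<open>auto intro: continuous_intros\<close>)
    have "(\<lambda>z. z * (\<integral>a. \<psi> a * ((z - a) ^ n * (W z - W a) ^ m) \<partial>lborel) - (\<integral>a. (\<psi> a * a) * ((z - a) ^ n * (W z - W a) ^ m) \<partial>lborel))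
        \<in> poly_closure (\<lambda>z. z) W D"
      by (rule diff[OF mult[OF poly_closure_gens(1) 1] 2])
    thus ?case
    proof (rule cong)
      fix z
      have i: "integrable lborel (\<lambda>a. \<psi> a * ((z - a) ^ n * (W z - W a) ^ m))"
        "integrable lborel (\<lambda>a. (\<psi> a * a) * ((z - a) ^ n * (W z - W a) ^ m))"
        using Suc.prems W by (auto intro!: integrable_compact_support[where R = R] continuous_intros)
      have "z * (\<integral>a. \<psi> a * ((z - a) ^ n * (W z - W a) ^ m) \<partial>lborel) - (\<integral>a. (\<psi> a * a) * ((z - a) ^ n * (W z - W a) ^ m) \<partial>lborel)
         = (\<integral>a. z * (\<psi> a * ((z - a) ^ n * (W z - W a) ^ m)) - (\<psi> a * a) * ((z - a) ^ n * (W z - W a) ^ m) \<partial>lborel)"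
        by (subst Bochner_Integration.integral_diff) (use i in auto)
      also have "\<dots> = (\<integral>a. \<psi> a * ((z - a) ^ Suc n * (W z - W a) ^ m) \<partial>lborel)"
        by (intro Bochner_Integration.integral_cong) (auto simp: algebra_simps)
      finally show "z * (\<integral>a. \<psi> a * ((z - a) ^ n * (W z - W a) ^ m) \<partial>lborel) - (\<integral>a. (\<psi> a * a) * ((z - a) ^ n * (W z - W a) ^ m) \<partial>lborel)
         = (\<integral>a. \<psi> a * ((z - a) ^ Suc n * (W z - W a) ^ m) \<partial>lborel)" .
    qed
  qed
qed

lemma exp_uniform_partial_sums:
  fixes Y e :: real assumes "e > 0"
  obtains N where "\<And>y::complex. norm y \<le> Y \<Longrightarrow> norm (exp y - (\<Sum>n<N. y ^ n /\<^sub>R fact n)) < e"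
proof -
  have "uniform_limit (cball 0 Y) (\<lambda>n x. \<Sum>i<n. (inverse (fact i) :: complex) * (x - 0) ^ i)
      (\<lambda>x. suminf (\<lambda>i. inverse (fact i) * (x - 0) ^ i)) sequentially"
    by (rule powser_uniform_limit) (subst conv_radius_inftyI'', auto intro: summable_exp)
  then obtain N where N: "\<forall>x\<in>cball 0 Y. dist (\<Sum>i<N. (inverse (fact i) :: complex) * x ^ i) (\<Sum>i. inverse (fact i) * x ^ i) < e"
    using assms unfolding uniform_limit_iff eventually_sequentially by fastforce
  have eq: "inverse (fact i) * x ^ i = x ^ i /\<^sub>R fact i" for x :: complex and i
    by (simp add: scaleR_conv_of_real)
  show ?thesis
    by (rule that[of N]) (use N in \<open>auto simp: eq exp_def dist_norm norm_minus_commute\<close>)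
qed

text \<open>The exponent is bounded for \<open>z\<close> in \<open>D\<close> and \<open>a\<close> in
  the support of \<psi>, so the exponential series converges uniformly there. Its n-th term is a
  kernel integral with both exponents equal to n.\<close>

lemma gaussian_transform_in_poly_closure:
  fixes \<psi> W :: "complex \<Rightarrow> complex" and t :: real
  assumes W: "continuous_on UNIV W" and D: "compact D"
    and \<psi>: "continuous_on UNIV \<psi>" "\<And>a. a \<notin> cball 0 R \<Longrightarrow> \<psi> a = 0"
  shows "(\<lambda>z. \<integral>a. \<psi> a * exp (- of_real t * ((z - a) * (W z - W a))) \<partial>lborel) \<in> poly_closure (\<lambda>z. z) W D"
proof -
  interpret uniform_algebra D "poly_closure (\<lambda>z. z) W D"
    using D continuous_on_subset[OF W] by (intro uniform_algebra_poly_closure) auto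
  define Q where "Q = (\<lambda>z a. - of_real t * ((z - a) * (W z - W a)))"
  have "compact ((\<lambda>(z,a). Q z a) ` (D \<times> cball 0 R))"
    unfolding Q_def case_prod_unfold
    by (intro compact_continuous_image compact_Times D compact_cball continuous_intros
      continuous_on_compose2[OF W]) auto
  hence "bounded ((\<lambda>(z,a). Q z a) ` (D \<times> cball 0 R))" by (rule compact_imp_bounded)
  then obtain Y where Y0: "\<forall>x\<in>(\<lambda>(z,a). Q z a) ` (D \<times> cball 0 R). norm x \<le> Y"
    unfolding bounded_iff ..
  have Y: "norm (Q z a) \<le> Y" if "z \<in> D" "a \<in> cball 0 R" for z a
    using bspec[OF Y0, of "Q z a"] that by (force simp del: mem_cball)
  have ipsi: "integrable lborel \<psi>" using integrable_compact_support[OF \<psi>, where f = "\<lambda>_. 1"] by simp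
  define I where "I = (\<integral>a. norm (\<psi> a) \<partial>lborel)"
  have I0: "I \<ge> 0" unfolding I_def by (intro integral_nonneg_AE) auto
  show ?thesis
  proof (rule closed)
    fix e :: real assume e: "e > 0"
    define e' where "e' = e / (I + 1)"
    have e': "e' > 0" using e I0 by (simp add: e'_def)
    obtain N where N: "\<And>y::complex. norm y \<le> Y \<Longrightarrow> norm (exp y - (\<Sum>n<N. y ^ n /\<^sub>R fact n)) < e'"
      using exp_uniform_partial_sums[OF e'] by blast
    define S where "S = (\<lambda>z a. \<Sum>n<N. Q z a ^ n /\<^sub>R fact n)"
    have cQ: "continuous_on UNIV (Q z)" for z unfolding Q_def by (intro continuous_intros W)
    have cS: "continuous_on UNIV (S z)" for z unfolding S_def by (intro continuous_intros cQ)
    have "(\<lambda>z. \<Sum>n<N. (of_real ((- t) ^ n / fact n)) * (\<integral>a. \<psi> a * ((z - a) ^ n * (W z - W a) ^ n) \<partial>lborel))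
        \<in> poly_closure (\<lambda>z. z) W D"
      by (intro sum mult const integral_kernel_power_in_poly_closure[OF W D \<psi>])
    also have "(\<lambda>z. \<Sum>n<N. (of_real ((- t) ^ n / fact n)) * (\<integral>a. \<psi> a * ((z - a) ^ n * (W z - W a) ^ n) \<partial>lborel))
        = (\<lambda>z. \<integral>a. \<psi> a * S z a \<partial>lborel)"
    proof
      fix z
      have Q_pow: "Q z a ^ n = of_real ((- t) ^ n) * ((z - a) ^ n * (W z - W a) ^ n)" for a n
        unfolding Q_def by (simp only: power_mult_distrib of_real_power of_real_minus)
      have "(\<integral>a. \<psi> a * S z a \<partial>lborel) = (\<integral>a. (\<Sum>n<N. of_real ((- t) ^ n / fact n) * (\<psi> a * ((z - a) ^ n * (W z - W a) ^ n))) \<partial>lborel)"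
        unfolding S_def Q_pow
        by (intro Bochner_Integration.integral_cong refl, unfold sum_distrib_left, intro sum.cong refl)
          (simp add: scaleR_conv_of_real divide_inverse mult_ac)
      also have "\<dots> = (\<Sum>n<N. \<integral>a. of_real ((- t) ^ n / fact n) * (\<psi> a * ((z - a) ^ n * (W z - W a) ^ n)) \<partial>lborel)"
        by (intro Bochner_Integration.integral_sum integrable_mult_right integrable_compact_support[OF \<psi>] continuous_intros W)
      finally show "(\<Sum>n<N. (of_real ((- t) ^ n / fact n)) * (\<integral>a. \<psi> a * ((z - a) ^ n * (W z - W a) ^ n) \<partial>lborel))
          = (\<integral>a. \<psi> a * S z a \<partial>lborel)" by simp
    qed
    finally have mem: "(\<lambda>z. \<integral>a. \<psi> a * S z a \<partial>lborel) \<in> poly_closure (\<lambda>z. z) W D" .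
    have "norm ((\<integral>a. \<psi> a * exp (Q z a) \<partial>lborel) - (\<integral>a. \<psi> a * S z a \<partial>lborel)) < e" if z: "z \<in> D" for z
    proof -
      have cE: "continuous_on UNIV (\<lambda>a. exp (Q z a))" by (intro continuous_intros cQ)
      note i = integrable_compact_support[OF \<psi> cE] integrable_compact_support[OF \<psi> cS]
      have pt: "norm (\<psi> a * exp (Q z a) - \<psi> a * S z a) \<le> norm (\<psi> a) * e'" for a
      proof (cases "a \<in> cball 0 R")
        case True
        have "norm (exp (Q z a) - S z a) \<le> e'" unfolding S_def using N[OF Y[OF z True]] by simp
        thus ?thesis by (simp add: norm_mult mult_left_mono flip: right_diff_distrib)
      next
        case False thus ?thesis using \<psi>(2)[OF False] by simp
      qed
      have "norm ((\<integral>a. \<psi> a * exp (Q z a) \<partial>lborel) - (\<integral>a. \<psi> a * S z a \<partial>lborel))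
          = norm (\<integral>a. \<psi> a * exp (Q z a) - \<psi> a * S z a \<partial>lborel)" using i by simp
      also have "\<dots> \<le> (\<integral>a. norm (\<psi> a) * e' \<partial>lborel)"
        by (rule Bochner_Integration.integral_norm_bound_integral) (use i ipsi pt in auto)
      also have "\<dots> = I * e'" by (simp add: I_def)
      also have "\<dots> < e" using e I0 by (simp add: e'_def field_simps)
      finally show ?thesis .
    qed
    thus "\<exists>v\<in>poly_closure (\<lambda>z. z) W D. \<forall>z\<in>D. norm ((\<integral>a. \<psi> a * exp (- of_real t * ((z - a) * (W z - W a))) \<partial>lborel) - v z) < e"
      using mem unfolding Q_def by (intro bexI[of _ "\<lambda>z. \<integral>a. \<psi> a * S z a \<partial>lborel"] ballI) (auto simp: Q_def)
  qed
qed

lemma integrable_bounded_times_gauss: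
  fixes f :: "complex \<Rightarrow> complex"
  assumes "continuous_on UNIV f" "\<And>x. norm (f x) \<le> B * gauss x"
  shows "integrable lborel f"
proof (rule Bochner_Integration.integrable_bound)
  show "integrable lborel (\<lambda>x. B * gauss x)" by (intro integrable_mult_right integrable_gauss)
  show "f \<in> borel_measurable lborel" using borel_measurable_continuous_onI[OF assms(1)] by simp
  show "AE x in lborel. norm (f x) \<le> norm (B * gauss x)"
    using assms(2) order_trans abs_ge_self by (intro always_eventually allI) fastforce
qed

text \<open>The three constants stay unevaluated: the estimates use only that they are nonnegative
  and that \<open>gauss_sq_mass\<close>, the total mass of the unperturbed kernel and hence the
  normalising factor, is positive.\<close>

definition gauss_moment :: real where "gauss_moment = (\<integral>x. (norm x)\<^sup>2 * gauss x \<partial>lborel)"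
definition gauss_mass :: real where "gauss_mass = (\<integral>x. gauss x \<partial>lborel)"
definition gauss_sq_mass :: real where "gauss_sq_mass = (\<integral>x. gauss x * gauss x \<partial>lborel)"

lemma gauss_moment_nonneg: "gauss_moment \<ge> 0" and gauss_mass_nonneg: "gauss_mass \<ge> 0" and gauss_sq_mass_pos: "gauss_sq_mass > 0"
  unfolding gauss_moment_def gauss_mass_def gauss_sq_mass_def using integral_gauss_pos
  by (auto intro!: integral_nonneg_AE simp: gauss_def)

lemma gauss_square: "gauss x * gauss x = exp (- (norm x)\<^sup>2)"
  by (simp add: gauss_def flip: exp_add)

text \<open>The substitution a = z + c x turns the kernel into one close to
  \<open>exp (- (norm x)\<^sup>2)\<close>. Two errors arise: the oscillation of \<phi>, which can be
  made small through the width \<open>c\<close>, and the deviation of \<open>W\<close> from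
  conjugation, which is proportional to \<open>k * M\<close> at every scale.\<close>

lemma gaussian_transform_rescaled_estimate:
  fixes \<phi> W :: "complex \<Rightarrow> complex" and k c M \<epsilon> \<delta> :: real
  assumes k: "0 \<le> k" "k \<le> 1/2"
    and W: "\<And>z a. norm (W z - W a - cnj (z - a)) \<le> k * norm (z - a)"
    and cW: "continuous_on UNIV W"
    and \<phi>: "continuous_on UNIV \<phi>" "\<And>a. norm (\<phi> a) \<le> M"
    and near: "\<And>a. norm (a - z) < \<delta> \<Longrightarrow> norm (\<phi> a - \<phi> z) \<le> \<epsilon>"
    and pos: "\<delta> > 0" "\<epsilon> \<ge> 0" "c > 0"
  shows "norm ((\<integral>x. \<phi> (z + of_real c * x) * exp (- (x / of_real c) * (W (z + of_real c * x) - W z)) \<partial>lborel) - of_real gauss_sq_mass * \<phi> z)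
      \<le> (k * M + 2 * M * c\<^sup>2 / \<delta>\<^sup>2) * gauss_moment + \<epsilon> * gauss_mass"
proof -
  have M0: "M \<ge> 0" using \<phi>(2)[of 0] norm_ge_zero order_trans by blast
  define E where "E = (\<lambda>x. exp (- (x / of_real c) * (W (z + of_real c * x) - W z)))"
  have Q: "norm (- (x / of_real c) * (W (z + of_real c * x) - W z) - (- of_real ((norm x)\<^sup>2))) \<le> k * (norm x)\<^sup>2" for x
  proof -
    have "- (x / of_real c) * (W (z + of_real c * x) - W z) - (- of_real ((norm x)\<^sup>2))
        = - (x / of_real c) * (W (z + of_real c * x) - W z - cnj (of_real c * x))"
      using pos by (simp add: field_simps complex_norm_square[symmetric])
    also have "norm \<dots> = norm x / c * norm (W (z + of_real c * x) - W z - cnj (of_real c * x))"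
      using pos by (simp add: norm_mult norm_divide)
    also have "\<dots> \<le> norm x / c * (k * norm (of_real c * x))"
      using W[of "z + of_real c * x" z] pos by (intro mult_left_mono) auto
    also have "\<dots> = k * (norm x)\<^sup>2" using pos by (simp add: norm_mult power2_eq_square)
    finally show ?thesis .
  qed
  have ReQ: "Re (- (x / of_real c) * (W (z + of_real c * x) - W z)) \<le> - (norm x)\<^sup>2 / 2" for x
  proof -
    have "Re (- (x / of_real c) * (W (z + of_real c * x) - W z)) + (norm x)\<^sup>2 \<le> k * (norm x)\<^sup>2"
      using complex_Re_le_cmod[of "- (x / of_real c) * (W (z + of_real c * x) - W z) - (- of_real ((norm x)\<^sup>2))"] Q[of x]
      by simp
    also have "\<dots> \<le> 1/2 * (norm x)\<^sup>2" using k by (intro mult_right_mono) auto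
    finally show ?thesis by simp
  qed
  have E1: "norm (E x) \<le> gauss x" for x
    unfolding E_def norm_exp_eq_Re gauss_def using ReQ by simp
  have E2: "norm (E x - of_real (gauss x * gauss x)) \<le> k * ((norm x)\<^sup>2 * gauss x)" for x
  proof -
    have "of_real (gauss x * gauss x) = exp (- complex_of_real ((norm x)\<^sup>2))"
      unfolding gauss_square by (simp flip: exp_of_real)
    hence "norm (E x - of_real (gauss x * gauss x)) \<le> gauss x * norm (- (x / of_real c) * (W (z + of_real c * x) - W z) - (- of_real ((norm x)\<^sup>2)))"
      unfolding E_def gauss_def by (simp only:) (rule norm_exp_diff_le, use ReQ in auto)
    also have "\<dots> \<le> gauss x * (k * (norm x)\<^sup>2)" using Q by (intro mult_left_mono) (auto simp: gauss_def)
    finally show ?thesis by (simp add: mult_ac)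
  qed
  \<comment> \<open>Outside the \<delta>-neighbourhood the trivial bound \<open>2 * M\<close> is
    multiplied by \<open>(c * norm x / \<delta>)\<^sup>2\<close>, which is at least 1 there. One
    bound then holds for all x, and the second moment integrates it.\<close>
  have osc: "norm (\<phi> (z + of_real c * x) - \<phi> z) \<le> \<epsilon> + 2 * M * c\<^sup>2 / \<delta>\<^sup>2 * (norm x)\<^sup>2" for x
  proof (cases "norm (of_real c * x) < \<delta>")
    case True
    have "0 \<le> 2 * M * c\<^sup>2 / \<delta>\<^sup>2 * (norm x)\<^sup>2" using M0 by simp
    thus ?thesis using near[of "z + of_real c * x"] True by simp
  next
    case False
    hence "\<delta>\<^sup>2 \<le> (c * norm x)\<^sup>2" using pos by (intro power_mono) (auto simp: norm_mult)
    hence "1 \<le> (c * norm x)\<^sup>2 / \<delta>\<^sup>2" using pos by (simp add: field_simps)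
    hence "2 * M * 1 \<le> 2 * M * ((c * norm x)\<^sup>2 / \<delta>\<^sup>2)" using M0 by (intro mult_left_mono) auto
    moreover have "norm (\<phi> (z + of_real c * x) - \<phi> z) \<le> 2 * M"
      using norm_triangle_ineq4[of "\<phi> (z + of_real c * x)" "\<phi> z"] \<phi>(2)[of "z + of_real c * x"] \<phi>(2)[of z] by linarith
    ultimately show ?thesis using pos by (simp add: power_mult_distrib)
  qed
  have cE: "continuous_on UNIV E"
    unfolding E_def by (intro continuous_intros continuous_on_compose2[OF cW]) (use pos in auto)
  have cphi: "continuous_on UNIV (\<lambda>x. \<phi> (z + of_real c * x))"
    by (intro continuous_on_compose2[OF \<phi>(1)] continuous_intros) auto
  have i1: "integrable lborel (\<lambda>x. \<phi> (z + of_real c * x) * E x)"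
    by (rule integrable_bounded_times_gauss[where B = M])
      (use \<phi>(2) E1 M0 in \<open>auto intro!: continuous_intros cphi cE simp: norm_mult intro!: mult_mono\<close>)
  have i2: "integrable lborel (\<lambda>x. of_real (gauss x * gauss x) * \<phi> z)"
    using integrable_gauss(3) by (intro integrable_mult_left) (simp del: of_real_mult)
  have k2: "(\<integral>x. of_real (gauss x * gauss x) * \<phi> z \<partial>lborel) = of_real gauss_sq_mass * \<phi> z"
    unfolding gauss_sq_mass_def by (simp del: of_real_mult)
  have pt: "norm (\<phi> (z + of_real c * x) * E x - of_real (gauss x * gauss x) * \<phi> z)
      \<le> (k * M + 2 * M * c\<^sup>2 / \<delta>\<^sup>2) * ((norm x)\<^sup>2 * gauss x) + \<epsilon> * gauss x" for x
  proof -
    have "\<phi> (z + of_real c * x) * E x - of_real (gauss x * gauss x) * \<phi> z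
        = \<phi> (z + of_real c * x) * (E x - of_real (gauss x * gauss x)) + (\<phi> (z + of_real c * x) - \<phi> z) * of_real (gauss x * gauss x)"
      by (simp add: algebra_simps)
    also have "norm \<dots> \<le> norm (\<phi> (z + of_real c * x)) * norm (E x - of_real (gauss x * gauss x)) + norm (\<phi> (z + of_real c * x) - \<phi> z) * (gauss x * gauss x)"
      by (rule order_trans[OF norm_triangle_ineq]) (simp add: norm_mult abs_mult gauss_def)
    also have "\<dots> \<le> M * (k * ((norm x)\<^sup>2 * gauss x)) + (\<epsilon> + 2 * M * c\<^sup>2 / \<delta>\<^sup>2 * (norm x)\<^sup>2) * (gauss x * 1)"
      using pos M0 by (intro add_mono mult_mono \<phi> E2 osc) (auto simp: gauss_def)
    finally show ?thesis by (simp add: algebra_simps)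
  qed
  have "norm ((\<integral>x. \<phi> (z + of_real c * x) * E x \<partial>lborel) - of_real gauss_sq_mass * \<phi> z)
      = norm (\<integral>x. \<phi> (z + of_real c * x) * E x - of_real (gauss x * gauss x) * \<phi> z \<partial>lborel)"
    using i1 i2 k2 by (subst Bochner_Integration.integral_diff) auto
  also have "\<dots> \<le> (\<integral>x. (k * M + 2 * M * c\<^sup>2 / \<delta>\<^sup>2) * ((norm x)\<^sup>2 * gauss x) + \<epsilon> * gauss x \<partial>lborel)"
    by (rule Bochner_Integration.integral_norm_bound_integral) (use i1 i2 pt integrable_gauss in auto)
  also have "\<dots> = (k * M + 2 * M * c\<^sup>2 / \<delta>\<^sup>2) * gauss_moment + \<epsilon> * gauss_mass"
    using integrable_gauss unfolding gauss_moment_def gauss_mass_def by (subst Bochner_Integration.integral_add) auto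
  finally show ?thesis unfolding E_def .
qed

text \<open>The error caused by \<open>k\<close> does not vanish with the width of the kernel, so a
  single smoothing gains only a fixed factor. Kernel error, far field and near field each get an
  eighth of \<open>M * gauss_sq_mass\<close>; their total of 3/8 stays below 1/2.\<close>

lemma poly_closure_half_step:
  fixes \<phi> W :: "complex \<Rightarrow> complex"
  assumes k: "0 \<le> k" "k \<le> 1/2" "k * gauss_moment \<le> gauss_sq_mass / 8"
    and W: "\<And>z a. norm (W z - W a - cnj (z - a)) \<le> k * norm (z - a)"
    and cW: "continuous_on UNIV W" and D: "compact D"
    and \<phi>: "continuous_on UNIV \<phi>" "\<And>a. norm (\<phi> a) \<le> M" "\<And>a. a \<notin> cball 0 R \<Longrightarrow> \<phi> a = 0" and M: "M > 0"
    and unif: "\<And>e. e > 0 \<Longrightarrow> \<exists>d>0. \<forall>z\<in>D. \<forall>a. norm (a - z) < d \<longrightarrow> norm (\<phi> a - \<phi> z) \<le> e"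
  shows "\<exists>v\<in>poly_closure (\<lambda>z. z) W D. \<forall>z\<in>D. norm (\<phi> z - v z) \<le> M / 2"
proof -
  interpret uniform_algebra D "poly_closure (\<lambda>z. z) W D"
    using D continuous_on_subset[OF cW] by (intro uniform_algebra_poly_closure) auto
  note kp = gauss_sq_mass_pos and c0 = gauss_moment_nonneg and c1 = gauss_mass_nonneg
  define \<epsilon> where "\<epsilon> = M * gauss_sq_mass / 8 / (gauss_mass + 1)"
  have \<epsilon>: "\<epsilon> > 0" "\<epsilon> * gauss_mass \<le> M * gauss_sq_mass / 8"
  proof -
    show "\<epsilon> > 0" using M kp c1 by (simp add: \<epsilon>_def)
    have "\<epsilon> * gauss_mass \<le> \<epsilon> * (gauss_mass + 1)" using \<open>\<epsilon> > 0\<close> by simp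
    also have "\<dots> = M * gauss_sq_mass / 8" using c1 unfolding \<epsilon>_def by (intro nonzero_eq_divide_eq[THEN iffD1]) auto
    finally show "\<epsilon> * gauss_mass \<le> M * gauss_sq_mass / 8" .
  qed
  obtain \<delta> where \<delta>: "\<delta> > 0" "\<And>z a. z \<in> D \<Longrightarrow> norm (a - z) < \<delta> \<Longrightarrow> norm (\<phi> a - \<phi> z) \<le> \<epsilon>"
    using unif[OF \<epsilon>(1)] by blast
  \<comment> \<open>The width for which the far-field term is at most an eighth of
    \<open>M * gauss_sq_mass\<close>; the summand 1 in the denominator avoids division by
    zero.\<close>
  define c where "c = sqrt (\<delta>\<^sup>2 * gauss_sq_mass / (16 * (gauss_moment + 1)))"
  have c: "c > 0" "2 * M * c\<^sup>2 / \<delta>\<^sup>2 * gauss_moment \<le> M * gauss_sq_mass / 8"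
  proof -
    show "c > 0" using \<delta> kp c0 by (simp add: c_def)
    have "c\<^sup>2 = \<delta>\<^sup>2 * gauss_sq_mass / (16 * (gauss_moment + 1))" using kp c0 by (simp add: c_def)
    hence "2 * M * c\<^sup>2 / \<delta>\<^sup>2 * gauss_moment = M * gauss_sq_mass / 8 * (gauss_moment / (gauss_moment + 1))" using \<delta> c0 by (simp add: field_simps)
    also have "\<dots> \<le> M * gauss_sq_mass / 8 * 1" using M kp c0 by (intro mult_left_mono) auto
    finally show "2 * M * c\<^sup>2 / \<delta>\<^sup>2 * gauss_moment \<le> M * gauss_sq_mass / 8" by simp
  qed
  define T where "T = (\<lambda>z. \<integral>a. \<phi> a * exp (- of_real (1 / c\<^sup>2) * ((z - a) * (W z - W a))) \<partial>lborel)"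
  have "T \<in> poly_closure (\<lambda>z. z) W D" unfolding T_def
    by (rule gaussian_transform_in_poly_closure[OF cW D \<phi>(1,3)])
  hence "(\<lambda>z. of_real (1 / (c\<^sup>2 * gauss_sq_mass)) * T z) \<in> poly_closure (\<lambda>z. z) W D" by (intro mult const)
  moreover have "norm (\<phi> z - of_real (1 / (c\<^sup>2 * gauss_sq_mass)) * T z) \<le> M / 2" if z: "z \<in> D" for z
  proof -
    define J where "J = (\<integral>x. \<phi> (z + of_real c * x) * exp (- (x / of_real c) * (W (z + of_real c * x) - W z)) \<partial>lborel)"
    have "continuous_on UNIV (\<lambda>a. \<phi> a * exp (- of_real (1 / c\<^sup>2) * ((z - a) * (W z - W a))))"
      by (intro continuous_intros \<phi> cW)
    hence meas: "(\<lambda>a. \<phi> a * exp (- of_real (1 / c\<^sup>2) * ((z - a) * (W z - W a)))) \<in> borel_measurable borel"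
      by (rule borel_measurable_continuous_onI)
    have "T z = of_real (c\<^sup>2) * (\<integral>x. \<phi> (z + of_real c * x) * exp (- of_real (1 / c\<^sup>2) * ((z - (z + of_real c * x)) * (W z - W (z + of_real c * x)))) \<partial>lborel)"
      unfolding T_def by (rule lborel_integral_affine_complex[OF meas c(1)])
    also have "(\<integral>x. \<phi> (z + of_real c * x) * exp (- of_real (1 / c\<^sup>2) * ((z - (z + of_real c * x)) * (W z - W (z + of_real c * x)))) \<partial>lborel) = J"
      unfolding J_def
    proof (rule Bochner_Integration.integral_cong[OF refl])
      fix x
      have "- of_real (1 / c\<^sup>2) * ((z - (z + of_real c * x)) * (W z - W (z + of_real c * x)))
          = - (x / of_real c) * (W (z + of_real c * x) - W z)"
        using c(1) by (simp add: field_simps power2_eq_square)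
      thus "\<phi> (z + of_real c * x) * exp (- of_real (1 / c\<^sup>2) * ((z - (z + of_real c * x)) * (W z - W (z + of_real c * x))))
          = \<phi> (z + of_real c * x) * exp (- (x / of_real c) * (W (z + of_real c * x) - W z))"
        by (simp only:)
    qed
    finally have T: "T z = of_real (c\<^sup>2) * J" .
    have "norm (J - of_real gauss_sq_mass * \<phi> z) \<le> (k * M + 2 * M * c\<^sup>2 / \<delta>\<^sup>2) * gauss_moment + \<epsilon> * gauss_mass"
      unfolding J_def
      by (rule gaussian_transform_rescaled_estimate[OF k(1,2) W cW \<phi>(1,2)]) (use \<delta> z \<epsilon> c in auto)
    also have "\<dots> = M * (k * gauss_moment) + 2 * M * c\<^sup>2 / \<delta>\<^sup>2 * gauss_moment + \<epsilon> * gauss_mass" by (simp add: algebra_simps)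
    also have "\<dots> \<le> M * (gauss_sq_mass / 8) + M * gauss_sq_mass / 8 + M * gauss_sq_mass / 8"
      using k M \<epsilon> c by (intro add_mono mult_left_mono) auto
    also have "\<dots> \<le> M / 2 * gauss_sq_mass" using M kp by simp
    finally have "norm (J - of_real gauss_sq_mass * \<phi> z) \<le> M / 2 * gauss_sq_mass" .
    moreover have "\<phi> z - of_real (1 / (c\<^sup>2 * gauss_sq_mass)) * T z = - (J - of_real gauss_sq_mass * \<phi> z) / of_real gauss_sq_mass"
      using c(1) kp by (simp add: T field_simps)
    hence "norm (\<phi> z - of_real (1 / (c\<^sup>2 * gauss_sq_mass)) * T z) = norm (J - of_real gauss_sq_mass * \<phi> z) / gauss_sq_mass"
      using kp by (simp only: norm_divide norm_minus_cancel norm_of_real abs_of_pos)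
    ultimately show ?thesis using kp by (simp only: pos_divide_le_eq)
  qed
  ultimately show ?thesis by (intro bexI[of _ "\<lambda>z. of_real (1 / (c\<^sup>2 * gauss_sq_mass)) * T z"] ballI)
qed

lemma poly_closure_cong:
  assumes "\<And>z. z \<in> D \<Longrightarrow> w z = w' z"
  shows "poly_closure f w D = poly_closure f w' D"
  unfolding poly_closure_def using assms by simp

text \<open>A continuous function is approximated by the polynomial algebra up to half its norm by
  smearing it with the complex Gaussian \<open>exp (- t (z - a) (w z - w a))\<close>, which is an entire
  function of \<open>z\<close> and \<open>w z\<close>; iterating this makes the error arbitrarily small.\<close>

lemma poly_closure_near_conjugation:
  obtains k where "0 < k"
    "\<And>r w \<phi>. \<lbrakk>0 < r; \<And>z a. z \<in> cball 0 r \<Longrightarrow> a \<in> cball 0 r \<Longrightarrow> norm (w z - w a - cnj (z - a)) \<le> k * norm (z - a);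
        continuous_on (cball 0 r) \<phi>\<rbrakk> \<Longrightarrow> \<phi> \<in> poly_closure (\<lambda>z. z) w (cball 0 r)"
proof -
  \<comment> \<open>The bound 1/2 secures half of the Gaussian decay, the second one keeps the
    kernel error below an eighth of the total mass.\<close>
  define k where "k = min (1/2) (gauss_sq_mass / (8 * (gauss_moment + 1)))"
  have k: "0 < k" "k \<le> 1/2" "k * gauss_moment \<le> gauss_sq_mass / 8"
  proof -
    show "0 < k" using gauss_sq_mass_pos gauss_moment_nonneg by (simp add: k_def)
    show "k \<le> 1/2" unfolding k_def by (rule min.cobounded1)
    have "k * gauss_moment \<le> gauss_sq_mass / (8 * (gauss_moment + 1)) * gauss_moment" using gauss_moment_nonneg by (intro mult_right_mono) (auto simp: k_def)
    also have "\<dots> = gauss_sq_mass / 8 * (gauss_moment / (gauss_moment + 1))" by simp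
    also have "\<dots> \<le> gauss_sq_mass / 8 * 1" using gauss_sq_mass_pos gauss_moment_nonneg by (intro mult_left_mono) auto
    finally show "k * gauss_moment \<le> gauss_sq_mass / 8" by simp
  qed
  show ?thesis
  proof (rule that[OF k(1)])
    fix r :: real and w \<phi> :: "complex \<Rightarrow> complex"
    assume r: "0 < r" and w: "\<And>z a. z \<in> cball 0 r \<Longrightarrow> a \<in> cball 0 r \<Longrightarrow> norm (w z - w a - cnj (z - a)) \<le> k * norm (z - a)"
      and \<phi>: "continuous_on (cball 0 r) \<phi>"
    define D where "D = cball (0::complex) r"
    have D: "compact D" "convex D" "closed D" "D \<noteq> {}" using r by (auto simp: D_def)
    \<comment> \<open>The Gaussian integral runs over the plane, so \<open>w\<close> has to be
      extended. Composing \<open>w - cnj\<close> with the nearest-point projection, which is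
      1-Lipschitz, extends this perturbation with the same constant \<open>k\<close>.\<close>
    define cp where "cp = closest_point D"
    have cpD: "cp a \<in> D" for a unfolding cp_def using D by (intro closest_point_in_set) auto
    have cpid: "cp a = a" if "a \<in> D" for a unfolding cp_def using that by (rule closest_point_self)
    have cplip: "norm (cp a - cp b) \<le> norm (a - b)" for a b
      using closest_point_lipschitz[OF D(2-4), of a b] by (simp add: cp_def dist_norm)
    have ccp: "continuous_on UNIV cp" unfolding cp_def using D by (intro continuous_on_closest_point) auto
    define W where "W = (\<lambda>a. cnj a + (w (cp a) - cnj (cp a)))"
    have W: "norm (W z - W a - cnj (z - a)) \<le> k * norm (z - a)" for z a
    proof -
      have "norm (W z - W a - cnj (z - a)) = norm (w (cp z) - w (cp a) - cnj (cp z - cp a))"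
        by (simp add: W_def algebra_simps)
      also have "\<dots> \<le> k * norm (cp z - cp a)" using cpD unfolding D_def by (intro w) auto
      also have "\<dots> \<le> k * norm (z - a)" using k cplip by (intro mult_left_mono) auto
      finally show ?thesis .
    qed
    have cW: "continuous_on UNIV W"
    proof -
      have "(k + 1)-lipschitz_on UNIV W"
      proof (rule lipschitz_onI)
        fix z a :: complex
        have "norm (W z - W a) \<le> norm (W z - W a - cnj (z - a)) + norm (cnj (z - a))"
          using norm_triangle_ineq[of "W z - W a - cnj (z - a)" "cnj (z - a)"] by simp
        also have "\<dots> \<le> k * norm (z - a) + norm (z - a)" using W[of z a] by (simp only: complex_mod_cnj)
        finally show "dist (W z) (W a) \<le> (k + 1) * dist z a" by (simp add: dist_norm algebra_simps)
      qed (use k in auto)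
      thus ?thesis by (rule lipschitz_on_continuous_on)
    qed
    interpret uniform_algebra D "poly_closure (\<lambda>z. z) W D"
      using D continuous_on_subset[OF cW] by (intro uniform_algebra_poly_closure) auto
    have half: "\<exists>v\<in>poly_closure (\<lambda>z. z) W D. \<forall>z\<in>D. norm (u z - v z) \<le> M / 2"
      if u: "continuous_on D u" and M: "M > 0" and uM: "\<And>z. z \<in> D \<Longrightarrow> norm (u z) \<le> M" for u M
    proof -
      \<comment> \<open>A cutoff by the distance to \<open>D\<close>: the extension of
        \<open>u\<close> keeps the bound \<open>M\<close>, agrees with \<open>u\<close> on
        \<open>D\<close> and vanishes outside the ball of radius \<open>r + 1\<close>.\<close>
      define cut where "cut = (\<lambda>a. max 0 (1 - norm (a - cp a)))"
      define f where "f = (\<lambda>a. of_real (cut a) * u (cp a))"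
      have cf: "continuous_on UNIV f" unfolding f_def cut_def
        by (intro continuous_intros ccp continuous_on_compose2[OF u ccp]) (use cpD in auto)
      have fb: "norm (f a) \<le> M" for a
      proof -
        have "norm (f a) = cut a * norm (u (cp a))" by (simp add: f_def norm_mult cut_def)
        also have "\<dots> \<le> 1 * M" using uM[OF cpD] M by (intro mult_mono) (auto simp: cut_def)
        finally show ?thesis by simp
      qed
      have f0: "f a = 0" if "a \<notin> cball 0 (r + 1)" for a
      proof -
        have "norm a \<le> norm (a - cp a) + norm (cp a)" using norm_triangle_ineq[of "a - cp a" "cp a"] by simp
        hence "norm (a - cp a) > 1" using that cpD[of a] by (simp add: D_def)
        thus ?thesis by (simp add: f_def cut_def)
      qed
      have unif: "\<exists>d>0. \<forall>z\<in>D. \<forall>a. norm (a - z) < d \<longrightarrow> norm (f a - f z) \<le> e" if e: "e > 0" for e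
      proof -
        have "uniformly_continuous_on (cball 0 (r + 1)) f"
          by (intro compact_uniformly_continuous continuous_on_subset[OF cf]) auto
        then obtain d where d: "d > 0" "\<And>x y. x \<in> cball 0 (r + 1) \<Longrightarrow> y \<in> cball 0 (r + 1) \<Longrightarrow> dist y x < d \<Longrightarrow> dist (f y) (f x) < e"
          using e unfolding uniformly_continuous_on_def by meson
        show ?thesis
        proof (intro exI[of _ "min d 1"] conjI ballI allI impI)
          show "0 < min d 1" using d by simp
          fix z a assume z: "z \<in> D" and a: "norm (a - z) < min d 1"
          have "norm a \<le> norm (a - z) + norm z" using norm_triangle_ineq[of "a - z" z] by simp
          hence "a \<in> cball 0 (r + 1)" "z \<in> cball 0 (r + 1)" using z a by (auto simp: D_def)
          thus "norm (f a - f z) \<le> e" using d(2)[of z a] a by (simp add: dist_norm)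
        qed
      qed
      obtain v where v: "v \<in> poly_closure (\<lambda>z. z) W D" "\<forall>z\<in>D. norm (f z - v z) \<le> M / 2"
        using poly_closure_half_step[OF less_imp_le[OF k(1)] k(2,3) W cW D(1) cf fb f0 M unif] by auto
      have "f z = u z" if "z \<in> D" for z using cpid[OF that] by (simp add: f_def cut_def)
      thus ?thesis using v by (intro bexI[of _ v]) auto
    qed
    have "bounded (\<phi> ` D)" using \<phi> D by (intro compact_imp_bounded compact_continuous_image) (auto simp: D_def)
    then obtain M where M: "M > 0" "\<And>z. z \<in> D \<Longrightarrow> norm (\<phi> z) \<le> M" unfolding bounded_pos by auto
    \<comment> \<open>Each round applies \<open>half\<close> to the current residual, which is again
      continuous on \<open>D\<close>, with its own bound in place of \<open>M\<close>.\<close>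
    have iter: "\<exists>v\<in>poly_closure (\<lambda>z. z) W D. \<forall>z\<in>D. norm (\<phi> z - v z) \<le> M / 2 ^ n" for n
    proof (induction n)
      case 0 thus ?case using M const[of 0] by (intro bexI[of _ "\<lambda>_. 0"]) auto
    next
      case (Suc n)
      then obtain v where v: "v \<in> poly_closure (\<lambda>z. z) W D" "\<forall>z\<in>D. norm (\<phi> z - v z) \<le> M / 2 ^ n" by auto
      have "continuous_on D (\<lambda>z. \<phi> z - v z)"
        using \<phi> cont[OF v(1)] by (intro continuous_intros) (auto simp: D_def)
      moreover have "M / 2 ^ n > 0" using M by simp
      ultimately obtain v' where v': "v' \<in> poly_closure (\<lambda>z. z) W D" "\<forall>z\<in>D. norm (\<phi> z - v z - v' z) \<le> M / 2 ^ n / 2"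
        using half[of "\<lambda>z. \<phi> z - v z" "M / 2 ^ n"] v(2) by auto
      show ?case
      proof (intro bexI[of _ "\<lambda>z. v z + v' z"] ballI)
        fix z assume "z \<in> D"
        thus "norm (\<phi> z - (v z + v' z)) \<le> M / 2 ^ Suc n" using v'(2) by (simp add: algebra_simps)
      qed (intro add v v')
    qed
    have "\<phi> \<in> poly_closure (\<lambda>z. z) W D"
    proof (rule closed)
      fix e :: real assume e: "e > 0"
      obtain n where n: "(1/2::real) ^ n < e / M" using real_arch_pow_inv[of "e / M" "1/2"] e M by auto
      obtain v where v: "v \<in> poly_closure (\<lambda>z. z) W D" "\<forall>z\<in>D. norm (\<phi> z - v z) \<le> M / 2 ^ n" using iter[of n] by auto
      have "M / 2 ^ n < e" using n M by (simp add: field_simps power_one_over)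
      show "\<exists>v\<in>poly_closure (\<lambda>z. z) W D. \<forall>z\<in>D. norm (\<phi> z - v z) < e"
        by (rule bexI[OF _ v(1)]) (use v(2) \<open>M / 2 ^ n < e\<close> in fastforce)
    qed
    moreover have "poly_closure (\<lambda>z. z) W D = poly_closure (\<lambda>z. z) w D"
      using cpid by (intro poly_closure_cong) (auto simp: W_def)
    ultimately show "\<phi> \<in> poly_closure (\<lambda>z. z) w (cball 0 r)" by (simp add: D_def)
  qed
qed

section \<open>Holomorphic functions of two variables\<close>

text \<open>Restriction to complex lines makes the one-variable Cauchy theory available for
  \<open>F\<close>.\<close>

lemma holomorphic2_derivative_along_line:
  assumes F: "(F has_derivative (\<lambda>v. a * fst v + b * snd v)) (at (x + (t * fst v, t * snd v)))"
  shows "((\<lambda>t. F (x + (t * fst v, t * snd v))) has_field_derivative (a * fst v + b * snd v)) (at (t :: complex))"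
proof -
  have "((\<lambda>t. x + (t * fst v, t * snd v)) has_derivative (\<lambda>s. (s * fst v, s * snd v))) (at t)"
    by (auto intro!: derivative_eq_intros has_derivative_Pair)
  from diff_chain_at[OF this F]
  have "((\<lambda>t. F (x + (t * fst v, t * snd v))) has_derivative (\<lambda>s. a * (s * fst v) + b * (s * snd v))) (at t)"
    by (simp add: o_def)
  thus ?thesis unfolding has_field_derivative_def
    by (rule has_derivative_eq_rhs) (simp add: fun_eq_iff algebra_simps)
qed

lemma norm_scale_pair: "norm (t * fst v, t * snd v) = norm t * norm (v :: complex \<times> complex)" for t :: complex
proof -
  have "norm (t * fst v, t * snd v) = sqrt ((norm t)\<^sup>2 * ((norm (fst v))\<^sup>2 + (norm (snd v))\<^sup>2))"
    by (simp add: norm_Pair norm_mult power_mult_distrib distrib_left)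
  thus ?thesis by (simp add: real_sqrt_mult norm_prod_def)
qed

text \<open>Cauchy's inequality on complex lines turns the bound C \<rho>^5 for \<open>F\<close> on
  the ball of radius \<rho> into a derivative bound of order \<rho>^4 on the half-size ball. This
  factor makes \<open>F\<close> a small perturbation, and each iteration step gains it.\<close>

lemma holomorphic2_lipschitz:
  fixes F :: "complex \<times> complex \<Rightarrow> complex"
  assumes F: "holomorphic2_on (ball 0 r0) F" and FC: "\<And>w. w \<in> ball 0 r0 \<Longrightarrow> norm (F w) \<le> C * norm w ^ 5"
    and C: "C \<ge> 0" and \<rho>: "0 < \<rho>" "\<rho> \<le> r0" and xy: "x \<in> ball 0 (\<rho> / 2)" "y \<in> ball 0 (\<rho> / 2)"
  shows "norm (F x - F y) \<le> 2 * C * \<rho> ^ 4 * norm (x - y)"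
proof -
  have "\<forall>w. \<exists>a b. w \<in> ball 0 r0 \<longrightarrow> (F has_derivative (\<lambda>v. a * fst v + b * snd v)) (at w)"
    using F unfolding holomorphic2_on_def by blast
  then obtain a b where ab: "\<And>w. w \<in> ball 0 r0 \<Longrightarrow> (F has_derivative (\<lambda>v. a w * fst v + b w * snd v)) (at w)"
    by metis
  show ?thesis
  proof (rule differentiable_bound[where S = "ball 0 (\<rho> / 2)" and f' = "\<lambda>w v. a w * fst v + b w * snd v"])
    fix w :: "complex \<times> complex" assume w: "w \<in> ball 0 (\<rho> / 2)"
    hence w': "w \<in> ball 0 r0" using \<rho> by auto
    show "(F has_derivative (\<lambda>v. a w * fst v + b w * snd v)) (at w within ball 0 (\<rho> / 2))"
      using ab[OF w'] by (rule has_derivative_at_withinI)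
    show "onorm (\<lambda>v. a w * fst v + b w * snd v) \<le> 2 * C * \<rho> ^ 4"
    proof (rule onorm_bound)
      show "0 \<le> 2 * C * \<rho> ^ 4" using C by simp
      fix v :: "complex \<times> complex"
      show "norm (a w * fst v + b w * snd v) \<le> 2 * C * \<rho> ^ 4 * norm v"
      proof (cases "v = 0")
        case False
        \<comment> \<open>The largest radius for which the segment part t v has norm at most \<rho>
          / 2, so that the disk around \<open>w\<close> in direction \<open>v\<close> stays inside
          the ball of radius \<rho>.\<close>
        define R where "R = \<rho> / 2 / norm v"
        have R: "R > 0" using False \<rho> by (simp add: R_def)
        define G where "G = (\<lambda>t. F (w + (t * fst v, t * snd v)))"
        have in_ball: "norm (w + (t * fst v, t * snd v)) < \<rho>" if "norm t \<le> R" for t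
        proof -
          have "norm (w + (t * fst v, t * snd v)) \<le> norm w + norm t * norm v"
            by (metis norm_triangle_ineq norm_scale_pair)
          also have "norm t * norm v \<le> R * norm v" using that by (intro mult_right_mono) auto
          also have "R * norm v = \<rho> / 2" using False by (simp add: R_def)
          finally show ?thesis using w by simp
        qed
        have der: "(G has_field_derivative (a (w + (t * fst v, t * snd v)) * fst v + b (w + (t * fst v, t * snd v)) * snd v)) (at t)"
          if "norm t \<le> R" for t
          unfolding G_def by (intro holomorphic2_derivative_along_line ab) (use in_ball[OF that] \<rho> in auto)
        have "norm ((deriv ^^ 1) G 0) \<le> fact 1 * (C * \<rho> ^ 5) / R ^ 1"
        proof (rule Cauchy_inequality[OF _ _ R])
          show "G holomorphic_on ball 0 R"
            unfolding holomorphic_on_def field_differentiable_def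
            using der by (metis dual_order.strict_implies_order has_field_derivative_at_within mem_ball_0)
          show "continuous_on (cball 0 R) G"
            using der by (intro continuous_at_imp_continuous_on ballI) (metis DERIV_isCont mem_cball_0)
          fix t :: complex assume "norm (0 - t) = R"
          hence t: "norm (w + (t * fst v, t * snd v)) < \<rho>" by (intro in_ball) simp
          have "norm (G t) \<le> C * norm (w + (t * fst v, t * snd v)) ^ 5"
            unfolding G_def using t \<rho> by (intro FC) auto
          also have "\<dots> \<le> C * \<rho> ^ 5" using t C by (intro mult_left_mono power_mono) auto
          finally show "norm (G t) \<le> C * \<rho> ^ 5" .
        qed
        moreover have "deriv G 0 = a w * fst v + b w * snd v"
          using der[of 0] R by (intro DERIV_imp_deriv) (simp flip: zero_prod_def)
        moreover have "C * \<rho> ^ 5 / R = 2 * C * \<rho> ^ 4 * norm v"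
          using \<rho> False by (simp add: R_def power_Suc numeral_eq_Suc)
        ultimately show ?thesis by simp
      qed simp
    qed
  qed (use xy in \<open>auto\<close>)
qed

lemma holomorphic_poly_approx:
  assumes f: "f holomorphic_on ball 0 R" and \<rho>: "0 \<le> \<rho>" "\<rho> < R" and e: "e > 0"
  shows "\<exists>p. \<forall>z\<in>cball 0 \<rho>. norm (f z - poly p z) < e"
proof -
  define a where "a = (\<lambda>n. (deriv ^^ n) f 0 / fact n)"
  have s: "(\<lambda>n. a n * z ^ n) sums f z" if "norm z < R" for z
    using holomorphic_power_series[OF f, of z] that by (simp add: a_def)
  define y :: complex where "y = of_real ((\<rho> + R) / 2)"
  have ny: "norm y = (\<rho> + R) / 2" unfolding y_def norm_of_real using \<rho> by simp
  have "summable (\<lambda>n. a n * y ^ n)" by (rule sums_summable[OF s]) (use \<rho> ny in simp)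
  hence "conv_radius a \<ge> norm y" by (rule conv_radius_geI)
  moreover have "ereal \<rho> < norm y" using ny \<rho> by simp
  ultimately have "\<rho> < conv_radius a" by (rule less_le_trans[rotated])
  from powser_uniform_limit[OF this, of 0]
  obtain N where N: "\<And>z. z \<in> cball 0 \<rho> \<Longrightarrow> dist (\<Sum>i<N. a i * z ^ i) (\<Sum>i. a i * z ^ i) < e"
    using e unfolding uniform_limit_iff eventually_sequentially by fastforce
  define p where "p = (\<Sum>i<N. monom (a i) i)"
  have "norm (f z - poly p z) < e" if z: "z \<in> cball 0 \<rho>" for z
  proof -
    have "(\<Sum>i. a i * z ^ i) = f z" using s[of z] z \<rho> by (intro sums_unique[symmetric]) simp
    thus ?thesis using N[OF z] by (simp add: p_def poly_sum poly_monom dist_norm norm_minus_commute)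
  qed
  thus ?thesis by blast
qed

text \<open>\<open>F\<close> is expanded in powers of the second variable, the series is truncated,
  and each coefficient, holomorphic in the first variable, is replaced by a polynomial. The
  holomorphy of the coefficients is the point that needs an argument.\<close>

lemma holomorphic2_poly_approx:
  fixes F :: "complex \<times> complex \<Rightarrow> complex"
  assumes F: "holomorphic2_on (ball 0 r0) F" and FM: "\<And>w. w \<in> ball 0 r0 \<Longrightarrow> norm (F w) \<le> M"
    and r0: "r0 > 0" and e: "e > 0"
  shows "\<exists>P. \<forall>z\<in>cball 0 (r0/6). \<forall>w\<in>cball 0 (r0/6). norm (F (z, w) - poly2 P z w) < e"
proof -
  \<comment> \<open>The closed bidisk of radius r0 / 3 lies in the ball of radius \<open>r0\<close>,
    and \<rho> = R / 2 makes the ratio of the tail at most 1/2.\<close>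
  define R \<rho> where "R = r0 / 3" and "\<rho> = r0 / 6"
  have R: "R > 0" "\<rho> > 0" "\<rho> < R" "\<rho> = R / 2" using r0 by (auto simp: R_def \<rho>_def)
  have M: "M \<ge> 0" using order_trans[OF norm_ge_zero FM[of 0]] r0 by simp
  have "\<forall>w. \<exists>a b. w \<in> ball 0 r0 \<longrightarrow> (F has_derivative (\<lambda>v. a * fst v + b * snd v)) (at w)"
    using F unfolding holomorphic2_on_def by blast
  then obtain a b where ab: "\<And>w. w \<in> ball 0 r0 \<Longrightarrow> (F has_derivative (\<lambda>v. a w * fst v + b w * snd v)) (at w)"
    by metis
  have inb: "(z, w) \<in> ball 0 r0" if "norm z \<le> R" "norm w \<le> R" for z w :: complex
    using norm_Pair_le[of z w] that r0 by (simp add: R_def)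
  have d2: "(\<lambda>w. F (z, w)) field_differentiable (at w)" if "norm z \<le> R" "norm w \<le> R" for z w
  proof -
    have "(F has_derivative (\<lambda>v. a (z, w) * fst v + b (z, w) * snd v)) (at ((z, 0) + (w * fst (0, 1), w * snd (0, 1))))"
      using ab[OF inb[OF that]] by simp
    from holomorphic2_derivative_along_line[OF this] show ?thesis
      unfolding field_differentiable_def by (intro exI[of _ "b (z, w)"]) simp
  qed
  have d1: "(\<lambda>z. F (z, w)) field_differentiable (at z)" if "norm z \<le> R" "norm w \<le> R" for z w
  proof -
    have "(F has_derivative (\<lambda>v. a (z, w) * fst v + b (z, w) * snd v)) (at ((0, w) + (z * fst (1, 0), z * snd (1, 0))))"
      using ab[OF inb[OF that]] by simp
    from holomorphic2_derivative_along_line[OF this] show ?thesis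
      unfolding field_differentiable_def by (intro exI[of _ "a (z, w)"]) simp
  qed
  have hc: "f holomorphic_on ball 0 R" "continuous_on (cball 0 R) f"
    if f: "\<And>w. norm w \<le> R \<Longrightarrow> f field_differentiable (at w)" for f :: "complex \<Rightarrow> complex"
  proof -
    show "f holomorphic_on ball 0 R" unfolding holomorphic_on_def
      by (simp add: f field_differentiable_at_within)
    show "continuous_on (cball 0 R) f"
      by (rule continuous_at_imp_continuous_on) (simp add: f field_differentiable_imp_continuous_at)
  qed
  have h2: "(\<lambda>w. F (z, w)) holomorphic_on ball 0 R" "continuous_on (cball 0 R) (\<lambda>w. F (z, w))" if "norm z \<le> R" for z
    by (rule hc, rule d2[OF that], assumption)+
  have h1: "(\<lambda>z. F (z, w)) holomorphic_on ball 0 R" "continuous_on (cball 0 R) (\<lambda>z. F (z, w))" if "norm w \<le> R" for w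
    by (rule hc, rule d1[OF _ that], assumption)+
  define c where "c = (\<lambda>n z. (deriv ^^ n) (\<lambda>w. F (z, w)) 0 / fact n)"
  have cb: "norm (c n z) \<le> M / R ^ n" if "norm z \<le> R" for n z
  proof -
    have "norm ((deriv ^^ n) (\<lambda>w. F (z, w)) 0) \<le> fact n * M / R ^ n"
      by (rule Cauchy_inequality[OF h2[OF that] R(1)]) (use that in \<open>auto intro!: FM inb\<close>)
    hence "norm (c n z) \<le> fact n * M / R ^ n / fact n"
      unfolding c_def norm_divide norm_fact by (intro divide_right_mono) auto
    thus ?thesis by simp
  qed
  have tail: "norm (F (z, w) - (\<Sum>k<n. c k z * w ^ k)) \<le> 2 * M * (norm w / R) ^ n"
    if z: "norm z \<le> R" and w: "norm w \<le> \<rho>" for z w n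
  proof -
    have w': "norm w / R \<le> 1/2" using w R by (simp add: field_simps)
    have s: "(\<lambda>k. c k z * w ^ k) sums F (z, w)"
      using holomorphic_power_series[OF h2(1)[OF z], of w] w R by (simp add: c_def)
    have sg: "(\<lambda>k. M * (norm w / R) ^ n * (norm w / R) ^ k) sums (M * (norm w / R) ^ n * (1 / (1 - norm w / R)))"
      using w' R by (intro sums_mult geometric_sums) auto
    have "(\<lambda>k. c (k + n) z * w ^ (k + n)) sums (F (z, w) - (\<Sum>k<n. c k z * w ^ k))"
      using sums_split_initial_segment[OF s] .
    hence "F (z, w) - (\<Sum>k<n. c k z * w ^ k) = (\<Sum>k. c (k + n) z * w ^ (k + n))" by (rule sums_unique)
    also have "norm \<dots> \<le> (\<Sum>k. M * (norm w / R) ^ n * (norm w / R) ^ k)"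
    proof (rule norm_suminf_le)
      fix k
      have "norm (c (k + n) z * w ^ (k + n)) \<le> M / R ^ (k + n) * norm w ^ (k + n)"
        unfolding norm_mult norm_power by (intro mult_right_mono cb[OF z]) auto
      thus "norm (c (k + n) z * w ^ (k + n)) \<le> M * (norm w / R) ^ n * (norm w / R) ^ k"
        by (simp add: power_add power_divide mult_ac)
    qed (rule sums_summable[OF sg])
    also have "\<dots> = M * (norm w / R) ^ n * (1 / (1 - norm w / R))" using sg by (rule sums_unique[symmetric])
    also have "\<dots> \<le> M * (norm w / R) ^ n * 2" using w' M R by (intro mult_left_mono) (auto simp: divide_simps)
    finally show ?thesis by simp
  qed
  \<comment> \<open>Strong induction: once the lower coefficients are known to be holomorphic,
    \<open>c n\<close> is the uniform limit of the quotients \<open>f j\<close>, because by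
    \<open>tail\<close> the expansion up to order n has an error O(|W j|^(n+1)) uniformly in
    z.\<close>
  have hol: "continuous_on (cball 0 R) (c n) \<and> c n holomorphic_on ball 0 R" for n
  proof (induction n rule: less_induct)
    case (less n)
    define W :: "nat \<Rightarrow> complex" where "W j = of_real (\<rho> / Suc j)" for j
    have nW: "norm (W j) = \<rho> / Suc j" for j unfolding W_def norm_of_real using R by simp
    have Wp: "norm (W j) \<le> \<rho>" "norm (W j) \<le> R" "W j \<noteq> 0" for j
    proof -
      show 1: "norm (W j) \<le> \<rho>" unfolding nW using R by (simp add: divide_simps)
      thus "norm (W j) \<le> R" using R by simp
      show "W j \<noteq> 0" unfolding W_def of_real_eq_0_iff using R by simp
    qed
    define f where "f = (\<lambda>j z. (F (z, W j) - (\<Sum>k<n. c k z * W j ^ k)) / W j ^ n)"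
    have "continuous_on (cball 0 R) (f j) \<and> f j holomorphic_on ball 0 R" for j
      unfolding f_def using less h1[OF Wp(2)] Wp(3)
      by (auto intro!: continuous_intros holomorphic_intros)
    hence ev: "\<forall>\<^sub>F j in sequentially. continuous_on (cball 0 R) (f j) \<and> f j holomorphic_on ball 0 R" by simp
    have lim: "uniform_limit (cball 0 R) f (c n) sequentially"
    proof (rule uniform_limitI)
      fix \<epsilon> :: real assume eps: "\<epsilon> > 0"
      have "(\<lambda>j. 2 * M / R ^ Suc n * \<rho> * inverse (real (Suc j))) \<longlonglongrightarrow> 2 * M / R ^ Suc n * \<rho> * 0"
        by (intro tendsto_mult_left LIMSEQ_inverse_real_of_nat)
      hence "\<forall>\<^sub>F j in sequentially. 2 * M / R ^ Suc n * \<rho> * inverse (real (Suc j)) < \<epsilon>"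
        using eps by (intro order_tendstoD(2)) auto
      thus "\<forall>\<^sub>F j in sequentially. \<forall>z\<in>cball 0 R. dist (f j z) (c n z) < \<epsilon>"
      proof eventually_elim
        case (elim j)
        show ?case
        proof
          fix z :: complex assume "z \<in> cball 0 R"
          hence z: "norm z \<le> R" by simp
          have "f j z - c n z = (F (z, W j) - (\<Sum>k<Suc n. c k z * W j ^ k)) / W j ^ n"
            using Wp(3)[of j] by (simp add: f_def field_simps)
          hence "norm (f j z - c n z) = norm (F (z, W j) - (\<Sum>k<Suc n. c k z * W j ^ k)) / norm (W j) ^ n"
            by (simp add: norm_divide norm_power)
          also have "\<dots> \<le> 2 * M * (norm (W j) / R) ^ Suc n / norm (W j) ^ n"
            using tail[OF z Wp(1)[of j], of "Suc n"] by (intro divide_right_mono) auto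
          also have "\<dots> = 2 * M / R ^ Suc n * norm (W j)"
            using Wp(3)[of j] by (simp add: power_divide)
          also have "\<dots> = 2 * M / R ^ Suc n * \<rho> * inverse (real (Suc j))" unfolding nW by (simp add: divide_inverse)
          finally show "dist (f j z) (c n z) < \<epsilon>" using elim by (simp add: dist_norm)
        qed
      qed
    qed
    show ?case using holomorphic_uniform_limit[OF ev lim] by auto
  qed
  have "(\<lambda>n. 2 * M * (1/2) ^ n) \<longlonglongrightarrow> 2 * M * 0" by (intro tendsto_mult_left LIMSEQ_power_zero) auto
  hence "\<forall>\<^sub>F n in sequentially. 2 * M * (1/2) ^ n < e / 2" using e by (intro order_tendstoD(2)) auto
  then obtain n where n: "2 * M * (1/2) ^ n < e / 2" unfolding eventually_sequentially by blast
  define \<eta> where "\<eta> = e / 2 / (1 + (\<Sum>k<n. \<rho> ^ k))"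
  have S0: "(\<Sum>k<n. \<rho> ^ k) \<ge> 0" using R by (intro sum_nonneg) auto
  have \<eta>: "\<eta> > 0" using e S0 by (simp add: \<eta>_def)
  have "\<forall>k. \<exists>p. \<forall>z\<in>cball 0 \<rho>. norm (c k z - poly p z) < \<eta>"
    using hol R \<eta> by (intro allI holomorphic_poly_approx[of _ R]) auto
  then obtain p where p: "\<And>k z. z \<in> cball 0 \<rho> \<Longrightarrow> norm (c k z - poly (p k) z) < \<eta>" by metis
  define P where "P = (\<Sum>k<n. monom (p k) k)"
  have P: "poly2 P z w = (\<Sum>k<n. poly (p k) z * w ^ k)" for z w
    by (simp add: P_def poly2_def poly_sum poly_monom)
  have "norm (F (z, w) - poly2 P z w) < e" if z: "z \<in> cball 0 \<rho>" and w: "w \<in> cball 0 \<rho>" for z w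
  proof -
    have zw: "norm z \<le> R" "norm w \<le> \<rho>" using z w R by auto
    have "norm (F (z, w) - (\<Sum>k<n. c k z * w ^ k)) \<le> 2 * M * (norm w / R) ^ n" by (rule tail[OF zw])
    also have "\<dots> \<le> 2 * M * (1/2) ^ n" using zw M R by (intro mult_left_mono power_mono) (auto simp: divide_simps)
    also note n
    finally have 1: "norm (F (z, w) - (\<Sum>k<n. c k z * w ^ k)) < e / 2" .
    have "norm ((\<Sum>k<n. c k z * w ^ k) - poly2 P z w) = norm (\<Sum>k<n. (c k z - poly (p k) z) * w ^ k)"
      by (simp add: P sum_subtractf left_diff_distrib)
    also have "\<dots> \<le> (\<Sum>k<n. \<eta> * \<rho> ^ k)"
      unfolding norm_mult norm_power using \<eta> zw(2) less_imp_le[OF p[OF z]]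
      by (intro sum_norm_le) (simp add: norm_mult norm_power mult_mono power_mono)
    also have "\<dots> = e / 2 * ((\<Sum>k<n. \<rho> ^ k) / (1 + (\<Sum>k<n. \<rho> ^ k)))" unfolding sum_distrib_left[symmetric] \<eta>_def by simp
    also have "\<dots> \<le> e / 2 * 1" using e S0 by (intro mult_left_mono) auto
    finally have 2: "norm ((\<Sum>k<n. c k z * w ^ k) - poly2 P z w) \<le> e / 2" by simp
    show ?thesis
      using norm_triangle_ineq[of "F (z, w) - (\<Sum>k<n. c k z * w ^ k)" "(\<Sum>k<n. c k z * w ^ k) - poly2 P z w"] 1 2 by simp
  qed
  thus ?thesis unfolding \<rho>_def by blast
qed

section \<open>Taylor expansion and positivity\<close>

text \<open>The remainders satisfy R(n+1) = (c + e) R(n) + n c^(n-1) e^2 with |c + e| \<le> 2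
  \<rho>. Both summands are bounded by 2 * 4^n times the same quantity, which gives 4^(n+1). The
  factor \<open>\<rho>\<^sup>2\<close> replaces a division and so admits \<rho> = 0.\<close>

lemma power_taylor_remainder:
  fixes c e :: complex
  assumes "norm c = \<rho>" "norm e \<le> \<rho>"
  shows "\<rho>\<^sup>2 * norm ((c + e) ^ n - c ^ n - of_nat n * c ^ (n - 1) * e) \<le> 4 ^ n * \<rho> ^ n * (norm e)\<^sup>2"
proof (induction n)
  case 0 show ?case by simp
next
  case (Suc n)
  define R where "R = (c + e) ^ n - c ^ n - of_nat n * c ^ (n - 1) * e"
  have \<rho>: "\<rho> \<ge> 0" using assms norm_ge_zero by metis
  have cn: "of_nat n * c * c ^ (n - 1) = of_nat n * c ^ n" by (cases n) auto
  have "(c + e) ^ Suc n - c ^ Suc n - of_nat (Suc n) * c ^ (Suc n - 1) * e = (c + e) * R + of_nat n * c ^ (n - 1) * e\<^sup>2"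
  proof -
    have "(c + e) * R + of_nat n * c ^ (n - 1) * e\<^sup>2
        = (c + e) ^ Suc n - c ^ Suc n - c ^ n * e - (of_nat n * c * c ^ (n - 1)) * e"
      by (simp add: R_def algebra_simps power2_eq_square)
    thus ?thesis unfolding cn by (simp add: algebra_simps)
  qed
  hence "\<rho>\<^sup>2 * norm ((c + e) ^ Suc n - c ^ Suc n - of_nat (Suc n) * c ^ (Suc n - 1) * e)
      \<le> \<rho>\<^sup>2 * (norm (c + e) * norm R + norm (of_nat n * c ^ (n - 1) * e\<^sup>2))"
    by (simp only:) (intro mult_left_mono order_trans[OF norm_triangle_ineq], auto simp: norm_mult)
  also have "\<dots> = norm (c + e) * (\<rho>\<^sup>2 * norm R) + \<rho>\<^sup>2 * (n * \<rho> ^ (n - 1)) * (norm e)\<^sup>2"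
    using assms by (simp add: norm_mult norm_power algebra_simps)
  also have "\<dots> \<le> (2 * \<rho>) * (4 ^ n * \<rho> ^ n * (norm e)\<^sup>2) + (2 * 4 ^ n * \<rho> ^ Suc n) * (norm e)\<^sup>2"
  proof (rule add_mono)
    show "norm (c + e) * (\<rho>\<^sup>2 * norm R) \<le> (2 * \<rho>) * (4 ^ n * \<rho> ^ n * (norm e)\<^sup>2)"
      using norm_triangle_ineq[of c e] assms Suc.IH \<rho> by (intro mult_mono[of "norm (c + e)"]) (auto simp: R_def)
    have "\<rho>\<^sup>2 * (real n * \<rho> ^ (n - 1)) \<le> 2 * 4 ^ n * \<rho> ^ Suc n"
    proof (cases n)
      case (Suc k)
      have "real n \<le> 2 * 4 ^ n"
      proof -
        have "real n \<le> 2 ^ n" using of_nat_less_two_power[of n, where 'a = real] by simp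
        also have "\<dots> \<le> 4 ^ n" by (intro power_mono) auto
        finally show ?thesis using zero_le_power[of "4::real" n] by linarith
      qed
      hence "real n * \<rho> ^ Suc n \<le> 2 * 4 ^ n * \<rho> ^ Suc n" using \<rho> by (intro mult_right_mono) auto
      thus ?thesis using Suc by (simp add: power2_eq_square mult_ac)
    qed (use \<rho> in auto)
    thus "\<rho>\<^sup>2 * (real n * \<rho> ^ (n - 1)) * (norm e)\<^sup>2 \<le> (2 * 4 ^ n * \<rho> ^ Suc n) * (norm e)\<^sup>2"
      by (rule mult_right_mono) simp
  qed
  also have "\<dots> = 4 ^ Suc n * \<rho> ^ Suc n * (norm e)\<^sup>2" by (simp add: algebra_simps)
  finally show ?case .
qed

text \<open>For \<open>k = d\<close> the truncated exponent \<open>d - k - 1\<close> is harmless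
  because the factor \<open>of_nat (d - k)\<close> vanishes.\<close>

lemma dpoly2_at_altdef:
  "dpoly2_at a d z = (\<Sum>k\<le>d. a k * z ^ k * (of_nat (d - k) * cnj z ^ (d - k - 1)))"
  unfolding dpoly2_at_def hpoly_def
  by (rule DERIV_imp_deriv) (auto intro!: derivative_eq_intros DERIV_sum simp: mult_ac)

lemma hpoly_taylor:
  assumes "norm e \<le> norm z"
  shows "(norm z)\<^sup>2 * norm (hpoly a d z (cnj z + e) - hpoly a d z (cnj z) - dpoly2_at a d z * e)
      \<le> (\<Sum>k\<le>d. norm (a k) * 4 ^ d) * norm z ^ d * (norm e)\<^sup>2"
proof -
  let ?R = "\<lambda>n. (cnj z + e) ^ n - cnj z ^ n - of_nat n * cnj z ^ (n - 1) * e"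
  have "hpoly a d z (cnj z + e) - hpoly a d z (cnj z) - dpoly2_at a d z * e = (\<Sum>k\<le>d. a k * z ^ k * ?R (d - k))"
    unfolding hpoly_def dpoly2_at_altdef sum_distrib_right sum_subtractf[symmetric]
    by (intro sum.cong refl) (simp add: algebra_simps)
  hence "(norm z)\<^sup>2 * norm (hpoly a d z (cnj z + e) - hpoly a d z (cnj z) - dpoly2_at a d z * e)
      \<le> (norm z)\<^sup>2 * (\<Sum>k\<le>d. norm (a k * z ^ k * ?R (d - k)))"
    by (simp only:) (intro mult_left_mono norm_sum, auto)
  also have "\<dots> = (\<Sum>k\<le>d. norm (a k) * norm z ^ k * ((norm z)\<^sup>2 * norm (?R (d - k))))"
    unfolding sum_distrib_left by (intro sum.cong refl) (simp add: norm_mult norm_power)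
  also have "\<dots> \<le> (\<Sum>k\<le>d. norm (a k) * norm z ^ k * (4 ^ d * norm z ^ (d - k) * (norm e)\<^sup>2))"
  proof (intro sum_mono mult_left_mono)
    fix k assume "k \<in> {..d}"
    have "(norm z)\<^sup>2 * norm (?R (d - k)) \<le> 4 ^ (d - k) * norm z ^ (d - k) * (norm e)\<^sup>2"
      by (rule power_taylor_remainder) (use assms in auto)
    also have "\<dots> \<le> 4 ^ d * norm z ^ (d - k) * (norm e)\<^sup>2"
      by (intro mult_right_mono power_increasing) auto
    finally show "(norm z)\<^sup>2 * norm (?R (d - k)) \<le> 4 ^ d * norm z ^ (d - k) * (norm e)\<^sup>2" .
  qed auto
  also have "\<dots> = (\<Sum>k\<le>d. norm (a k) * 4 ^ d * norm z ^ d * (norm e)\<^sup>2)"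
    by (intro sum.cong refl) (simp add: mult_ac flip: power_add)
  finally show ?thesis by (simp add: sum_distrib_right)
qed

text \<open>Conjugation exchanges the terms with indices k and d - k. Hence the imaginary part of a
  perturbed value starts with the first-order Taylor term.\<close>

lemma Im_hpoly_cnj:
  assumes "complex_symmetric a d" shows "Im (hpoly a d z (cnj z)) = 0"
proof -
  have "cnj (hpoly a d z (cnj z)) = (\<Sum>k\<le>d. cnj (a k) * cnj z ^ k * z ^ (d - k))" by (simp add: hpoly_def)
  also have "\<dots> = (\<Sum>k\<le>d. cnj (a (d - k)) * cnj z ^ (d - k) * z ^ (d - (d - k)))"
    by (rule sum.reindex_bij_witness[of _ "\<lambda>k. d - k" "\<lambda>k. d - k"]) auto
  also have "\<dots> = hpoly a d z (cnj z)"
  proof -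
    have "cnj (a (d - k)) = a k" if "k \<le> d" for k
      using assms that unfolding complex_symmetric_def by metis
    thus ?thesis unfolding hpoly_def by (intro sum.cong refl) auto
  qed
  finally have "Im (cnj (hpoly a d z (cnj z))) = Im (hpoly a d z (cnj z))" by (rule arg_cong)
  thus ?thesis by simp
qed

lemma dpoly2_at_homogeneous:
  assumes "d \<ge> 1"
  shows "dpoly2_at a d (of_real t * z) = of_real (t ^ (d - 1)) * dpoly2_at a d z"
  unfolding dpoly2_at_altdef sum_distrib_left
proof (intro sum.cong refl)
  fix k assume k: "k \<in> {..d}"
  show "a k * (of_real t * z) ^ k * (of_nat (d - k) * cnj (of_real t * z) ^ (d - k - 1))
      = of_real (t ^ (d - 1)) * (a k * z ^ k * (of_nat (d - k) * cnj z ^ (d - k - 1)))"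
  proof (cases "k = d")
    case False
    hence "k + (d - k - 1) = d - 1" using k by auto
    hence "t ^ (d - 1) = t ^ k * t ^ (d - k - 1)" by (metis power_add)
    thus ?thesis by (simp add: power_mult_distrib)
  qed simp
qed

lemma dpoly2_at_cont: "continuous_on S (dpoly2_at a d)"
  unfolding dpoly2_at_altdef[abs_def] by (intro continuous_intros)

lemma dpoly2_at_bound:
  assumes "d \<ge> 1"
  shows "norm (dpoly2_at a d z) \<le> (\<Sum>k\<le>d. norm (a k) * d) * norm z ^ (d - 1)"
  unfolding dpoly2_at_altdef sum_distrib_right
proof (intro sum_norm_le)
  fix k assume k: "k \<in> {..d}"
  show "norm (a k * z ^ k * (of_nat (d - k) * cnj z ^ (d - k - 1))) \<le> norm (a k) * d * norm z ^ (d - 1)"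
  proof (cases "k = d")
    case False
    hence "k + (d - k - 1) = d - 1" using k by auto
    hence e: "norm z ^ (d - 1) = norm z ^ k * norm z ^ (d - k - 1)" by (metis power_add)
    have "norm (a k) * real (d - k) * norm z ^ (d - 1) \<le> norm (a k) * d * norm z ^ (d - 1)"
      by (intro mult_right_mono mult_left_mono) auto
    thus ?thesis unfolding e by (simp add: norm_mult norm_power mult_ac)
  qed simp
qed

text \<open>By compactness max(A, B) has a positive minimum \<mu>. Where B \<ge> \<mu> the claim is
  immediate; elsewhere A \<ge> \<mu>, which outweighs the possibly negative t B as soon as t (\<mu>
  + b) \<le> \<mu>, with b a bound for |B|. In the application t is |z|^2.\<close>

lemma max_pos_imp_linear_lower_bound:
  fixes A B :: "'a :: topological_space \<Rightarrow> real"
  assumes S: "compact S" "S \<noteq> {}" and A: "continuous_on S A" and B: "continuous_on S B"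
    and A0: "\<And>x. x \<in> S \<Longrightarrow> A x \<ge> 0" and AB: "\<And>x. x \<in> S \<Longrightarrow> A x = 0 \<Longrightarrow> B x > 0"
  obtains \<mu> t0 where "\<mu> > 0" "t0 > 0" "\<And>x t. x \<in> S \<Longrightarrow> 0 \<le> t \<Longrightarrow> t \<le> t0 \<Longrightarrow> A x + t * B x \<ge> \<mu> * t"
proof -
  have "continuous_on S (\<lambda>x. max (A x) (B x))" by (intro continuous_intros A B)
  then obtain y where y: "y \<in> S" "\<And>x. x \<in> S \<Longrightarrow> max (A y) (B y) \<le> max (A x) (B x)"
    using continuous_attains_inf[OF S] by blast
  define \<mu> where "\<mu> = max (A y) (B y)"
  have \<mu>: "\<mu> > 0" using A0[OF y(1)] AB[OF y(1)] by (cases "A y = 0") (auto simp: \<mu>_def less_max_iff_disj)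
  have "continuous_on S (\<lambda>x. \<bar>B x\<bar>)" by (intro continuous_intros B)
  then obtain x0 where x0: "x0 \<in> S" "\<And>x. x \<in> S \<Longrightarrow> \<bar>B x\<bar> \<le> \<bar>B x0\<bar>"
    using continuous_attains_sup[OF S] by blast
  define b where "b = \<bar>B x0\<bar>"
  define t0 where "t0 = \<mu> / (\<mu> + b)"
  show ?thesis
  proof (rule that[OF \<mu>])
    show "t0 > 0" using \<mu> by (simp add: t0_def b_def add_pos_nonneg)
    fix x t assume x: "x \<in> S" and t: "0 \<le> t" "t \<le> t0"
    show "A x + t * B x \<ge> \<mu> * t"
    proof (cases "B x \<ge> \<mu>")
      case True
      hence "t * \<mu> \<le> t * B x" using t by (intro mult_left_mono) auto
      thus ?thesis using A0[OF x] by (simp add: mult.commute)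
    next
      case False
      hence "A x \<ge> \<mu>" using y(2)[OF x] unfolding \<mu>_def by linarith
      moreover have "t * B x \<ge> t * (- b)" using x0(2)[OF x] t by (intro mult_left_mono) (auto simp: b_def)
      moreover have "t * (\<mu> + b) \<le> \<mu>" using t \<mu> by (simp add: t0_def b_def field_simps add_pos_nonneg)
      ultimately show ?thesis by (simp add: algebra_simps)
    qed
  qed
qed

text \<open>The smallness condition says that the derivative at 0 vanishes; by continuity it is
  small on a ball, and the mean value inequality applies there.\<close>

lemma C1_on_small_lipschitz:
  fixes g :: "complex \<Rightarrow> complex"
  assumes g: "C1_on (ball 0 r0) g" and r0: "r0 > 0" and g0: "g 0 = 0"
    and small: "\<And>c. c > 0 \<Longrightarrow> \<forall>\<^sub>F z in at 0. norm (g z) \<le> c * norm z" and k: "k > 0"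
  shows "\<exists>\<delta>>0. \<delta> \<le> r0 \<and> (\<forall>z\<in>ball 0 \<delta>. \<forall>a\<in>ball 0 \<delta>. norm (g z - g a) \<le> k * norm (z - a))"
proof -
  obtain g' where g': "\<And>z. z \<in> ball 0 r0 \<Longrightarrow> (g has_derivative blinfun_apply (g' z)) (at z)"
    and cg': "continuous_on (ball 0 r0) g'" using g unfolding C1_on_def by blast
  have d0: "(g has_derivative (\<lambda>_. 0)) (at 0)"
    unfolding has_derivative_at
  proof (intro conjI)
    have "((\<lambda>h. norm (g h) / norm h) \<longlongrightarrow> 0) (at 0)"
    proof (rule tendstoI)
      fix e :: real assume e: "e > 0"
      have "\<forall>\<^sub>F z in at 0. norm (g z) \<le> e / 2 * norm z" using e by (intro small) simp
      moreover have "\<forall>\<^sub>F z in at (0::complex). z \<noteq> 0" by (simp add: eventually_at_filter)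
      ultimately show "\<forall>\<^sub>F z in at 0. dist (norm (g z) / norm z) 0 < e"
      proof eventually_elim
        case (elim z)
        moreover have "e * norm z > 0" using e elim by simp
        ultimately have "norm (g z) < e * norm z" by simp
        thus ?case using elim by (simp add: dist_norm divide_less_eq)
      qed
    qed
    thus "(\<lambda>h. norm (g (0 + h) - g 0 - 0) / norm h) \<midarrow>0\<rightarrow> 0" by (simp add: g0)
  qed simp
  have "blinfun_apply (g' 0) = (\<lambda>_. 0)" by (rule has_derivative_unique[OF g' d0]) (use r0 in simp)
  hence g'0: "g' 0 = 0" by (intro blinfun_eqI) simp
  have "isCont g' 0" using cg' r0 by (simp add: continuous_on_eq_continuous_at)
  then obtain d where d0: "d > 0" "\<forall>z. dist z 0 < d \<longrightarrow> dist (g' z) (g' 0) < k"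
    unfolding continuous_at_eps_delta using k by blast
  have d: "d > 0" "\<And>z. norm z < d \<Longrightarrow> norm (g' z) < k" using d0 by (simp_all add: g'0)
  define \<delta> where "\<delta> = min d r0"
  have "norm (g z - g a) \<le> k * norm (z - a)" if "z \<in> ball 0 \<delta>" "a \<in> ball 0 \<delta>" for z a
  proof (rule differentiable_bound[where S = "ball 0 \<delta>" and f' = "\<lambda>x. blinfun_apply (g' x)"])
    fix x :: complex assume x: "x \<in> ball 0 \<delta>"
    show "(g has_derivative blinfun_apply (g' x)) (at x within ball 0 \<delta>)"
      by (rule has_derivative_at_withinI[OF g']) (use x in \<open>simp add: \<delta>_def\<close>)
    show "onorm (blinfun_apply (g' x)) \<le> k"
      using d(2)[of x] x by (simp add: \<delta>_def norm_blinfun.rep_eq[symmetric])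
  qed (use that in auto)
  thus ?thesis using d r0 by (intro exI[of _ \<delta>]) (auto simp: \<delta>_def)
qed

lemma homogeneous_zero:
  fixes g :: "complex \<Rightarrow> complex" and m :: real
  assumes "\<And>z t. t > 0 \<Longrightarrow> g (of_real t * z) = of_real (t powr m) * g z" "m > 0"
  shows "g 0 = 0"
proof -
  have "g 0 = of_real (2 powr m) * g 0" using assms(1)[of 2 0] by simp
  moreover have "2 powr m \<noteq> (1::real)" using assms(2) by simp
  hence "complex_of_real (2 powr m) \<noteq> 1" by (metis of_real_eq_1_iff)
  ultimately show ?thesis by (metis mult_cancel_right1)
qed

lemma homogeneous_bound:
  fixes g :: "complex \<Rightarrow> complex" and m :: real
  assumes hom: "\<And>z t. t > 0 \<Longrightarrow> g (of_real t * z) = of_real (t powr m) * g z" and m: "m > 0"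
    and cont: "continuous_on (sphere 0 1) g"
  obtains G where "G > 0" "\<And>z. norm (g z) \<le> G * norm z powr m"
proof -
  have "bounded (g ` sphere 0 1)" using cont by (intro compact_imp_bounded compact_continuous_image) auto
  then obtain G where G: "G > 0" "\<And>z. norm z = 1 \<Longrightarrow> norm (g z) \<le> G" unfolding bounded_pos by auto
  have "norm (g z) \<le> G * norm z powr m" for z
  proof (cases "z = 0")
    case True thus ?thesis using homogeneous_zero[OF hom m] by simp
  next
    case False
    have "g z = g (of_real (norm z) * (z / of_real (norm z)))" using False by simp
    also have "\<dots> = of_real (norm z powr m) * g (z / of_real (norm z))" using False by (intro hom) simp
    finally have "norm (g z) = norm z powr m * norm (g (z / of_real (norm z)))"
      by (metis abs_of_nonneg norm_mult norm_of_real powr_ge_zero)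
    also have "\<dots> \<le> norm z powr m * G" using False by (intro mult_left_mono G) (auto simp: norm_divide)
    finally show ?thesis by (simp add: mult.commute)
  qed
  thus ?thesis using that G(1) by blast
qed

text \<open>In units of \<rho>^(2s) u, with \<rho> = |z| and u = \<rho>^m, the first-order terms in
  g contribute at least \<mu>, those in \<open>e\<close> at most \<mu> / 4, and the quadratic
  remainders at most a multiple of \<rho>^(m-3), again kept below \<mu> / 4.\<close>

lemma Im_hpoly_sum_pos:
  fixes g :: "complex \<Rightarrow> complex" and m :: real and s :: nat
  assumes hom: "\<And>z t. t > 0 \<Longrightarrow> g (of_real t * z) = of_real (t powr m) * g z"
    and cont: "continuous_on (sphere 0 1) g" and m: "m > 3" and s: "s \<ge> 1"
    and p: "complex_symmetric p (2 * s - 1)" and q: "complex_symmetric q (Suc (2 * s))"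
    and c1: "\<And>z. z \<in> sphere 0 1 \<Longrightarrow> Im (dpoly2_at p (2 * s - 1) z * g z) \<ge> 0"
    and c2: "\<And>z. z \<in> sphere 0 1 \<Longrightarrow> Im (dpoly2_at p (2 * s - 1) z * g z) = 0 \<Longrightarrow>
                   Im (dpoly2_at q (Suc (2 * s)) z * g z) > 0"
  obtains \<epsilon> \<delta> where "\<epsilon> > 0" "\<delta> > 0"
    "\<And>z e. 0 < norm z \<Longrightarrow> norm z < \<delta> \<Longrightarrow> norm e \<le> \<epsilon> * ((norm z)\<^sup>2 * norm z powr m) \<Longrightarrow>
       Im (hpoly p (2 * s - 1) z (cnj z + (g z + e)) + hpoly q (Suc (2 * s)) z (cnj z + (g z + e))) > 0"
proof -
  define dp dq where "dp = dpoly2_at p (2 * s - 1)" and "dq = dpoly2_at q (Suc (2 * s))"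
  define A B where "A = (\<lambda>z. Im (dp z * g z))" and "B = (\<lambda>z. Im (dq z * g z))"
  obtain \<mu> t0 where \<mu>: "\<mu> > 0" and t0: "t0 > 0"
    and AB: "\<And>x t. x \<in> sphere 0 1 \<Longrightarrow> 0 \<le> t \<Longrightarrow> t \<le> t0 \<Longrightarrow> A x + t * B x \<ge> \<mu> * t"
  proof (rule max_pos_imp_linear_lower_bound[of "sphere (0::complex) 1" A B])
    show "continuous_on (sphere 0 1) A" "continuous_on (sphere 0 1) B"
      unfolding A_def B_def dp_def dq_def by (intro continuous_intros dpoly2_at_cont cont)+
  qed (use c1 c2 in \<open>auto simp: A_def B_def dp_def dq_def\<close>)
  obtain G where G: "G > 0" "\<And>z. norm (g z) \<le> G * norm z powr m"
    using homogeneous_bound[OF hom _ cont] m by auto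
  define Kp where "Kp = (\<Sum>k\<le>2 * s - 1. norm (p k) * 4 ^ (2 * s - 1))"
  define Kq where "Kq = (\<Sum>k\<le>Suc (2 * s). norm (q k) * 4 ^ Suc (2 * s))"
  define Lp where "Lp = (\<Sum>k\<le>2 * s - 1. norm (p k) * real (2 * s - 1))"
  define Lq where "Lq = (\<Sum>k\<le>Suc (2 * s). norm (q k) * real (Suc (2 * s)))"
  have K0: "Kp \<ge> 0" "Kq \<ge> 0" "Lp \<ge> 0" "Lq \<ge> 0"
    unfolding Kp_def Kq_def Lp_def Lq_def by (intro sum_nonneg mult_nonneg_nonneg; simp)+
  define \<epsilon> where "\<epsilon> = min 1 (\<mu> / (4 * (Lp + Lq + 1)))"
  have \<epsilon>: "\<epsilon> > 0" "\<epsilon> \<le> 1" "(Lp + Lq) * \<epsilon> \<le> \<mu> / 4"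
  proof -
    show "\<epsilon> > 0" "\<epsilon> \<le> 1" using \<mu> K0 by (auto simp: \<epsilon>_def)
    have "(Lp + Lq) * \<epsilon> \<le> (Lp + Lq + 1) * (\<mu> / (4 * (Lp + Lq + 1)))"
      using K0 \<open>\<epsilon> > 0\<close> by (intro mult_mono) (auto simp: \<epsilon>_def)
    also have "\<dots> = \<mu> / 4" using K0 by (simp add: divide_simps)
    finally show "(Lp + Lq) * \<epsilon> \<le> \<mu> / 4" .
  qed
  define Q where "Q = (Kp + Kq) * (G + 1)\<^sup>2"
  have Q0: "Q \<ge> 0" using K0 by (simp add: Q_def)
  \<comment> \<open>A bound for \<open>v = \<rho> powr (m - 3)\<close>: its first entry gives |E|
    \<le> |z|, as \<open>hpoly_taylor\<close> requires, the second one tames the quadratic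
    remainder.\<close>
  define v0 where "v0 = min (1 / (G + 1)) (\<mu> / (4 * (Q + 1)))"
  have v0: "v0 > 0" "(G + 1) * v0 \<le> 1" "Q * v0 \<le> \<mu> / 4"
  proof -
    show "v0 > 0" using \<mu> Q0 G by (auto simp: v0_def)
    have "(G + 1) * v0 \<le> (G + 1) * (1 / (G + 1))" using G by (intro mult_left_mono) (auto simp: v0_def)
    thus "(G + 1) * v0 \<le> 1" using G by simp
    have "Q * v0 \<le> (Q + 1) * (\<mu> / (4 * (Q + 1)))" using Q0 \<open>v0 > 0\<close> by (intro mult_mono) (auto simp: v0_def)
    also have "\<dots> = \<mu> / 4" using Q0 by (simp add: divide_simps)
    finally show "Q * v0 \<le> \<mu> / 4" .
  qed
  define \<delta> where "\<delta> = min 1 (min (sqrt t0) (v0 powr (1 / (m - 3))))"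
  have \<delta>: "\<delta> > 0" using t0 v0 by (simp add: \<delta>_def)
  show ?thesis
  proof (rule that[OF \<epsilon>(1) \<delta>])
    fix z e :: complex
    assume z: "0 < norm z" "norm z < \<delta>" and e: "norm e \<le> \<epsilon> * ((norm z)\<^sup>2 * norm z powr m)"
    define \<rho> u v where "\<rho> = norm z" and "u = \<rho> powr m" and "v = \<rho> powr (m - 3)"
    have \<rho>: "0 < \<rho>" "\<rho> \<le> 1" "\<rho>\<^sup>2 \<le> t0"
    proof -
      show "0 < \<rho>" "\<rho> \<le> 1" using z by (auto simp: \<rho>_def \<delta>_def)
      have "\<rho> \<le> sqrt t0" using z by (auto simp: \<rho>_def \<delta>_def)
      hence "\<rho>\<^sup>2 \<le> (sqrt t0)\<^sup>2" using \<open>0 < \<rho>\<close> by (intro power_mono) auto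
      thus "\<rho>\<^sup>2 \<le> t0" using t0 by simp
    qed
    have u: "u > 0" using \<rho> by (simp add: u_def)
    have uv: "u = \<rho> ^ 3 * v"
    proof -
      have "u = \<rho> powr 3 * \<rho> powr (m - 3)" by (simp add: u_def flip: powr_add)
      thus ?thesis using \<rho> by (simp add: v_def powr_numeral)
    qed
    have v: "0 < v" "v \<le> v0"
    proof -
      show "0 < v" using \<rho> by (simp add: v_def)
      have "\<rho> \<le> v0 powr (1 / (m - 3))" using z by (auto simp: \<rho>_def \<delta>_def)
      hence "v \<le> (v0 powr (1 / (m - 3))) powr (m - 3)" unfolding v_def using \<rho> m by (intro powr_mono2) auto
      also have "\<dots> = v0" using v0 m by (simp add: powr_powr)
      finally show "v \<le> v0" .
    qed
    define E where "E = g z + e"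
    have ne: "norm e \<le> \<epsilon> * (\<rho>\<^sup>2 * u)" using e by (simp add: \<rho>_def u_def)
    have "\<epsilon> * (\<rho>\<^sup>2 * u) \<le> 1 * (1 * u)" using \<epsilon> \<rho> u by (intro mult_mono) (auto simp: power_le_one)
    hence E: "norm E \<le> (G + 1) * u"
      using norm_triangle_ineq[of "g z" e] G(2)[of z] ne by (simp add: E_def u_def \<rho>_def algebra_simps)
    have "(G + 1) * u = \<rho> ^ 3 * ((G + 1) * v)" by (simp add: uv)
    also have "\<dots> \<le> \<rho> ^ 1 * 1"
    proof (intro mult_mono power_decreasing)
      have "(G + 1) * v \<le> (G + 1) * v0" using v G by (intro mult_left_mono) auto
      thus "(G + 1) * v \<le> 1" using v0 by simp
    qed (use \<rho> v G in auto)
    finally have E\<rho>: "norm E \<le> norm z" using E by (simp add: \<rho>_def)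
    define Rp where "Rp = hpoly p (2 * s - 1) z (cnj z + E) - hpoly p (2 * s - 1) z (cnj z) - dp z * E"
    define Rq where "Rq = hpoly q (Suc (2 * s)) z (cnj z + E) - hpoly q (Suc (2 * s)) z (cnj z) - dq z * E"
    have "\<rho>\<^sup>2 * norm Rp \<le> Kp * \<rho> ^ (2 * s - 1) * (norm E)\<^sup>2"
      using hpoly_taylor[OF E\<rho>, of p "2 * s - 1"] by (simp add: Rp_def dp_def Kp_def \<rho>_def)
    moreover have "\<rho>\<^sup>2 * norm Rq \<le> Kq * \<rho> ^ (2 * s - 1) * (norm E)\<^sup>2"
    proof -
      have "\<rho>\<^sup>2 * norm Rq \<le> Kq * \<rho> ^ Suc (2 * s) * (norm E)\<^sup>2"
        using hpoly_taylor[OF E\<rho>, of q "Suc (2 * s)"] by (simp add: Rq_def dq_def Kq_def \<rho>_def)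
      also have "\<dots> \<le> Kq * \<rho> ^ (2 * s - 1) * (norm E)\<^sup>2"
        using K0 \<rho> by (intro mult_right_mono mult_left_mono power_decreasing) auto
      finally show ?thesis .
    qed
    ultimately have "\<rho>\<^sup>2 * (norm Rp + norm Rq) \<le> (Kp + Kq) * \<rho> ^ (2 * s - 1) * (norm E)\<^sup>2"
      by (simp add: algebra_simps)
    also have "\<dots> \<le> (Kp + Kq) * \<rho> ^ (2 * s - 1) * ((G + 1) * u)\<^sup>2"
      using K0 \<rho> E by (intro mult_left_mono power_mono) auto
    also have "\<dots> = \<rho>\<^sup>2 * (Q * v * (\<rho> ^ (2 * s) * u))"
    proof -
      have "\<rho> ^ (2 * s - 1) * \<rho> ^ 3 = \<rho>\<^sup>2 * \<rho> ^ (2 * s)"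
        unfolding power_add[symmetric] using s by (intro arg_cong[where f = "\<lambda>n. \<rho> ^ n"]) simp
      hence "\<rho> ^ (2 * s - 1) * (u * u) = \<rho>\<^sup>2 * (v * (\<rho> ^ (2 * s) * u))" by (subst (1) uv) (simp add: mult_ac)
      hence "Q * (\<rho> ^ (2 * s - 1) * (u * u)) = Q * (\<rho>\<^sup>2 * (v * (\<rho> ^ (2 * s) * u)))" by (simp only:)
      thus ?thesis unfolding Q_def power_mult_distrib power2_eq_square[of u] by (simp only: mult_ac)
    qed
    finally have "norm Rp + norm Rq \<le> Q * v * (\<rho> ^ (2 * s) * u)" using \<rho> by simp
    also have "\<dots> \<le> \<mu> / 4 * (\<rho> ^ (2 * s) * u)"
    proof (rule mult_right_mono)
      have "Q * v \<le> Q * v0" using v Q0 by (intro mult_left_mono) auto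
      thus "Q * v \<le> \<mu> / 4" using v0 by simp
    qed (use \<rho> u in auto)
    finally have R: "norm Rp + norm Rq \<le> \<mu> / 4 * (\<rho> ^ (2 * s) * u)" .
    \<comment> \<open>The factor \<open>\<rho>\<^sup>2\<close> in the bound on \<open>e\<close>
      makes up for \<open>dp\<close> having degree two less than \<open>dq\<close>.\<close>
    have "norm (dp z * e) \<le> Lp * \<rho> ^ (2 * s - 2) * (\<epsilon> * (\<rho>\<^sup>2 * u))"
      using dpoly2_at_bound[of "2 * s - 1" p z] s ne K0 \<rho> unfolding norm_mult
      by (intro mult_mono) (auto simp: dp_def Lp_def \<rho>_def numeral_2_eq_2)
    also have "\<dots> = Lp * \<epsilon> * (\<rho> ^ (2 * s) * u)"
    proof -
      have "\<rho> ^ (2 * s) = \<rho> ^ (2 * s - 2) * \<rho>\<^sup>2"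
        unfolding power_add[symmetric] using s by (intro arg_cong[where f = "\<lambda>n. \<rho> ^ n"]) simp
      thus ?thesis by simp
    qed
    finally have dpe: "norm (dp z * e) \<le> Lp * \<epsilon> * (\<rho> ^ (2 * s) * u)" .
    have "norm (dq z * e) \<le> Lq * \<rho> ^ (2 * s) * (\<epsilon> * (1 * u))"
    proof -
      have "\<epsilon> * (\<rho>\<^sup>2 * u) \<le> \<epsilon> * (1 * u)" using \<epsilon> \<rho> u by (intro mult_left_mono mult_right_mono) (auto simp: power_le_one)
      hence "norm e \<le> \<epsilon> * (1 * u)" using ne by linarith
      thus ?thesis using dpoly2_at_bound[of "Suc (2 * s)" q z] K0 \<rho> unfolding norm_mult
        by (intro mult_mono) (auto simp: dq_def Lq_def \<rho>_def)
    qed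
    hence dqe: "norm (dq z * e) \<le> Lq * \<epsilon> * (\<rho> ^ (2 * s) * u)" by (simp add: mult_ac)
    have "norm (dp z * e) + norm (dq z * e) \<le> (Lp + Lq) * \<epsilon> * (\<rho> ^ (2 * s) * u)"
      using dpe dqe by (simp add: algebra_simps)
    also have "\<dots> \<le> \<mu> / 4 * (\<rho> ^ (2 * s) * u)" using \<epsilon> \<rho> u by (intro mult_right_mono) auto
    finally have de: "norm (dp z * e) + norm (dq z * e) \<le> \<mu> / 4 * (\<rho> ^ (2 * s) * u)" .
    \<comment> \<open>Scaling to the unit circle leaves the factor \<rho>^(2s-2) u in front of A +
      \<rho>^2 B, so \<open>AB\<close> applies with t = \<rho>^2.\<close>
    have main: "Im (dp z * g z) + Im (dq z * g z) \<ge> \<mu> * (\<rho> ^ (2 * s) * u)"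
    proof -
      define \<zeta> where "\<zeta> = z / of_real \<rho>"
      have z\<zeta>: "z = of_real \<rho> * \<zeta>" using \<rho> by (simp add: \<zeta>_def)
      have \<zeta>: "\<zeta> \<in> sphere 0 1" using \<rho> by (simp add: \<zeta>_def norm_divide \<rho>_def)
      have gz: "g z = of_real u * g \<zeta>" unfolding u_def by (subst z\<zeta>) (rule hom[OF \<rho>(1)])
      have e1: "2 * s - 1 - 1 = 2 * s - 2" and e2: "Suc (2 * s) - 1 = 2 * s" by auto
      have dpz: "dp z = of_real (\<rho> ^ (2 * s - 2)) * dp \<zeta>"
        unfolding dp_def e1[symmetric] by (subst z\<zeta>, rule dpoly2_at_homogeneous) (use s in simp)
      have dqz: "dq z = of_real (\<rho> ^ (2 * s)) * dq \<zeta>"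
        unfolding dq_def using dpoly2_at_homogeneous[of "Suc (2 * s)" q \<rho> \<zeta>] by (simp only: z\<zeta>[symmetric] e2)
      have Im_scale: "Im (of_real t * x) = t * Im x" for t x by simp
      have "dp z * g z = of_real (\<rho> ^ (2 * s - 2) * u) * (dp \<zeta> * g \<zeta>)"
        unfolding gz dpz of_real_mult by (simp only: mult_ac)
      hence ip: "Im (dp z * g z) = \<rho> ^ (2 * s - 2) * u * A \<zeta>" unfolding A_def by (simp only: Im_scale)
      have "dq z * g z = of_real (\<rho> ^ (2 * s) * u) * (dq \<zeta> * g \<zeta>)"
        unfolding gz dqz of_real_mult by (simp only: mult_ac)
      hence iq: "Im (dq z * g z) = \<rho> ^ (2 * s) * u * B \<zeta>" unfolding B_def by (simp only: Im_scale)
      have r2: "\<rho> ^ (2 * s) = \<rho> ^ (2 * s - 2) * \<rho>\<^sup>2"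
        unfolding power_add[symmetric] using s by (intro arg_cong[where f = "\<lambda>n. \<rho> ^ n"]) simp
      have "\<mu> * (\<rho> ^ (2 * s) * u) = \<rho> ^ (2 * s - 2) * u * (\<mu> * \<rho>\<^sup>2)" unfolding r2 by simp
      also have "\<dots> \<le> \<rho> ^ (2 * s - 2) * u * (A \<zeta> + \<rho>\<^sup>2 * B \<zeta>)"
        using AB[OF \<zeta>, of "\<rho>\<^sup>2"] \<rho> u by (intro mult_left_mono) auto
      also have "\<dots> = Im (dp z * g z) + Im (dq z * g z)" unfolding ip iq r2 by (simp add: algebra_simps)
      finally show ?thesis .
    qed
    have "Im (hpoly p (2 * s - 1) z (cnj z + E) + hpoly q (Suc (2 * s)) z (cnj z + E))
        = Im (dp z * g z) + Im (dq z * g z) + Im (dp z * e) + Im (dq z * e) + Im Rp + Im Rq"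
    proof -
      have "hpoly p (2 * s - 1) z (cnj z + E) + hpoly q (Suc (2 * s)) z (cnj z + E)
          = hpoly p (2 * s - 1) z (cnj z) + hpoly q (Suc (2 * s)) z (cnj z)
            + (dp z * g z + dq z * g z + dp z * e + dq z * e + Rp + Rq)"
        by (simp add: Rp_def Rq_def E_def algebra_simps)
      hence "Im (hpoly p (2 * s - 1) z (cnj z + E) + hpoly q (Suc (2 * s)) z (cnj z + E))
          = Im (hpoly p (2 * s - 1) z (cnj z)) + Im (hpoly q (Suc (2 * s)) z (cnj z))
            + (Im (dp z * g z) + Im (dq z * g z) + Im (dp z * e) + Im (dq z * e) + Im Rp + Im Rq)"
        by (simp only: plus_complex.sel)
      thus ?thesis by (simp only: Im_hpoly_cnj[OF p] Im_hpoly_cnj[OF q] add_0)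
    qed
    moreover have "\<mu> * (\<rho> ^ (2 * s) * u) > 0" using \<mu> \<rho> u by simp
    ultimately show "Im (hpoly p (2 * s - 1) z (cnj z + (g z + e)) + hpoly q (Suc (2 * s)) z (cnj z + (g z + e))) > 0"
      unfolding E_def[symmetric]
      using main R de abs_Im_le_cmod[of "dp z * e"] abs_Im_le_cmod[of "dq z * e"] abs_Im_le_cmod[of Rp] abs_Im_le_cmod[of Rq]
      by linarith
  qed
qed

text \<open>The iteration solves \<open>\<eta> + F (z, \<eta>) = w\<close>: it removes the holomorphic perturbation \<open>F\<close>
  from \<open>w\<close> up to an error of any prescribed order.\<close>

primrec eta :: "(complex \<times> complex \<Rightarrow> complex) \<Rightarrow> (complex \<Rightarrow> complex) \<Rightarrow> nat \<Rightarrow> complex \<Rightarrow> complex" where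
  "eta F w 0 z = w z"
| "eta F w (Suc k) z = w z - F (z, eta F w k z)"

text \<open>The new error is F (z, cnj z) - F (z, \<eta>), and \<open>F\<close> has Lipschitz
  constant O(|z|^4) at this scale. The distance of \<eta> from cnj z consists of the old error and
  of g + h: the former gains |z|^4 in each step, the latter leaves the persistent term |z|^4
  |z|^m.\<close>

lemma eta_estimate:
  fixes F :: "complex \<times> complex \<Rightarrow> complex" and g h w :: "complex \<Rightarrow> complex" and m :: real
  assumes F: "holomorphic2_on (ball 0 r0) F" and FC: "\<And>w. w \<in> ball 0 r0 \<Longrightarrow> norm (F w) \<le> C * norm w ^ 5"
    and C: "C \<ge> 0" and r0: "r0 > 0" and m: "m > 3"
    and G: "G > 0" "\<And>z. norm (g z) \<le> G * norm z powr m"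
    and h: "\<delta>1 > 0" "\<And>z. norm z < \<delta>1 \<Longrightarrow> norm (h z) \<le> (norm z)\<^sup>2 * (G * norm z powr m)"
    and w: "w = (\<lambda>z. cnj z + F (z, cnj z) + g z + h z)"
  shows "\<exists>K\<ge>0. \<exists>\<delta>>0. \<forall>z. norm z < \<delta> \<longrightarrow>
      norm (eta F w k z - (cnj z + g z + h z)) \<le> K * (norm z ^ (4 * k + 5) + norm z ^ 4 * norm z powr m)
      \<and> norm (eta F w k z) \<le> 2 * norm z"
proof -
  define u where "u = (\<lambda>z::complex. norm z powr m)"
  define \<delta>2 where "\<delta>2 = min \<delta>1 (min 1 (r0 / 8))"
  have \<delta>2: "\<delta>2 > 0" using h r0 by (simp add: \<delta>2_def)
  have u: "0 \<le> u z" "u z \<le> norm z ^ 3" "u z \<le> 1" if "norm z < \<delta>2" for z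
  proof -
    have z1: "norm z \<le> 1" using that by (simp add: \<delta>2_def)
    show "0 \<le> u z" by (simp add: u_def)
    show "u z \<le> norm z ^ 3"
    proof (cases "z = 0")
      case False
      have "norm z powr m \<le> norm z powr 3" using False z1 m by (intro powr_mono') auto
      thus ?thesis using False by (simp add: u_def powr_numeral)
    qed (simp add: u_def)
    also have "norm z ^ 3 \<le> 1" using z1 by (simp add: power_le_one)
    finally show "u z \<le> 1" .
  qed
  have gh: "norm (g z + h z) \<le> 2 * G * u z" if z: "norm z < \<delta>2" for z
  proof -
    have "norm (h z) \<le> (norm z)\<^sup>2 * (G * u z)" using h(2)[of z] z by (simp add: \<delta>2_def u_def)
    also have "\<dots> \<le> 1 * (G * u z)" using z G u[OF z] by (intro mult_right_mono) (auto simp: \<delta>2_def power_le_one)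
    finally show ?thesis using G(2)[of z] norm_triangle_ineq[of "g z" "h z"] by (simp add: u_def)
  qed
  \<comment> \<open>The error bound implies |\<eta>| \<le> 2 |z| on a smaller disk, which keeps (z,
    \<eta>) within reach of the Lipschitz estimate in the next step.\<close>
  have dbl: "\<exists>\<delta>>0. \<delta> \<le> \<delta>2 \<and> (\<forall>z. norm z < \<delta> \<longrightarrow> norm (x z) \<le> 2 * norm z)"
    if K: "K \<ge> 0" and \<delta>: "\<delta> > 0" "\<delta> \<le> \<delta>2"
      and x: "\<And>z. norm z < \<delta> \<Longrightarrow> norm (x z - (cnj z + g z + h z)) \<le> K * (norm z ^ (4 * k + 5) + norm z ^ 4 * u z)"
    for K \<delta> k and x :: "complex \<Rightarrow> complex"
  proof -
    define \<delta>' where "\<delta>' = min \<delta> (1 / (1 + 2 * G + 2 * K))"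
    have "norm (x z) \<le> 2 * norm z" if z: "norm z < \<delta>'" for z
    proof -
      have z2: "norm z < \<delta>" "norm z < \<delta>2" using z \<delta> by (auto simp: \<delta>'_def)
      have z1: "norm z \<le> 1" using z2 by (simp add: \<delta>2_def)
      have "norm z \<le> 1 / (1 + 2 * G + 2 * K)" using z by (simp add: \<delta>'_def)
      hence "norm z * (1 + 2 * G + 2 * K) \<le> 1" using G K by (simp add: pos_le_divide_eq)
      hence sm: "(2 * G + 2 * K) * norm z \<le> 1" using norm_ge_zero[of z] by (simp add: algebra_simps del: norm_ge_zero)
      have "norm z ^ (4 * k + 5) \<le> norm z ^ 3" using z1 by (intro power_decreasing) auto
      moreover have "norm z ^ 4 * u z \<le> norm z ^ 3 * 1" using z1 u[OF z2(2)] by (intro mult_mono power_decreasing) auto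
      ultimately have "K * (norm z ^ (4 * k + 5) + norm z ^ 4 * u z) \<le> K * (2 * norm z ^ 3)"
        using K by (intro mult_left_mono) auto
      moreover have "2 * G * u z \<le> 2 * G * norm z ^ 3" using G u[OF z2(2)] by (intro mult_left_mono) auto
      moreover have "norm (x z) \<le> norm (x z - (cnj z + g z + h z)) + norm (cnj z) + norm (g z + h z)"
        using norm_triangle_ineq[of "x z - (cnj z + g z + h z)" "cnj z + (g z + h z)"]
          norm_triangle_ineq[of "cnj z" "g z + h z"] by (simp add: algebra_simps)
      ultimately have "norm (x z) \<le> norm z + (2 * G + 2 * K) * norm z ^ 3"
        using x[OF z2(1)] gh[OF z2(2)] by (simp add: algebra_simps)
      also have "(2 * G + 2 * K) * norm z ^ 3 \<le> (2 * G + 2 * K) * (norm z * norm z)"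
        using G K z1 by (intro mult_left_mono) (auto simp: power3_eq_cube mult_left_le)
      also have "\<dots> = (2 * G + 2 * K) * norm z * norm z" by simp
      also have "\<dots> \<le> 1 * norm z" using sm by (intro mult_right_mono) auto
      finally show ?thesis by simp
    qed
    moreover have "\<delta>' > 0" "\<delta>' \<le> \<delta>2" using \<delta> G K by (auto simp: \<delta>'_def)
    ultimately show ?thesis by (intro exI[of _ \<delta>']) auto
  qed
  have "\<exists>K\<ge>0. \<exists>\<delta>>0. \<delta> \<le> \<delta>2 \<and> (\<forall>z. norm z < \<delta> \<longrightarrow>
      norm (eta F w k z - (cnj z + g z + h z)) \<le> K * (norm z ^ (4 * k + 5) + norm z ^ 4 * u z))"
  proof (induction k)
    case 0
    have "norm (eta F w 0 z - (cnj z + g z + h z)) \<le> C * 2 ^ 5 * (norm z ^ (4 * 0 + 5) + norm z ^ 4 * u z)"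
      if z: "norm z < \<delta>2" for z
    proof -
      have n: "norm (z, cnj z) \<le> 2 * norm z" using norm_Pair_le[of z "cnj z"] by simp
      have "eta F w 0 z - (cnj z + g z + h z) = F (z, cnj z)" by (simp add: w)
      also have "norm \<dots> \<le> C * norm (z, cnj z) ^ 5" by (rule FC) (use n z r0 in \<open>simp add: \<delta>2_def\<close>)
      also have "\<dots> \<le> C * (2 * norm z) ^ 5" using n C by (intro mult_left_mono power_mono) auto
      also have "\<dots> = C * 2 ^ 5 * norm z ^ 5" by (simp add: power_mult_distrib)
      also have "\<dots> \<le> C * 2 ^ 5 * (norm z ^ (4 * 0 + 5) + norm z ^ 4 * u z)"
        using C u[OF z] by (intro mult_left_mono) auto
      finally show ?thesis .
    qed
    thus ?case using C \<delta>2 by (intro exI[of _ "C * 2 ^ 5"] conjI exI[of _ \<delta>2]) auto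
  next
    case (Suc k)
    then obtain K \<delta> where K: "K \<ge> 0" and \<delta>: "\<delta> > 0" "\<delta> \<le> \<delta>2"
      and x: "\<And>z. norm z < \<delta> \<Longrightarrow> norm (eta F w k z - (cnj z + g z + h z)) \<le> K * (norm z ^ (4 * k + 5) + norm z ^ 4 * u z)"
      by auto
    obtain \<delta>3 where \<delta>3: "\<delta>3 > 0" "\<delta>3 \<le> \<delta>2" "\<And>z. norm z < \<delta>3 \<Longrightarrow> norm (eta F w k z) \<le> 2 * norm z"
      using dbl[OF K \<delta> x] by auto
    define L where "L = 2 * C * 8 ^ 4"
    have L: "L \<ge> 0" using C by (simp add: L_def)
    have "norm (eta F w (Suc k) z - (cnj z + g z + h z)) \<le> L * (K + 2 * G) * (norm z ^ (4 * Suc k + 5) + norm z ^ 4 * u z)"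
      if z: "norm z < min \<delta> \<delta>3" for z
    proof (cases "z = 0")
      case True
      have "g 0 = 0" using G(2)[of 0] by simp
      moreover have "h 0 = 0" using h(2)[of 0] h(1) by simp
      moreover have "F (0, 0) = 0" using FC[of "(0, 0)"] r0 by (simp flip: zero_prod_def)
      moreover have "eta F w k 0 = 0" using \<delta>3(3)[of 0] \<delta>3(1) by simp
      ultimately show ?thesis using True by (simp add: w u_def power_0_left)
    next
      case False
      have zn: "norm z > 0" using False by simp
      have z2: "norm z < \<delta>2" "norm z < \<delta>" "norm z < \<delta>3" using z \<delta> by auto
      have z1: "norm z \<le> 1" using z2 by (simp add: \<delta>2_def)
      \<comment> \<open>The Lipschitz estimate is used with \<rho> = 8 |z|, at most
        \<open>r0\<close> by the choice of \<delta>2. Both points have norm at most 3 |z|, hence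
        less than \<rho> / 2; strictness is why z = 0 is a separate case.\<close>
      have n1: "norm (z, cnj z) < 8 * norm z / 2" using norm_Pair_le[of z "cnj z"] zn unfolding complex_mod_cnj by linarith
      have n2: "norm (z, eta F w k z) < 8 * norm z / 2"
        using norm_Pair_le[of z "eta F w k z"] \<delta>3(3)[OF z2(3)] zn by linarith
      have "eta F w (Suc k) z - (cnj z + g z + h z) = F (z, cnj z) - F (z, eta F w k z)" by (simp add: w)
      also have "norm \<dots> \<le> 2 * C * (8 * norm z) ^ 4 * norm ((z, cnj z) - (z, eta F w k z))"
        by (rule holomorphic2_lipschitz[OF F FC C]) (use z2 False n1 n2 in \<open>auto simp: \<delta>2_def\<close>)
      also have "\<dots> = L * norm z ^ 4 * norm (eta F w k z - cnj z)"
        by (simp add: L_def power_mult_distrib norm_Pair norm_minus_commute)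
      also have "norm (eta F w k z - cnj z) \<le> K * (norm z ^ (4 * k + 5) + norm z ^ 4 * u z) + 2 * G * u z"
        using norm_triangle_ineq[of "eta F w k z - (cnj z + g z + h z)" "g z + h z"] x[OF z2(2)] gh[OF z2(1)]
        by (simp add: algebra_simps)
      also have "\<dots> \<le> (K + 2 * G) * (norm z ^ (4 * k + 5) + u z)"
      proof -
        have "K * (norm z ^ 4 * u z) \<le> K * (1 * u z)"
          using K u[OF z2(1)] z1 by (intro mult_left_mono mult_right_mono) (auto simp: power_le_one)
        moreover have "0 \<le> 2 * G * norm z ^ (4 * k + 5)" using G by simp
        ultimately show ?thesis by (simp add: algebra_simps)
      qed
      finally have "norm (eta F w (Suc k) z - (cnj z + g z + h z)) \<le> L * norm z ^ 4 * ((K + 2 * G) * (norm z ^ (4 * k + 5) + u z))"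
        using L by (simp add: mult_left_mono)
      also have "\<dots> = L * (K + 2 * G) * (norm z ^ (4 * Suc k + 5) + norm z ^ 4 * u z)"
        by (simp add: algebra_simps power_add)
      finally show ?thesis .
    qed
    moreover have "L * (K + 2 * G) \<ge> 0" "min \<delta> \<delta>3 > 0" "min \<delta> \<delta>3 \<le> \<delta>2" using L K G \<delta> \<delta>3 by auto
    ultimately show ?case by blast
  qed
  then obtain K \<delta> where K: "K \<ge> 0" and \<delta>: "\<delta> > 0" "\<delta> \<le> \<delta>2"
    and x: "\<And>z. norm z < \<delta> \<Longrightarrow> norm (eta F w k z - (cnj z + g z + h z)) \<le> K * (norm z ^ (4 * k + 5) + norm z ^ 4 * u z)"
    by auto
  obtain \<delta>3 where \<delta>3: "\<delta>3 > 0" "\<delta>3 \<le> \<delta>2" "\<And>z. norm z < \<delta>3 \<Longrightarrow> norm (eta F w k z) \<le> 2 * norm z"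
    using dbl[OF K \<delta> x] by auto
  show ?thesis using K \<delta> \<delta>3 x unfolding u_def
    by (intro exI[of _ K] conjI exI[of _ "min \<delta> \<delta>3"]) auto
qed

section \<open>Density\<close>

text \<open>Because \<open>F\<close> is odd, the odd part of an approximating polynomial
  approximates it equally well: the two errors, at a point and at its negative, are
  averaged.\<close>

lemma (in graded_algebra) Odd_holomorphic2:
  assumes F: "holomorphic2_on (ball 0 r0) F" and FM: "\<And>w. w \<in> ball 0 r0 \<Longrightarrow> norm (F w) \<le> M"
    and odd: "\<And>w. w \<in> ball 0 r0 \<Longrightarrow> F (- w) = - F w" and r0: "r0 > 0"
    and u: "u \<in> Odd" "\<And>z. z \<in> D \<Longrightarrow> norm (u z) \<le> r0 / 6"
    and v: "v \<in> Odd" "\<And>z. z \<in> D \<Longrightarrow> norm (v z) \<le> r0 / 6"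
  shows "(\<lambda>z. F (u z, v z)) \<in> Odd"
proof (rule Odd_closed)
  fix e :: real assume e: "e > 0"
  obtain P where P: "\<And>z w. z \<in> cball 0 (r0/6) \<Longrightarrow> w \<in> cball 0 (r0/6) \<Longrightarrow> norm (F (z, w) - poly2 P z w) < e"
    using holomorphic2_poly_approx[OF F FM r0 e] by meson
  have "norm (F (u z, v z) - (poly2 P (u z) (v z) - poly2 P (- u z) (- v z)) / 2) < e" if z: "z \<in> D" for z
  proof -
    have "(u z, v z) \<in> ball 0 r0" using norm_Pair_le[of "u z" "v z"] u(2)[OF z] v(2)[OF z] r0 by simp
    hence o: "F (- u z, - v z) = - F (u z, v z)" using odd[of "(u z, v z)"] by simp
    have "norm (F (u z, v z) - poly2 P (u z) (v z)) < e" "norm (F (- u z, - v z) - poly2 P (- u z) (- v z)) < e"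
      using u(2)[OF z] v(2)[OF z] by (auto intro!: P)
    hence "norm ((F (u z, v z) - poly2 P (u z) (v z)) - (F (- u z, - v z) - poly2 P (- u z) (- v z))) < 2 * e"
      using norm_triangle_ineq4[of "F (u z, v z) - poly2 P (u z) (v z)" "F (- u z, - v z) - poly2 P (- u z) (- v z)"]
      by linarith
    moreover have "F (u z, v z) - (poly2 P (u z) (v z) - poly2 P (- u z) (- v z)) / 2
        = ((F (u z, v z) - poly2 P (u z) (v z)) - (F (- u z, - v z) - poly2 P (- u z) (- v z))) / 2"
      unfolding o by (simp add: field_simps)
    ultimately show ?thesis by (simp only: norm_divide) simp
  qed
  thus "\<exists>x\<in>Odd. \<forall>z\<in>D. norm (F (u z, v z) - x z) < e"
    by (intro bexI[OF _ Odd_poly2[OF u(1) v(1), of P]] ballI)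
qed

lemma (in graded_algebra) Odd_eta:
  assumes F: "holomorphic2_on (ball 0 r0) F" and FM: "\<And>w. w \<in> ball 0 r0 \<Longrightarrow> norm (F w) \<le> M"
    and odd: "\<And>w. w \<in> ball 0 r0 \<Longrightarrow> F (- w) = - F w" and r0: "r0 > 0"
    and id: "f1 = (\<lambda>z. z)" "\<And>z. z \<in> D \<Longrightarrow> norm z \<le> r0 / 6"
    and eta: "\<And>j z. j \<le> k \<Longrightarrow> z \<in> D \<Longrightarrow> norm (eta F f2 j z) \<le> r0 / 6"
  shows "eta F f2 k \<in> Odd"
  using eta
proof (induction k)
  case 0
  have "eta F f2 0 = f2" by (simp add: fun_eq_iff)
  thus ?case using Odd_gens(2) by simp
next
  case (Suc k)
  have "eta F f2 k \<in> Odd" by (rule Suc.IH, rule Suc.prems) auto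
  moreover have "(\<lambda>z. z) \<in> Odd" using Odd_gens(1) id(1) by (simp only:)
  ultimately have "(\<lambda>z. F (z, eta F f2 k z)) \<in> Odd"
    by (intro Odd_holomorphic2[OF F FM odd r0] id(2) Suc.prems) auto
  from Odd_diff[OF Odd_gens(2) this] show ?case by (simp add: fun_eq_iff[symmetric] eta.simps(2)[abs_def])
qed

text \<open>The quotient \<open>u / \<Psi>\<close> is regularised to \<open>u * cnj \<Psi> / (\<bar>\<Psi>\<bar>\<^sup>2 + t)\<close>.\<close>

lemma (in uniform_algebra) all_continuous_if_multiples:
  assumes \<Psi>: "continuous_on D \<Psi>" "\<And>z. z \<in> D \<Longrightarrow> z \<noteq> 0 \<Longrightarrow> \<Psi> z \<noteq> 0"
    and mul: "\<And>u. continuous_on D u \<Longrightarrow> (\<lambda>z. \<Psi> z * u z) \<in> A"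
    and \<phi>: "continuous_on D \<phi>"
  shows "\<phi> \<in> A"
proof -
  \<comment> \<open>Normalised to vanish at 0, the only point of \<open>D\<close> where \<Psi> may
    vanish; the constant is added back at the end.\<close>
  define u where "u = (\<lambda>z. \<phi> z - \<phi> 0)"
  have u: "continuous_on D u" unfolding u_def by (intro continuous_intros \<phi>)
  have "bounded (u ` D)" using u compact_D compact_continuous_image compact_imp_bounded by blast
  then obtain M where M: "M > 0" "\<And>z. z \<in> D \<Longrightarrow> norm (u z) \<le> M" unfolding bounded_pos by auto
  have "u \<in> A"
  proof (rule closed)
    fix e :: real assume e: "e > 0"
    define S where "S = {z \<in> D. e / 2 \<le> norm (u z)}"
    have "S = D \<inter> (\<lambda>z. norm (u z)) -` {e / 2..}" by (auto simp: S_def)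
    moreover have "closed D" using compact_D by (rule compact_imp_closed)
    ultimately have "closed S"
      using continuous_on_closed_vimage[of D "\<lambda>z. norm (u z)"] u
      by (auto intro: continuous_on_norm simp: Int_commute)
    hence S: "compact S" using compact_Int_closed[OF compact_D, of S] by (auto simp: S_def Int_absorb1 Int_def)
    have nz: "\<Psi> z \<noteq> 0" if "z \<in> S" for z
      using \<Psi>(2)[of z] that e by (cases "z = 0") (auto simp: S_def u_def)
    obtain c where c: "c > 0" "\<And>z. z \<in> S \<Longrightarrow> c \<le> (norm (\<Psi> z))\<^sup>2"
    proof (cases "S = {}")
      case True thus ?thesis using that[of 1] by simp
    next
      case False
      have "continuous_on S (\<lambda>z. (norm (\<Psi> z))\<^sup>2)"
        by (intro continuous_intros continuous_on_subset[OF \<Psi>(1)]) (auto simp: S_def)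
      from continuous_attains_inf[OF S False this] obtain y
        where "y \<in> S" "\<And>z. z \<in> S \<Longrightarrow> (norm (\<Psi> y))\<^sup>2 \<le> (norm (\<Psi> z))\<^sup>2" by blast
      thus ?thesis using that[of "(norm (\<Psi> y))\<^sup>2"] nz[of y] by simp
    qed
    \<comment> \<open>On \<open>S\<close> the regularisation error is at most M t / c = e / 2; off
      \<open>S\<close> it is bounded by |u| itself, which is below e / 2.\<close>
    define t where "t = c * e / (2 * M)"
    have t: "t > 0" using c e M by (simp add: t_def)
    have den: "(norm (\<Psi> z))\<^sup>2 + t > 0" for z using t by (simp add: add_nonneg_pos)
    define x where "x = (\<lambda>z. u z * cnj (\<Psi> z) / of_real ((norm (\<Psi> z))\<^sup>2 + t))"
    have "continuous_on D x" unfolding x_def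
    proof (intro continuous_intros u \<Psi>(1) ballI)
      fix z show "complex_of_real ((norm (\<Psi> z))\<^sup>2 + t) \<noteq> 0" unfolding of_real_eq_0_iff using den[of z] by simp
    qed
    hence "(\<lambda>z. \<Psi> z * x z) \<in> A" by (rule mul)
    moreover have "norm (u z - \<Psi> z * x z) < e" if z: "z \<in> D" for z
    proof -
      define N where "N = (norm (\<Psi> z))\<^sup>2"
      have N: "N \<ge> 0" "N + t > 0" using den[of z] by (auto simp: N_def)
      have "\<Psi> z * cnj (\<Psi> z) = of_real N" unfolding N_def by (rule complex_norm_square[symmetric])
      moreover have "\<Psi> z * x z = u z * (\<Psi> z * cnj (\<Psi> z)) / of_real (N + t)"
        by (simp add: x_def N_def mult_ac)
      ultimately have \<Psi>x: "\<Psi> z * x z = u z * of_real N / of_real (N + t)" by (simp only:)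
      have nz': "complex_of_real (N + t) \<noteq> 0" unfolding of_real_eq_0_iff using N(2) by simp
      have "u z * of_real (t / (N + t)) = u z * (of_real (N + t) - of_real N) / of_real (N + t)" by simp
      also have "\<dots> = u z - \<Psi> z * x z"
        unfolding \<Psi>x using nz' by (simp add: right_diff_distrib diff_divide_distrib del: of_real_add)
      finally have "u z - \<Psi> z * x z = u z * of_real (t / (N + t))" ..
      hence eq: "norm (u z - \<Psi> z * x z) = norm (u z) * (t / (N + t))"
        using N t by (simp only: norm_mult norm_of_real abs_of_nonneg divide_nonneg_nonneg less_imp_le)
      show ?thesis
      proof (cases "z \<in> S")
        case False
        have "norm (u z) * (t / (N + t)) \<le> norm (u z) * 1" using N t by (intro mult_left_mono) auto
        thus ?thesis using False z e unfolding eq by (simp add: S_def)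
      next
        case True
        hence "c \<le> N" using c by (simp add: N_def)
        hence "t / (N + t) \<le> t / c" using t c by (intro divide_left_mono) auto
        hence "norm (u z) * (t / (N + t)) \<le> M * (t / c)" using M(1) M(2)[OF z] N t by (intro mult_mono) auto
        also have "\<dots> = e / 2" using M c by (simp add: t_def)
        finally show ?thesis unfolding eq using e by linarith
      qed
    qed
    ultimately show "\<exists>v\<in>A. \<forall>z\<in>D. norm (u z - v z) < e" by (intro bexI[of _ "\<lambda>z. \<Psi> z * x z"] ballI)
  qed
  from add[OF this const[of "\<phi> 0"]] show ?thesis by (simp add: u_def)
qed

theorem theorem5p1:
  fixes F :: "complex \<times> complex \<Rightarrow> complex"
    and g h :: "complex \<Rightarrow> complex"
    and m :: real and s :: nat and r0 :: real
    and p q :: "nat \<Rightarrow> complex"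
  assumes r0: "r0 > 0"
    and F_hol: "holomorphic2_on (ball 0 r0) F"
    and F_odd: "\<forall>w\<in>ball 0 r0. F (- w) = - F w"
    and F_O5: "\<exists>C. \<forall>w\<in>ball 0 r0. norm (F w) \<le> C * norm w ^ 5"
    and g_C1: "C1_on (ball 0 r0) g"
    and g_even: "\<forall>z. g (- z) = g z"
    and g_hom: "\<forall>z. \<forall>t>0. g (complex_of_real t * z) = complex_of_real (t powr m) * g z"
    and m_gt: "m > 3"
    and s_ge: "s \<ge> 1"
    and a_sym: "complex_symmetric p (2 * s - 1)"
    and b_sym: "complex_symmetric q (Suc (2 * s))"
    and cond1: "\<forall>z\<in>sphere 0 1. Im (dpoly2_at p (2 * s - 1) z * g z) \<ge> 0"
    and cond2: "\<forall>z\<in>sphere 0 1. Im (dpoly2_at p (2 * s - 1) z * g z) = 0 \<longrightarrow>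
                   Im (dpoly2_at q (Suc (2 * s)) z * g z) > 0"
    and h_C1: "C1_on (ball 0 r0) h"
    and h_small: "h \<in> o[at 0](\<lambda>z. z^2 * g z)"
  shows "\<exists>\<delta>>0. \<forall>r. 0 < r \<and> r < \<delta> \<longrightarrow>
           poly_gen_dense (\<lambda>z. z^2)
             (\<lambda>z. (cnj z + F (z, cnj z) + g z + h z)^2) (cball 0 r)"
proof -

  \<comment> \<open>Behaviour of the data at the origin\<close>
  define w where "w = (\<lambda>z. cnj z + F (z, cnj z) + g z + h z)"
  obtain C where C: "C \<ge> 0" and FC: "\<And>x. x \<in> ball 0 r0 \<Longrightarrow> norm (F x) \<le> C * norm x ^ 5"
  proof -
    obtain C where C: "\<forall>x\<in>ball 0 r0. norm (F x) \<le> C * norm x ^ 5" using F_O5 by blast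
    have "norm (F x) \<le> max C 0 * norm x ^ 5" if "x \<in> ball 0 r0" for x
      using order_trans[OF bspec[OF C that] mult_right_mono[of C "max C 0" "norm x ^ 5"]] by simp
    thus ?thesis using that[of "max C 0"] by simp
  qed
  have FM: "norm (F x) \<le> C * r0 ^ 5" if "x \<in> ball 0 r0" for x
    using order_trans[OF FC[OF that] mult_left_mono[OF power_mono[of "norm x" r0 5] C]] that by simp
  have odd: "F (- x) = - F x" if "x \<in> ball 0 r0" for x using F_odd that by blast
  have hom: "g (of_real t * z) = of_real (t powr m) * g z" if "t > 0" for z t using g_hom that by blast
  have C1_cont: "continuous_on (ball 0 r0) f" if "C1_on (ball 0 r0) f" for f
  proof -
    from that obtain f' where "\<forall>z\<in>ball 0 r0. (f has_derivative blinfun_apply (f' z)) (at z)"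
      unfolding C1_on_def by blast
    thus ?thesis by (intro continuous_at_imp_continuous_on ballI has_derivative_continuous) blast
  qed
  \<comment> \<open>The ball on which \<open>g\<close> is known to be differentiable need not reach
    the unit circle; homogeneity transports continuity from the circle of radius r0 / 2.\<close>
  have g_sphere: "continuous_on (sphere 0 1) g"
  proof -
    have "continuous_on (sphere 0 1) (\<lambda>z. of_real ((r0 / 2) powr (- m)) * g (of_real (r0 / 2) * z))"
      using r0 by (intro continuous_intros continuous_on_compose2[OF C1_cont[OF g_C1]]) (auto simp: norm_mult norm_divide)
    moreover have "of_real ((r0 / 2) powr (- m)) * g (of_real (r0 / 2) * z) = g z" for z
    proof -
      have "(r0 / 2) powr (- m) * (r0 / 2) powr m = 1" using r0 by (simp flip: powr_add)
      hence "complex_of_real ((r0 / 2) powr (- m)) * of_real ((r0 / 2) powr m) = 1" by (metis of_real_1 of_real_mult)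
      thus ?thesis using hom[of "r0 / 2" z] r0 by (simp add: mult.assoc[symmetric])
    qed
    ultimately show ?thesis by (simp only:)
  qed
  have m0: "m > 0" using m_gt by simp
  obtain G where G: "G > 0" "\<And>z. norm (g z) \<le> G * norm z powr m" using homogeneous_bound[OF hom m0 g_sphere] by blast
  have g0: "g 0 = 0" by (rule homogeneous_zero[OF hom m0])
  have powr_le: "x powr m \<le> x ^ 3" if "0 \<le> x" "x \<le> 1" for x :: real
  proof (cases "x = 0")
    case False
    have "x powr m \<le> x powr 3" using that False m_gt by (intro powr_mono') auto
    thus ?thesis using that False by (simp add: powr_numeral)
  qed simp
  have g_ev: "\<forall>\<^sub>F z in at 0. norm (g z) \<le> c * norm z" if c: "c > 0" for c
    unfolding eventually_at
  proof (intro exI[of _ "min 1 (c / G)"] conjI ballI impI)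
    show "0 < min 1 (c / G)" using c G by simp
    fix z :: complex assume "z \<noteq> 0 \<and> dist z 0 < min 1 (c / G)"
    hence z: "norm z \<le> 1" "G * norm z \<le> c" using G(1) by (auto simp: field_simps)
    have "norm (g z) \<le> G * norm z ^ 3" using order_trans[OF G(2) mult_left_mono[OF powr_le]] z(1) G(1) by simp
    also have "\<dots> = G * norm z * norm z * norm z" by (simp add: power3_eq_cube)
    also have "\<dots> \<le> c * 1 * norm z" using z G c by (intro mult_mono) auto
    finally show "norm (g z) \<le> c * norm z" by simp
  qed
  have h_ev: "\<forall>\<^sub>F z in at 0. norm (h z) \<le> c * norm (z\<^sup>2 * g z)" if "c > 0" for c
    using landau_o.smallD[OF h_small that] by simp
  have h_lin: "\<forall>\<^sub>F z in at 0. norm (h z) \<le> c * norm z" if c: "c > 0" for c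
  proof -
    have "\<forall>\<^sub>F z::complex in at 0. norm z < 1" by (auto simp: eventually_at intro!: exI[of _ 1])
    with h_ev[of 1, simplified] g_ev[OF c] show ?thesis
    proof eventually_elim
      case (elim z)
      have "norm (z\<^sup>2 * g z) \<le> 1 * norm (g z)" unfolding norm_mult norm_power
        using elim by (intro mult_right_mono) (auto simp: power_le_one)
      thus ?case using elim by simp
    qed
  qed
  \<comment> \<open>The little-o condition at 0 says nothing about the value there; continuity of
    \<open>h\<close> supplies it.\<close>
  have h0: "h 0 = 0"
  proof -
    have "(h \<longlongrightarrow> 0) (at 0)"
    proof (rule Lim_null_comparison)
      show "\<forall>\<^sub>F z in at 0. norm (h z) \<le> norm z" using h_lin[of 1] by simp
      show "(norm \<longlongrightarrow> 0) (at (0::complex))" by (intro tendsto_eq_intros) auto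
    qed
    moreover have "(h \<longlongrightarrow> h 0) (at 0)"
      using C1_cont[OF h_C1] r0 by (simp add: continuous_on_eq_continuous_at isCont_def)
    ultimately show ?thesis by (metis LIM_unique)
  qed
  \<comment> \<open>Since \<open>g\<close> may have zeros, |g z| is replaced by its majorant G
    |z|^m, the scale on which positivity tolerates errors.\<close>
  have h_bound: "\<exists>d>0. \<forall>z. norm z < d \<longrightarrow> norm (h z) \<le> c * ((norm z)\<^sup>2 * (G * norm z powr m))" if c: "c > 0" for c
  proof -
    obtain d where d: "d > 0" "\<And>z. z \<noteq> 0 \<Longrightarrow> norm z < d \<Longrightarrow> norm (h z) \<le> c * norm (z\<^sup>2 * g z)"
      using h_ev[OF c] unfolding eventually_at by auto
    have "norm (h z) \<le> c * ((norm z)\<^sup>2 * (G * norm z powr m))" if "norm z < d" for z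
    proof (cases "z = 0")
      case False
      have "c * ((norm z)\<^sup>2 * norm (g z)) \<le> c * ((norm z)\<^sup>2 * (G * norm z powr m))"
        using c G(2) by (intro mult_left_mono) auto
      thus ?thesis using d(2)[OF False that] by (simp add: norm_mult norm_power)
    qed (simp add: h0)
    thus ?thesis using d(1) by blast
  qed
  obtain d1 where d1: "d1 > 0" "\<And>z. norm z < d1 \<Longrightarrow> norm (h z) \<le> (norm z)\<^sup>2 * (G * norm z powr m)"
    using h_bound[of 1] by auto

  \<comment> \<open>Positivity constants and length of the iteration\<close>
  obtain \<epsilon> dI where \<epsilon>: "\<epsilon> > 0" and dI: "dI > 0"
    and ImPos: "\<And>z e. 0 < norm z \<Longrightarrow> norm z < dI \<Longrightarrow> norm e \<le> \<epsilon> * ((norm z)\<^sup>2 * norm z powr m) \<Longrightarrow>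
       Im (hpoly p (2 * s - 1) z (cnj z + (g z + e)) + hpoly q (Suc (2 * s)) z (cnj z + (g z + e))) > 0"
    by (rule Im_hpoly_sum_pos[OF hom g_sphere m_gt s_ge a_sym b_sym]) (use cond1 cond2 in auto)
  \<comment> \<open>The tolerance \<epsilon> is split into two halves: one for \<open>h\<close>, the
    other for the error of the iteration.\<close>
  obtain dh where dh: "dh > 0" "\<And>z. norm z < dh \<Longrightarrow> norm (h z) \<le> \<epsilon> / (2 * G) * ((norm z)\<^sup>2 * (G * norm z powr m))"
    using h_bound[of "\<epsilon> / (2 * G)"] \<epsilon> G by auto

  \<comment> \<open>With 4n + 5 \<ge> m + 3, the term |z|^(4n+5) is at most |z|^3 |z|^m for |z|
    \<le> 1, so both error terms of the iteration are o(|z|^2 |z|^m).\<close>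
  define n where "n = nat \<lceil>m\<rceil>"
  have n: "real (4 * n + 5) \<ge> m + 3"
  proof -
    have "m \<le> real n" using m0 by (simp add: n_def real_nat_ceiling_ge)
    thus ?thesis by simp
  qed
  note eta_est = eta_estimate[OF F_hol FC C r0 m_gt G d1 w_def]
  have "\<forall>j. \<exists>d>0. \<forall>z. norm z < d \<longrightarrow> norm (eta F w j z) \<le> 2 * norm z"
    using eta_est by meson
  then obtain dl where dl: "\<And>j. dl j > 0" "\<And>j z. norm z < dl j \<Longrightarrow> norm (eta F w j z) \<le> 2 * norm z" by metis
  define dE where "dE = Min (dl ` {..n})"
  have dE: "dE > 0" "\<And>j. j \<le> n \<Longrightarrow> dE \<le> dl j" using dl(1) by (auto simp: dE_def)
  obtain K dK where K: "K \<ge> 0" and dK: "dK > 0"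
    and eK: "\<And>z. norm z < dK \<Longrightarrow>
      norm (eta F w n z - (cnj z + g z + h z)) \<le> K * (norm z ^ (4 * n + 5) + norm z ^ 4 * norm z powr m)"
    using eta_est[of n] by meson

  \<comment> \<open>Lipschitz distance from conjugation\<close>
  obtain k where k: "0 < k" and dense: "\<And>r w \<phi>. \<lbrakk>0 < r; \<And>z a. z \<in> cball 0 r \<Longrightarrow> a \<in> cball 0 r \<Longrightarrow> norm (w z - w a - cnj (z - a)) \<le> k * norm (z - a);
        continuous_on (cball 0 r) \<phi>\<rbrakk> \<Longrightarrow> \<phi> \<in> poly_closure (\<lambda>z. z) w (cball 0 r)"
    by (rule poly_closure_near_conjugation) blast
  \<comment> \<open>The bound \<open>k\<close> is for density, the bound 1/2 keeps z w in the right
    half-plane; a third of \<open>k0\<close> goes to each of F, g and h.\<close>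
  define k0 where "k0 = min k (1/2)"
  have k0: "0 < k0" "k0 \<le> k" "k0 \<le> 1/2" using k by (auto simp: k0_def)
  have k3: "k0 / 3 > 0" using k0 by simp
  obtain eg where eg: "eg > 0" "\<And>z a. z \<in> ball 0 eg \<Longrightarrow> a \<in> ball 0 eg \<Longrightarrow> norm (g z - g a) \<le> k0 / 3 * norm (z - a)"
    using C1_on_small_lipschitz[OF g_C1 r0 g0 g_ev k3] by blast
  obtain eh where eh: "eh > 0" "\<And>z a. z \<in> ball 0 eh \<Longrightarrow> a \<in> ball 0 eh \<Longrightarrow> norm (h z - h a) \<le> k0 / 3 * norm (z - a)"
    using C1_on_small_lipschitz[OF h_C1 r0 h0 h_lin k3] by blast
  define \<rho> where "\<rho> = min r0 (min 1 (k0 / (12 * C + 1)))"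
  have \<rho>: "0 < \<rho>" "\<rho> \<le> r0" "4 * C * \<rho> ^ 4 \<le> k0 / 3"
  proof -
    show "0 < \<rho>" "\<rho> \<le> r0" using r0 k0 C by (auto simp: \<rho>_def)
    have "\<rho> ^ 4 \<le> \<rho> ^ 1" using \<open>0 < \<rho>\<close> by (intro power_decreasing) (auto simp: \<rho>_def)
    hence "\<rho> ^ 4 \<le> k0 / (12 * C + 1)" by (simp add: \<rho>_def)
    hence "\<rho> ^ 4 * (12 * C + 1) \<le> k0" using C by (simp add: pos_le_divide_eq)
    moreover have "\<rho> ^ 4 > 0" using \<open>0 < \<rho>\<close> by (rule zero_less_power)
    moreover have "\<rho> ^ 4 * (12 * C + 1) = 3 * (4 * C * \<rho> ^ 4) + \<rho> ^ 4" by (simp add: algebra_simps)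
    ultimately show "4 * C * \<rho> ^ 4 \<le> k0 / 3" by linarith
  qed
  \<comment> \<open>The pair (z, cnj z) has norm at most 2 |z|, so the radius \<rho> / 4 puts it
    into the ball of radius \<rho> / 2.\<close>
  have F_lip: "norm (F (z, cnj z) - F (a, cnj a)) \<le> k0 / 3 * norm (z - a)"
    if "z \<in> ball 0 (\<rho> / 4)" "a \<in> ball 0 (\<rho> / 4)" for z a
  proof -
    have "norm (F (z, cnj z) - F (a, cnj a)) \<le> 2 * C * \<rho> ^ 4 * norm ((z, cnj z) - (a, cnj a))"
    proof (rule holomorphic2_lipschitz[OF F_hol FC C \<rho>(1,2)])
      show "(z, cnj z) \<in> ball 0 (\<rho> / 2)" "(a, cnj a) \<in> ball 0 (\<rho> / 2)"
        using norm_Pair_le[of z "cnj z"] norm_Pair_le[of a "cnj a"] that by auto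
    qed
    also have "\<dots> \<le> 2 * C * \<rho> ^ 4 * (2 * norm (z - a))"
      using norm_Pair_le[of "z - a" "cnj z - cnj a"] C complex_mod_cnj[of "z - a"] by (intro mult_left_mono) auto
    also have "\<dots> = 4 * C * \<rho> ^ 4 * norm (z - a)" by simp
    also have "\<dots> \<le> k0 / 3 * norm (z - a)" by (intro mult_right_mono \<rho>) auto
    finally show ?thesis .
  qed

  \<comment> \<open>The entry r0 / 12 together with |\<eta>| \<le> 2 |z| keeps all iterates within
    r0 / 6, where \<open>F\<close> is approximated by polynomials; \<epsilon> / (4 K + 1) holds the
    iteration error to half of the tolerance.\<close>
  define \<delta> where "\<delta> = Min {1, d1, dI, dh, dE, dK, eg, eh, \<rho> / 4, r0 / 12, \<epsilon> / (4 * K + 1)}"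
  have \<delta>: "\<delta> > 0" unfolding \<delta>_def
  proof (subst Min_gr_iff)
    show "\<forall>x\<in>{1, d1, dI, dh, dE, dK, eg, eh, \<rho> / 4, r0 / 12, \<epsilon> / (4 * K + 1)}. 0 < x"
      using d1(1) dI dh(1) dE(1) dK eg(1) eh(1) \<rho>(1) r0 \<epsilon> K by simp
  qed auto
  have \<delta>_le: "\<delta> \<le> x" if "x \<in> {1, d1, dI, dh, dE, dK, eg, eh, \<rho> / 4, r0 / 12, \<epsilon> / (4 * K + 1)}" for x
    unfolding \<delta>_def using that by (intro Min_le) auto
  have w_lip: "norm (w z - w a - cnj (z - a)) \<le> k0 * norm (z - a)" if z: "norm z < \<delta>" and a: "norm a < \<delta>" for z a
  proof -
    have "z \<in> ball 0 eg" "a \<in> ball 0 eg" using \<delta>_le[of eg] z a by auto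
    hence "norm (g z - g a) \<le> k0 / 3 * norm (z - a)" by (rule eg(2))
    moreover have "z \<in> ball 0 eh" "a \<in> ball 0 eh" using \<delta>_le[of eh] z a by auto
    hence "norm (h z - h a) \<le> k0 / 3 * norm (z - a)" by (rule eh(2))
    moreover have "z \<in> ball 0 (\<rho> / 4)" "a \<in> ball 0 (\<rho> / 4)" using \<delta>_le[of "\<rho> / 4"] z a by auto
    hence "norm (F (z, cnj z) - F (a, cnj a)) \<le> k0 / 3 * norm (z - a)" by (rule F_lip)
    moreover have "w z - w a - cnj (z - a) = (F (z, cnj z) - F (a, cnj a)) + (g z - g a) + (h z - h a)"
      by (simp add: w_def)
    ultimately show ?thesis
      using norm_triangle_ineq[of "(F (z, cnj z) - F (a, cnj a)) + (g z - g a)" "h z - h a"]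
        norm_triangle_ineq[of "F (z, cnj z) - F (a, cnj a)" "g z - g a"] by (simp only:)
  qed
  have w0: "w 0 = 0"
  proof -
    have "F (0, 0) = 0" using FC[of "(0, 0)"] r0 by (simp flip: zero_prod_def)
    thus ?thesis by (simp add: w_def g0 h0)
  qed
  define \<Psi> where "\<Psi> = (\<lambda>z. hpoly p (2 * s - 1) z (eta F w n z) + hpoly q (Suc (2 * s)) z (eta F w n z))"
  have \<Psi>_pos: "Im (\<Psi> z) > 0" if z: "z \<noteq> 0" "norm z < \<delta>" for z
  proof -
    \<comment> \<open>The positivity estimate is centred at cnj z + g z, so \<open>e\<close>
      collects both \<open>h\<close> and the error of the iteration.\<close>
    define e where "e = h z + (eta F w n z - (cnj z + g z + h z))"
    define t u where "t = norm z" and "u = t powr m"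
    have t: "0 < t" "t \<le> 1" using z \<delta>_le[of 1] by (auto simp: t_def)
    have u: "u > 0" using t by (simp add: u_def)
    have "norm (h z) \<le> \<epsilon> / (2 * G) * (t\<^sup>2 * (G * u))"
      unfolding t_def u_def using z \<delta>_le[of dh] by (intro dh(2)) auto
    hence hz: "norm (h z) \<le> \<epsilon> / 2 * (t\<^sup>2 * u)" using G(1) by simp
    have "t ^ (4 * n + 5) = t powr real (4 * n + 5)" using t by (simp only: powr_realpow)
    also have "\<dots> \<le> t powr (m + 3)" using t n by (intro powr_mono') auto
    also have "\<dots> = u * t ^ 3" using t by (simp add: u_def powr_add powr_numeral)
    finally have "t ^ (4 * n + 5) \<le> t ^ 3 * u" by (simp add: mult.commute)
    moreover have "t ^ 4 * u \<le> t ^ 3 * u" using t u by (intro mult_right_mono power_decreasing) auto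
    ultimately have "K * (t ^ (4 * n + 5) + t ^ 4 * u) \<le> K * (2 * (t ^ 3 * u))" using K by (intro mult_left_mono) auto
    also have "\<dots> = 2 * K * t * (t\<^sup>2 * u)" by (simp add: power3_eq_cube power2_eq_square)
    also have "\<dots> \<le> \<epsilon> / 2 * (t\<^sup>2 * u)"
    proof (rule mult_right_mono)
      have "t \<le> \<epsilon> / (4 * K + 1)" using z \<delta>_le[of "\<epsilon> / (4 * K + 1)"] by (simp add: t_def)
      hence "t * (4 * K + 1) \<le> \<epsilon>" using K by (simp add: pos_le_divide_eq)
      thus "2 * K * t \<le> \<epsilon> / 2" using t by (simp add: algebra_simps)
    qed (use u in auto)
    finally have "norm (eta F w n z - (cnj z + g z + h z)) \<le> \<epsilon> / 2 * (t\<^sup>2 * u)"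
      using eK[of z] z \<delta>_le[of dK] by (simp add: t_def u_def)
    hence "norm e \<le> \<epsilon> * (t\<^sup>2 * u)"
      using hz norm_triangle_ineq[of "h z" "eta F w n z - (cnj z + g z + h z)"] by (simp add: e_def)
    hence "Im (hpoly p (2 * s - 1) z (cnj z + (g z + e)) + hpoly q (Suc (2 * s)) z (cnj z + (g z + e))) > 0"
      using z \<delta>_le[of dI] by (intro ImPos) (auto simp: t_def u_def)
    moreover have "cnj z + (g z + e) = eta F w n z" by (simp add: e_def)
    ultimately show ?thesis by (simp only: \<Psi>_def)
  qed

  \<comment> \<open>Density on a fixed disk\<close>
  have main: "poly_gen_dense (\<lambda>z. z\<^sup>2) (\<lambda>z. (w z)\<^sup>2) (cball 0 r)" if r: "0 < r" "r < \<delta>" for r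
  proof -
    define D where "D = cball (0::complex) r"
    define A where "A = poly_closure (\<lambda>z. z\<^sup>2) (\<lambda>z. (w z)\<^sup>2) D"
    have Dd: "norm z < \<delta>" if "z \<in> D" for z using that r by (simp add: D_def)
    have w_cont: "continuous_on D w"
    proof -
      have "(k0 + 1)-lipschitz_on D w"
      proof (rule lipschitz_onI)
        fix z a assume "z \<in> D" "a \<in> D"
        hence "norm (w z - w a - cnj (z - a)) \<le> k0 * norm (z - a)" using Dd by (intro w_lip)
        moreover have "norm (w z - w a) \<le> norm (w z - w a - cnj (z - a)) + norm (cnj (z - a))"
          using norm_triangle_ineq[of "w z - w a - cnj (z - a)" "cnj (z - a)"] by simp
        ultimately show "dist (w z) (w a) \<le> (k0 + 1) * dist z a"
          unfolding complex_mod_cnj by (simp add: dist_norm distrib_right)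
      qed (use k0 in simp)
      thus ?thesis by (rule lipschitz_on_continuous_on)
    qed
    have D: "compact D" by (simp add: D_def)
    interpret uniform_algebra D A
      unfolding A_def using D w_cont by (intro uniform_algebra_poly_closure continuous_intros) auto
    have z2: "(\<lambda>z. z\<^sup>2) \<in> A" and w2: "(\<lambda>z. (w z)\<^sup>2) \<in> A"
      unfolding A_def by (rule poly_closure_gens)+
    have zw: "(\<lambda>z. z * w z) \<in> A"
    proof (rule square_root)
      show "continuous_on D (\<lambda>z. z * w z)" by (intro continuous_intros w_cont)
      show "(\<lambda>z. (z * w z)\<^sup>2) \<in> A" unfolding power_mult_distrib by (rule mult[OF z2 w2])
      fix z assume z: "z \<in> D"
      show "Re (z * w z) > 0 \<or> z * w z = 0"
      proof (cases "z = 0")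
        case False
        have "norm (w z - cnj z) \<le> k0 * norm z" using w_lip[of z 0] Dd[OF z] \<delta> w0 by simp
        hence "norm (w z - cnj z) \<le> 1/2 * norm z" using mult_right_mono[OF k0(3), of "norm z"] by simp
        hence "norm z * norm (w z - cnj z) \<le> norm z * (1/2 * norm z)" by (intro mult_left_mono) auto
        hence "norm (z * (w z - cnj z)) \<le> (norm z)\<^sup>2 / 2" by (simp add: norm_mult power2_eq_square)
        moreover have "z * w z = of_real ((norm z)\<^sup>2) + z * (w z - cnj z)"
          unfolding complex_norm_square by (simp add: algebra_simps)
        hence "Re (z * w z) = (norm z)\<^sup>2 + Re (z * (w z - cnj z))" by (simp only: plus_complex.sel Re_complex_of_real)
        moreover have "(norm z)\<^sup>2 > 0" using False by simp
        ultimately show ?thesis using abs_Re_le_cmod[of "z * (w z - cnj z)"] by linarith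
      qed simp
    qed
    interpret graded_algebra D A "\<lambda>z. z" w
      by unfold_locales (use w_cont z2 w2 zw in \<open>auto simp: power2_eq_square intro: continuous_intros\<close>)
    have eta_bd: "norm (eta F w j z) \<le> r0 / 6" if "j \<le> n" "z \<in> D" for j z
    proof -
      have "norm z < dl j" "norm z \<le> r0 / 12"
        using Dd[OF that(2)] dE(2)[OF that(1)] \<delta>_le[of dE] \<delta>_le[of "r0 / 12"] by auto
      thus ?thesis using dl(2)[of z j] by simp
    qed
    have eta_Odd: "eta F w n \<in> Odd"
    proof (rule Odd_eta[OF F_hol FM odd r0 refl])
      fix z assume "z \<in> D" thus "norm z \<le> r0 / 6" using Dd[of z] \<delta>_le[of "r0 / 12"] r0 by simp
    qed (use eta_bd in auto)
    have \<Psi>_Odd: "\<Psi> \<in> Odd" unfolding \<Psi>_def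
      using s_ge by (intro Odd_add Odd_hpoly eta_Odd Odd_gens(1)) auto
    have \<Psi>0: "\<Psi> 0 = 0"
    proof -
      have "eta F w n 0 = 0" using dl(2)[of 0 n] dl(1)[of n] by simp
      thus ?thesis using s_ge unfolding \<Psi>_def hpoly_def by (simp add: power_0_left sum.neutral)
    qed
    have \<Psi>_A: "\<Psi> \<in> A"
    proof -
      \<comment> \<open>Multiplication by -i turns the upper half-plane into the right one, as
        \<open>square_root\<close> requires.\<close>
      have "(\<lambda>z. - \<i> * \<Psi> z) \<in> A"
      proof (rule square_root)
        show "continuous_on D (\<lambda>z. - \<i> * \<Psi> z)" by (intro continuous_intros Odd_cont \<Psi>_Odd)
        have "(\<lambda>z. - 1 * (\<Psi> z * \<Psi> z)) \<in> A" by (intro mult[OF const] Odd_mult \<Psi>_Odd)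
        moreover have "(- \<i> * x)\<^sup>2 = - 1 * (x * x)" for x
          by (simp add: complex_eq_iff power2_eq_square)
        ultimately show "(\<lambda>z. (- \<i> * \<Psi> z)\<^sup>2) \<in> A" by (simp only:)
        fix z assume "z \<in> D"
        thus "Re (- \<i> * \<Psi> z) > 0 \<or> - \<i> * \<Psi> z = 0"
          using \<Psi>_pos[of z] Dd \<Psi>0 by (cases "z = 0") auto
      qed
      from mult[OF const[of \<i>] this] show ?thesis by (simp add: mult.assoc[symmetric])
    qed
    have all: "\<phi> \<in> poly_closure (\<lambda>z. z) w D" if "continuous_on D \<phi>" for \<phi>
      unfolding D_def
    proof (rule dense[OF r(1)])
      fix z a :: complex assume "z \<in> cball 0 r" "a \<in> cball 0 r"
      hence "norm (w z - w a - cnj (z - a)) \<le> k0 * norm (z - a)" using r by (intro w_lip) auto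
      also have "\<dots> \<le> k * norm (z - a)" by (intro mult_right_mono k0) auto
      finally show "norm (w z - w a - cnj (z - a)) \<le> k * norm (z - a)" .
    qed (use that in \<open>simp add: D_def\<close>)
    have "\<phi> \<in> A" if "continuous_on D \<phi>" for \<phi>
    proof (rule all_continuous_if_multiples[OF Odd_cont[OF \<Psi>_Odd] _ _ that])
      show "\<Psi> z \<noteq> 0" if "z \<in> D" "z \<noteq> 0" for z using \<Psi>_pos[of z] that Dd by force
      show "(\<lambda>z. \<Psi> z * u z) \<in> A" if "continuous_on D u" for u
        by (rule mult_poly_closure[OF \<Psi>_Odd \<Psi>_A all[OF that]])
    qed
    thus ?thesis unfolding poly_gen_dense_iff A_def D_def by blast
  qed
  show ?thesis using \<delta> main unfolding w_def by blast
qed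

end
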